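(* Let $r,s\in\mathbb Z_+$, $a_1,\dots,a_r,b_1,\dots,b_s\in\mathfrak h^{\mathcal B}\cup\mathfrak h^{\mathcal F}$, $m_1,\dots,m_r,n_1,\dots,n_s\in\mathbb Z_+$. Then, as series of operators on $V$, $$\begin{aligned}&:a_1^{(m_1-1)}(x_1)\cdots a_r^{(m_r-1)}(x_r):\cdot:b_1^{(n_1-1)}(y_1)\cdots b_s^{(n_s-1)}(y_s):\\&=\sum_{\rho,\eta=0}^{\min(r,s)}\ \sum_{I^b\in A^{\mathcal B}_\eta,\,J^b\in B^{\mathcal B}_\eta}\operatorname{perm}\Bigl(\ell_{\mathcal B}(a_{i^b_\alpha},b_{j^b_\beta})F^{\mathcal B}_{m_{i^b_\alpha}n_{j^b_\beta}}(x_{i^b_\alpha},y_{j^b_\beta})\Bigr)_{\alpha,\beta=1}^{\eta}\\&\quad\cdot\sum_{I^f\in A^{\mathcal F}_\rho,\,J^f\in B^{\mathcal F}_\rho}(-1)^{r^{\mathcal F}(i^f_1)+\cdots+r^{\mathcal F}(i^f_\rho)+s^{\mathcal F}(j^f_1)+\cdots+s^{\mathcal F}(j^f_\rho)}(-1)^{r^{\mathcal F}\rho+\frac{\rho(\rho+1)}2}\\&\qquad\cdot\det\Bigl(\ell_{\mathcal F}(a_{i^f_\gamma},b_{j^f_\delta})F^{\mathcal F}_{m_{i^f_\gamma}n_{j^f_\delta}}(x_{i^f_\gamma},y_{j^f_\delta})\Bigr)_{\gamma,\delta=1}^{\rho}\\&\qquad\cdot:a_1^{(m_1-1)}(x_1)\cdots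 a_r^{(m_r-1)}(x_r)b_1^{(n_1-1)}(y_1)\cdots b_s^{(n_s-1)}(y_s):_{O(I^b,I^f,J^b,J^f)},\end{aligned}$$ where the rational functions $F^{\mathcal B}_{mn}(x_i,y_j)$, $F^{\mathcal F}_{mn}(x_i,y_j)$ are expanded in nonnegative powers of $y_j$.
   Context: **The space $V$.** $\mathbb N=\{0,1,\dots\}$, $\mathbb Z_+=\{1,2,\dots\}$. Let $\mathfrak h$ be a finite-dimensional complex vector space with a nondegenerate symmetric bilinear form $(\cdot,\cdot)$; $\mathfrak h^{\mathcal B},\mathfrak h^{\mathcal F}$ are two copies of $\mathfrak h$, mutually orthogonal in $\mathfrak h^{\mathcal B}\oplus\mathfrak h^{\mathcal F}$; $|a|=0$ for $a\in\mathfrak h^{\mathcal B}$, $|a|=1$ for $a\in\mathfrak h^{\mathcal F}$. Let $\widehat{\mathfrak h}_{\mathbb Z/2}=(\mathfrak h^{\mathcal B}\otimes\mathbb C[t,t^{-1}])\oplus(\mathfrak h^{\mathcal F}\otimes t^{1/2}\mathbb C[t,t^{-1}])\oplus\mathbb C\mathbf k_{\mathcal B}\oplus\mathbb C\mathbf k_{\mathcal F}$. Its tensor algebra is $\mathbb Z_2$-graded with $a\otimes t^{k+|a|/2}$ of parity $|a|$ and $\mathbf k_{\mathcal B},\mathbf k_{\mathcal F}$ even; $[u,v]=uv-(-1)^{|u||v|}vu$. Let $N$ be its quotient by the two-sided ideal generated by: $[\mathbf k_{\mathcal B},\mathbf k_{\mathcal F}]$; $[a\otimes t^{k+|a|/2},\mathbf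 k_{\mathcal B}]$, $[a\otimes t^{k+|a|/2},\mathbf k_{\mathcal F}]$ ($a\in\mathfrak h^{\mathcal B}\cup\mathfrak h^{\mathcal F}$, $k\in\mathbb Z$); $[a\otimes t^k,b\otimes t^0]$ ($a,b\in\mathfrak h^{\mathcal B}$, $k\ne0$); $[a\otimes t^{k+1/2},b\otimes t^0]$ ($a\in\mathfrak h^{\mathcal F},b\in\mathfrak h^{\mathcal B},k\in\mathbb Z$); $[a\otimes t^m,b\otimes t^n]-m(a,b)\delta_{m+n,0}\mathbf k_{\mathcal B}$ ($a,b\in\mathfrak h^{\mathcal B}$, $m\in\mathbb Z_+,n\in-\mathbb Z_+$); $[a\otimes t^{m+1/2},b\otimes t^{n+1/2}]-(a,b)\delta_{m+n+1,0}\mathbf k_{\mathcal F}$ ($a,b\in\mathfrak h^{\mathcal F}$, $m\in\mathbb N,n\in-\mathbb Z_+$); $[a\otimes t^m,b\otimes t^{n+1/2}]$ ($a\in\mathfrak h^{\mathcal B},b\in\mathfrak h^{\mathcal F}$, with $m\in\mathbb Z_+,n\in-\mathbb Z_+$ or $m\in-\mathbb Z_+,n\in\mathbb N$). Fix $\ell_{\mathcal B},\ell_{\mathcal F}\in\mathbb C^\times$. Let $V=N\otimes_{N_{\ge0}}\mathbb C\mathbf 1$, where $N_{\ge0}$ is the subalgebra generated by all $a\otimes t^{n+|a|/2}$ with $n\ge0$ (acting as $0$ on $\mathbb C\mathbf 1$) and $\mathbf k_{\mathcal B},\mathbf k_{\mathcal F}$ (acting as $\ell_{\mathcal B},\ell_{\mathcal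 F}$). Write $a(m+|a|/2)$ for the action of $a\otimes t^{m+|a|/2}$ on $V$. **Fields and normal ordering.** $a(x)=\sum_{n\in\mathbb Z}a(n+|a|/2)x^{-n-1}$, $a^{(m)}(x)=\frac1{m!}\frac{d^m}{dx^m}a(x)$. $:\cdots:$ of a product of modes is the product rearranged as negative modes, then positive modes, then zero modes, keeping the original relative order in each group, times the sign of the induced permutation of the fermionic factors; it is extended coefficientwise to products of series. **Functions.** $F^{\mathcal B}_{mn}(x,y)=\frac1{(m-1)!(n-1)!}\partial_x^{m-1}\partial_y^{n-1}(x-y)^{-2}$, $F^{\mathcal F}_{mn}(x,y)=\frac1{(m-1)!(n-1)!}\partial_x^{m-1}\partial_y^{n-1}(x-y)^{-1}$. **Index notation.** $A^{\mathcal B}=\{i:a_i\in\mathfrak h^{\mathcal B}\}$, $A^{\mathcal F}=\{i:a_i\in\mathfrak h^{\mathcal F}\}$ (disjoint subsets of $\{1,\dots,r\}$), and $B^{\mathcal B},B^{\mathcal F}\subset\{1,\dots,s\}$ similarly for the $b_j$. $A^{\mathcal B}_\eta$ is the set of increasing $\eta$-tuples $I^b=(i^b_1<\cdots<i^b_\eta)$ in $A^{\mathcal B}$; $A^{\mathcal F}_\rho\ni I^f=(i_1^f<\cdots<i_\rho^f)$, $B^{\mathcal B}_\eta\ni J^b=(j^b_1<\cdots<j^b_\eta)$, $B^{\mathcal F}_\rho\ni J^f=(j^f_1<\cdots<j^f_\rho)$ are defined similarly (for length $0$: only the empty tuple). $r^{\mathcal F}=\#A^{\mathcal F}$, $r^{\mathcal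 F}(i)=\#\{j\le i:j\in A^{\mathcal F}\}$, $s^{\mathcal F}(j)=\#\{k\le j:k\in B^{\mathcal F}\}$. The subscript $O(I^b,I^f,J^b,J^f)$ means that the factors $a_i$ with index in $I^b$ or $I^f$ and $b_j$ with index in $J^b$ or $J^f$ are omitted before normal ordering. Permanent and determinant of the empty matrix are $1$. *)

theory Defs
  imports
    Complex_Main
    "HOL-Library.Poly_Mapping"
    "HOL-Library.Product_Plus"
    "HOL-Library.FuncSet"
    "HOL-Computational_Algebra.Formal_Laurent_Series"
    "HOL-Combinatorics.Permutations"
begin

section \<open>The free associative algebra on a set of letters\<close>

text \<open>Finitely supported functions on the free monoid, with the convolution product of
  \<^typ>\<open>'m::monoid_add \<Rightarrow>\<^sub>0 'c\<close>; the monoid of words is written additively for that purpose.\<close>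

datatype 'u fword = FWord (letters: "'u list")

instantiation fword :: (type) monoid_add
begin

definition zero_fword :: "'a fword" where
  "0 = FWord []"

definition plus_fword :: "'a fword \<Rightarrow> 'a fword \<Rightarrow> 'a fword" where
  "v + w = FWord (letters v @ letters w)"

instance
  by standard (simp_all add: zero_fword_def plus_fword_def)

end

type_synonym 'u free_alg = "'u fword \<Rightarrow>\<^sub>0 complex"

definition gen :: "'u \<Rightarrow> 'u free_alg" where
  "gen u = Poly_Mapping.single (FWord [u]) 1"

definition const :: "complex \<Rightarrow> 'u free_alg" where
  "const c = Poly_Mapping.single 0 c"


section \<open>The algebra $N$\<close>

text \<open>Elements of $\mathfrak h^{\mathcal B}\cup\mathfrak h^{\mathcal F}$, the two copies of
  $\mathfrak h$ being disjoint.\<close>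

datatype 'h bf = is_bos: Bos 'h | is_fer: Fer 'h

fun par :: "'h bf \<Rightarrow> nat" where
  "par (Bos u) = 0"
| "par (Fer u) = 1"

text \<open>The form on $\mathfrak h^{\mathcal B}\oplus\mathfrak h^{\mathcal F}$.\<close>

fun bf_form :: "('h \<Rightarrow> 'h \<Rightarrow> complex) \<Rightarrow> 'h bf \<Rightarrow> 'h bf \<Rightarrow> complex" where
  "bf_form form (Bos u) (Bos v) = form u v"
| "bf_form form (Fer u) (Fer v) = form u v"
| "bf_form form _ _ = 0"

text \<open>The vector space $\widehat{\mathfrak h}_{\mathbb Z/2}$. A tuple $(f,g,c,d)$ stands for
  $\sum_k f_k\otimes t^k+\sum_k g_k\otimes t^{k+1/2}+c\,\mathbf k_{\mathcal B}+d\,\mathbf k_{\mathcal F}$.\<close>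

type_synonym 'h hhat = "(int \<Rightarrow>\<^sub>0 'h) \<times> (int \<Rightarrow>\<^sub>0 'h) \<times> complex \<times> complex"

fun hhat_scale :: "(complex \<Rightarrow> 'h \<Rightarrow> 'h) \<Rightarrow> complex \<Rightarrow> 'h::ab_group_add hhat \<Rightarrow> 'h hhat" where
  "hhat_scale sc z (f, g, c, d) =
     (Poly_Mapping.map (sc z) f, Poly_Mapping.map (sc z) g, z * c, z * d)"

text \<open>\<open>mode a k\<close> is $a\otimes t^{k+|a|/2}$.\<close>

fun mode :: "'h bf \<Rightarrow> int \<Rightarrow> 'h::ab_group_add hhat" where
  "mode (Bos u) k = (Poly_Mapping.single k u, 0, 0, 0)"
| "mode (Fer u) k = (0, Poly_Mapping.single k u, 0, 0)"

definition kB :: "'h::ab_group_add hhat" where "kB = (0, 0, 1, 0)"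
definition kF :: "'h::ab_group_add hhat" where "kF = (0, 0, 0, 1)"

text \<open>The supercommutator of two letters of parities \<open>p\<close> and \<open>q\<close>.\<close>

definition scomm :: "nat \<Rightarrow> nat \<Rightarrow> 'u \<Rightarrow> 'u \<Rightarrow> 'u free_alg" where
  "scomm p q u v = gen u * gen v - (-1) ^ (p * q) * (gen v * gen u)"

text \<open>\<open>N_ideal\<close> is a two-sided ideal of the free algebra on the underlying set of
  $\widehat{\mathfrak h}_{\mathbb Z/2}$. The generators \<open>lin_add\<close> and \<open>lin_scale\<close> turn that free
  algebra into the tensor algebra of the vector space; the others are the relations of $N$.
  Thus $N$ is the quotient by \<open>N_ideal\<close>, and its elements are represented by elements of the
  free algebra.\<close>

inductive_set N_ideal :: "(complex \<Rightarrow> 'h \<Rightarrow> 'h) \<Rightarrow> ('h \<Rightarrow> 'h \<Rightarrow> complex) \<Rightarrow>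
    'h::ab_group_add hhat free_alg set"
  for sc :: "complex \<Rightarrow> 'h \<Rightarrow> 'h" and form :: "'h \<Rightarrow> 'h \<Rightarrow> complex"
where
  lin_add: "gen (u + v) - gen u - gen v \<in> N_ideal sc form"
| lin_scale: "gen (hhat_scale sc z u) - const z * gen u \<in> N_ideal sc form"
| kB_kF: "scomm 0 0 kB kF \<in> N_ideal sc form"
| mode_kB: "scomm (par a) 0 (mode a k) kB \<in> N_ideal sc form"
| mode_kF: "scomm (par a) 0 (mode a k) kF \<in> N_ideal sc form"
| bos_zero: "k \<noteq> 0 \<Longrightarrow> scomm 0 0 (mode (Bos u) k) (mode (Bos v) 0) \<in> N_ideal sc form"
| fer_zero: "scomm 1 0 (mode (Fer u) k) (mode (Bos v) 0) \<in> N_ideal sc form"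
| bos_bos: "m > 0 \<Longrightarrow> n < 0 \<Longrightarrow>
    scomm 0 0 (mode (Bos u) m) (mode (Bos v) n)
      - const (of_int m * form u v * (if m + n = 0 then 1 else 0)) * gen kB \<in> N_ideal sc form"
| fer_fer: "m \<ge> 0 \<Longrightarrow> n < 0 \<Longrightarrow>
    scomm 1 1 (mode (Fer u) m) (mode (Fer v) n)
      - const (form u v * (if m + n + 1 = 0 then 1 else 0)) * gen kF \<in> N_ideal sc form"
| bos_fer: "m > 0 \<and> n < 0 \<or> m < 0 \<and> n \<ge> 0 \<Longrightarrow>
    scomm 0 1 (mode (Bos u) m) (mode (Fer v) n) \<in> N_ideal sc form"
| add: "f \<in> N_ideal sc form \<Longrightarrow> g \<in> N_ideal sc form \<Longrightarrow> f + g \<in> N_ideal sc form"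
| mult_left: "f \<in> N_ideal sc form \<Longrightarrow> h * f \<in> N_ideal sc form"
| mult_right: "f \<in> N_ideal sc form \<Longrightarrow> f * h \<in> N_ideal sc form"


section \<open>The module $V=N\otimes_{N_{\ge0}}\mathbb C\mathbf 1$\<close>

text \<open>\<open>vac_char lB lF u c\<close>: \<open>u\<close> lies in the subalgebra $N_{\ge0}$ and acts on
  $\mathbb C\mathbf 1$ as the scalar \<open>c\<close>.\<close>

inductive vac_char :: "complex \<Rightarrow> complex \<Rightarrow> 'h::ab_group_add hhat free_alg \<Rightarrow> complex \<Rightarrow> bool"
  for lB lF :: complex
where
  mode: "n \<ge> 0 \<Longrightarrow> vac_char lB lF (gen (mode a n)) 0"
| kB: "vac_char lB lF (gen kB) lB"
| kF: "vac_char lB lF (gen kF) lF"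
| const: "vac_char lB lF (const c) c"
| add: "vac_char lB lF u c \<Longrightarrow> vac_char lB lF v d \<Longrightarrow> vac_char lB lF (u + v) (c + d)"
| mult: "vac_char lB lF u c \<Longrightarrow> vac_char lB lF v d \<Longrightarrow> vac_char lB lF (u * v) (c * d)"

text \<open>Since $N\otimes_{\mathbb C}\mathbb C\mathbf 1$ is $N$, the tensor product over $N_{\ge0}$ is the
  quotient of $N$ by the span of the elements $fu-cf$, which express
  $fu\otimes\mathbf 1=f\otimes u\mathbf 1=f\otimes c\mathbf 1$. \<open>V_ker\<close> is the preimage of this
  span in the free algebra.\<close>

inductive_set V_ker :: "(complex \<Rightarrow> 'h \<Rightarrow> 'h) \<Rightarrow> ('h \<Rightarrow> 'h \<Rightarrow> complex) \<Rightarrow> complex \<Rightarrow> complex \<Rightarrow>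
    'h::ab_group_add hhat free_alg set"
  for sc :: "complex \<Rightarrow> 'h \<Rightarrow> 'h" and form :: "'h \<Rightarrow> 'h \<Rightarrow> complex" and lB lF :: complex
where
  ideal: "f \<in> N_ideal sc form \<Longrightarrow> f \<in> V_ker sc form lB lF"
| balanced: "vac_char lB lF u c \<Longrightarrow> f * u - const c * f \<in> V_ker sc form lB lF"
| add: "f \<in> V_ker sc form lB lF \<Longrightarrow> g \<in> V_ker sc form lB lF \<Longrightarrow> f + g \<in> V_ker sc form lB lF"

text \<open>\<open>V_elem sc form lB lF w\<close> is the vector $w\otimes\mathbf 1$, as a coset.\<close>

definition V_elem :: "(complex \<Rightarrow> 'h \<Rightarrow> 'h) \<Rightarrow> ('h \<Rightarrow> 'h \<Rightarrow> complex) \<Rightarrow> complex \<Rightarrow> complex \<Rightarrow>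
    'h::ab_group_add hhat free_alg \<Rightarrow> 'h hhat free_alg set" where
  "V_elem sc form lB lF w = {w'. w' - w \<in> V_ker sc form lB lF}"

definition V_space :: "(complex \<Rightarrow> 'h \<Rightarrow> 'h) \<Rightarrow> ('h \<Rightarrow> 'h \<Rightarrow> complex) \<Rightarrow> complex \<Rightarrow> complex \<Rightarrow>
    'h::ab_group_add hhat free_alg set set" where
  "V_space sc form lB lF = range (V_elem sc form lB lF)"

text \<open>The operator on $V$ by which an element of (a representative of an element of) $N$ acts.
  In particular \<open>V_op sc form lB lF (gen (mode a k))\<close> is $a(k+|a|/2)$.\<close>

definition V_op :: "(complex \<Rightarrow> 'h \<Rightarrow> 'h) \<Rightarrow> ('h \<Rightarrow> 'h \<Rightarrow> complex) \<Rightarrow> complex \<Rightarrow> complex \<Rightarrow>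
    'h::ab_group_add hhat free_alg \<Rightarrow> 'h hhat free_alg set \<Rightarrow> 'h hhat free_alg set" where
  "V_op sc form lB lF f =
     (\<lambda>v \<in> V_space sc form lB lF. \<Union>w\<in>v. V_elem sc form lB lF (f * w))"

lemma const_commute: "const c * f = f * const c"
proof (induction f rule: update_induct)
  case const
  then show ?case by simp
next
  case (update f k v)
  have "Poly_Mapping.update k v f = f + Poly_Mapping.single k v"
    using update.hyps(1)
    by (intro poly_mapping_eqI)
       (auto simp: Poly_Mapping.lookup_update lookup_add lookup_single in_keys_iff when_def)
  moreover have "const c * Poly_Mapping.single k v = Poly_Mapping.single k v * const c"
    by (simp add: const_def mult_single mult.commute)
  ultimately show ?case
    using update.IH by (simp add: distrib_left distrib_right)
qed

lemma V_ker_zero: "0 \<in> V_ker sc form lB lF"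
  using V_ker.ideal[OF N_ideal.mult_left[OF N_ideal.kB_kF, where h = 0]] by simp

lemma V_ker_mult_left: "f \<in> V_ker sc form lB lF \<Longrightarrow> h * f \<in> V_ker sc form lB lF"
proof (induction rule: V_ker.induct)
  case (ideal f)
  then show ?case by (intro V_ker.ideal N_ideal.mult_left)
next
  case (balanced u c f)
  have "h * (f * u - const c * f) = (h * f) * u - const c * (h * f)"
    by (simp only: right_diff_distrib mult.assoc[symmetric] const_commute[of c h])
  with V_ker.balanced[OF balanced, of "h * f" sc form] show ?case by simp
next
  case (add f g)
  then show ?case by (simp add: distrib_left V_ker.add)
qed

lemma V_ker_uminus: "f \<in> V_ker sc form lB lF \<Longrightarrow> - f \<in> V_ker sc form lB lF"
  using V_ker_mult_left[of f sc form lB lF "-1"] by simp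

lemma V_elem_eq_iff:
  "V_elem sc form lB lF w = V_elem sc form lB lF w' \<longleftrightarrow> w - w' \<in> V_ker sc form lB lF"
proof
  assume "V_elem sc form lB lF w = V_elem sc form lB lF w'"
  moreover have "w \<in> V_elem sc form lB lF w" by (simp add: V_elem_def V_ker_zero)
  ultimately show "w - w' \<in> V_ker sc form lB lF" by (simp add: V_elem_def)
next
  assume *: "w - w' \<in> V_ker sc form lB lF"
  have "x - w \<in> V_ker sc form lB lF \<longleftrightarrow> x - w' \<in> V_ker sc form lB lF" for x
  proof
    assume "x - w \<in> V_ker sc form lB lF"
    from V_ker.add[OF this *] show "x - w' \<in> V_ker sc form lB lF" by simp
  next
    assume "x - w' \<in> V_ker sc form lB lF"
    from V_ker.add[OF this V_ker_uminus[OF *]] show "x - w \<in> V_ker sc form lB lF" by simp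
  qed
  then show "V_elem sc form lB lF w = V_elem sc form lB lF w'" by (simp add: V_elem_def)
qed

lemma V_op_V_elem:
  "V_op sc form lB lF f (V_elem sc form lB lF w) = V_elem sc form lB lF (f * w)"
proof -
  have "V_elem sc form lB lF (f * w') = V_elem sc form lB lF (f * w)"
    if "w' \<in> V_elem sc form lB lF w" for w'
  proof -
    from that have "f * (w' - w) \<in> V_ker sc form lB lF"
      by (intro V_ker_mult_left) (simp add: V_elem_def)
    then show ?thesis by (simp only: V_elem_eq_iff right_diff_distrib)
  qed
  then have "(\<Union>w'\<in>V_elem sc form lB lF w. V_elem sc form lB lF (f * w')) =
      (\<Union>w'\<in>V_elem sc form lB lF w. V_elem sc form lB lF (f * w))"
    by (intro SUP_cong refl)
  also have "w \<in> V_elem sc form lB lF w" by (simp add: V_elem_def V_ker_zero)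
  then have "(\<Union>w'\<in>V_elem sc form lB lF w. V_elem sc form lB lF (f * w)) =
      V_elem sc form lB lF (f * w)" by blast
  finally show ?thesis by (simp add: V_op_def V_space_def)
qed

lemma V_op_mult:
  "v \<in> V_space sc form lB lF \<Longrightarrow>
    V_op sc form lB lF (f * g) v = V_op sc form lB lF f (V_op sc form lB lF g v)"
  unfolding V_space_def by (elim rangeE) (simp only: V_op_V_elem mult.assoc)


section \<open>Formal series in the variables $x_i$, $y_j$\<close>

datatype var = X nat | Y nat

text \<open>Monomials have integer exponents; a formal series is an arbitrary family of coefficients.\<close>

type_synonym monom = "var \<Rightarrow>\<^sub>0 int"
type_synonym 'c series = "monom \<Rightarrow> 'c"

text \<open>The product of two series is only meaningful if each of its coefficients is a finite sum,
  as is the case for series in disjoint sets of variables.\<close>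

definition ser_mult :: "'c::semiring_0 series \<Rightarrow> 'c series \<Rightarrow> 'c series" where
  "ser_mult f g = (\<lambda>e. \<Sum>d | f d \<noteq> 0 \<and> g (e - d) \<noteq> 0. f d * g (e - d))"

definition ser_one :: "'c::zero_neq_one series" where
  "ser_one = (\<lambda>e. if e = 0 then 1 else 0)"

definition ser_prod :: "'c::semiring_1 series list \<Rightarrow> 'c series" where
  "ser_prod fs = foldr ser_mult fs ser_one"

definition ser_const :: "complex series \<Rightarrow> 'u free_alg series" where
  "ser_const f = (\<lambda>e. const (f e))"

definition ser1 :: "var \<Rightarrow> (int \<Rightarrow> 'c) \<Rightarrow> 'c::zero series" where
  "ser1 v c = (\<lambda>e. if Poly_Mapping.keys e \<subseteq> {v} then c (Poly_Mapping.lookup e v) else 0)"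

definition ser2 :: "var \<Rightarrow> var \<Rightarrow> (int \<Rightarrow> int \<Rightarrow> 'c) \<Rightarrow> 'c::zero series" where
  "ser2 v w c = (\<lambda>e. if Poly_Mapping.keys e \<subseteq> {v, w}
                      then c (Poly_Mapping.lookup e v) (Poly_Mapping.lookup e w) else 0)"

definition ser_perm :: "nat \<Rightarrow> (nat \<Rightarrow> nat \<Rightarrow> 'c::semiring_1 series) \<Rightarrow> 'c series" where
  "ser_perm k M = (\<lambda>e. \<Sum>\<sigma> | \<sigma> permutes {..<k}. ser_prod (map (\<lambda>\<alpha>. M \<alpha> (\<sigma> \<alpha>)) [0..<k]) e)"

definition ser_det :: "nat \<Rightarrow> (nat \<Rightarrow> nat \<Rightarrow> 'c::ring_1 series) \<Rightarrow> 'c series" where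
  "ser_det k M = (\<lambda>e. \<Sum>\<sigma> | \<sigma> permutes {..<k}.
     of_int (sign \<sigma>) * ser_prod (map (\<lambda>\<alpha>. M \<alpha> (\<sigma> \<alpha>)) [0..<k]) e)"

text \<open>Expansion in nonnegative powers of $y$ is the embedding of the rational functions in $x,y$
  into the field $\mathbb C((x))((y))$, the type \<^typ>\<open>complex fls fls\<close>, whose outer variable
  is $y$. There $\partial_y$ is \<^const>\<open>fls_deriv\<close> and $\partial_x$ is \<^const>\<open>fls_deriv\<close>
  on each coefficient. \<open>F_coeff k m n p q\<close> is the coefficient of $x^py^q$ in
  $\frac1{(m-1)!(n-1)!}\partial_x^{m-1}\partial_y^{n-1}(x-y)^{-k}$.\<close>

definition F_coeff :: "nat \<Rightarrow> nat \<Rightarrow> nat \<Rightarrow> int \<Rightarrow> int \<Rightarrow> complex" where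
  "F_coeff k m n p q =
     fls_nth ((fls_deriv ^^ (m - 1))
       (fls_nth ((fls_deriv ^^ (n - 1)) (1 / (fls_const fls_X - fls_X) ^ k)) q)) p
     / (fact (m - 1) * fact (n - 1))"

definition FB :: "nat \<Rightarrow> nat \<Rightarrow> var \<Rightarrow> var \<Rightarrow> complex series" where
  "FB m n x y = ser2 x y (F_coeff 2 m n)"

definition FF :: "nat \<Rightarrow> nat \<Rightarrow> var \<Rightarrow> var \<Rightarrow> complex series" where
  "FF m n x y = ser2 x y (F_coeff 1 m n)"


section \<open>Normal ordering\<close>

text \<open>\<open>mode_sgn (a, n)\<close> is the sign of $n+|a|/2$.\<close>

definition mode_sgn :: "'h bf \<times> int \<Rightarrow> int" where
  "mode_sgn m = sgn (2 * snd m + int (par (fst m)))"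

definition rearrange :: "('x \<Rightarrow> int) \<Rightarrow> 'x list \<Rightarrow> 'x list" where
  "rearrange s xs = [x \<leftarrow> xs. s x = -1] @ [x \<leftarrow> xs. s x = 1] @ [x \<leftarrow> xs. s x = 0]"

text \<open>The permutation that the rearrangement of a list of modes induces on the positions of its
  fermionic factors.\<close>

definition fer_perm :: "('h bf \<times> int) list \<Rightarrow> nat \<Rightarrow> nat" where
  "fer_perm ms = (let fs = [m \<leftarrow> ms. is_fer (fst m)];
                      js = rearrange (\<lambda>i. mode_sgn (fs ! i)) [0..<length fs]
                  in (\<lambda>i. if i < length fs then js ! i else i))"

definition nord :: "('h bf \<times> int) list \<Rightarrow> 'h::ab_group_add hhat free_alg" where
  "nord ms = of_int (sign (fer_perm ms)) *
     prod_list (map (\<lambda>(a, n). gen (mode a n)) (rearrange mode_sgn ms))"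

text \<open>A list entry \<open>(a, m, v)\<close> stands for the field
  $a^{(m)}(v)=\sum_n a(n+|a|/2)\,\frac1{m!}\partial_v^m v^{-n-1}$. \<open>nord_series\<close> is the normally
  ordered product of a list of such fields: the monomial series are multiplied, and the modes are
  normally ordered. For each exponent, only finitely many \<open>ns\<close> contribute.\<close>

definition field_monom :: "nat \<Rightarrow> var \<Rightarrow> int \<Rightarrow> complex series" where
  "field_monom m v n =
     ser1 v (\<lambda>p. fls_nth ((fls_deriv ^^ m) (fls_X_intpow (- n - 1))) p / fact m)"

definition nord_series :: "('h bf \<times> nat \<times> var) list \<Rightarrow> 'h::ab_group_add hhat free_alg series" where
  "nord_series fs = (\<lambda>e.
     let c = (\<lambda>ns. ser_prod (map2 (\<lambda>(a, m, v) n. field_monom m v n) fs ns) e)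
     in \<Sum>ns | length ns = length fs \<and> c ns \<noteq> 0. const (c ns) * nord (zip (map fst fs) ns))"


section \<open>Index notation\<close>

definition bos_idx :: "nat \<Rightarrow> (nat \<Rightarrow> 'h bf) \<Rightarrow> nat set" where
  "bos_idx r a = {i \<in> {1..r}. is_bos (a i)}"

definition fer_idx :: "nat \<Rightarrow> (nat \<Rightarrow> 'h bf) \<Rightarrow> nat set" where
  "fer_idx r a = {i \<in> {1..r}. is_fer (a i)}"

definition incr_tuples :: "nat set \<Rightarrow> nat \<Rightarrow> nat list set" where
  "incr_tuples A k = {is. length is = k \<and> set is \<subseteq> A \<and> sorted_wrt (<) is}"

definition fer_count :: "nat \<Rightarrow> (nat \<Rightarrow> 'h bf) \<Rightarrow> nat \<Rightarrow> nat" where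
  "fer_count r a i = card {j \<in> fer_idx r a. j \<le> i}"

text \<open>The fields $a_i^{(m_i-1)}(v_i)$, $1\le i\le r$, without those whose index is in \<open>S\<close>.\<close>

definition fields :: "nat \<Rightarrow> (nat \<Rightarrow> 'h bf) \<Rightarrow> (nat \<Rightarrow> nat) \<Rightarrow> (nat \<Rightarrow> var) \<Rightarrow> nat set \<Rightarrow>
    ('h bf \<times> nat \<times> var) list" where
  "fields r a m v S = [(a i, m i - 1, v i). i \<leftarrow> [1..<Suc r], i \<notin> S]"

end

(*
  The normal ordering of a list of modes is a sign times the product of its negative, positive and
  zero modes, in this order. As zero modes commute with all nonzero modes, multiplying a normally
  ordered product by a single mode x from the right or from the left gives the normally ordered
  product of the longer list, plus one term for each contraction of x with another mode. Expanding
  (:A: x) :B: = :A: (x :B:) in both ways expresses :A x: :B: through products whose left factor is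
  shorter than A x, so by induction :A: :B: is a signed sum over all partial pairings of A with B.

  Such a pairing is an increasing list I of positions in A together with a list J of distinct
  positions in B of the same length. Sorting J turns the sum over pairings with prescribed sets of
  positions into a permanent, and, as the sign of J is given by its number of inversions, into a
  determinant for the fermions.

  Since the fields involve pairwise distinct variables, each coefficient of the series is a single
  monomial in the modes, which reduces the theorem to the identity for modes.
*)

theory Submission
  imports Defs
begin

section \<open>Inversions and the sign of a normal ordering\<close>

text \<open>Between modes, the relations of N only exchange a positive with a negative one, or a
  zero mode with a nonzero one. Two modes of equal sign obey no relation, so a normally ordered
  product is not symmetric in its factors, and every step must keep the remaining modes in their
  given order. The central elements are scalars only on V; hence congruence of operators on V, not
  equality in N.

  The sign: contract the fermions of A from the last to the first. A pair (i, j) costs the number of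
  fermions still standing between the two modes: those after i and those before j. Now r^F - r^F(i)
  also counts the contracted fermions after i, in total rho(rho-1)/2 too many, and s^F(j) counts j
  itself, in total rho too many; together this is rho(rho+1)/2. Finally, s^F(j) counts the smaller
  partners of later fermions of A, which are already gone: these are the inversions of J, the sign
  in the determinant.\<close>

fun inversions :: "nat list \<Rightarrow> nat" where
  "inversions [] = 0"
| "inversions (x # xs) = length (filter (\<lambda>y. y < x) xs) + inversions xs"

definition cross_inversions :: "nat list \<Rightarrow> nat list \<Rightarrow> nat" where
  "cross_inversions xs ys = (\<Sum>x\<leftarrow>xs. length (filter (\<lambda>y. y < x) ys))"

lemma inversions_append:
  "inversions (xs @ ys) = inversions xs + inversions ys + cross_inversions xs ys"
  by (induction xs) (auto simp: cross_inversions_def)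

lemma inversions_map_strict:
  assumes "\<And>x y. x \<in> set xs \<Longrightarrow> y \<in> set xs \<Longrightarrow> f x < f y \<longleftrightarrow> x < y"
  shows "inversions (map f xs) = inversions xs"
  using assms
proof (induction xs)
  case (Cons x xs)
  have "filter (\<lambda>y. f y < f x) xs = filter (\<lambda>y. y < x) xs"
    by (intro filter_cong refl) (use Cons.prems in auto)
  with Cons show ?case by (auto simp: filter_map comp_def)
qed simp

text \<open>The new entry is inverted with every entry of \<open>vs\<close> and with none of
  \<open>us\<close>.\<close>

lemma inversions_insert_greatest:
  assumes "\<And>u. u \<in> set (us @ vs) \<Longrightarrow> u < k"
  shows "inversions (us @ k # vs) = inversions (us @ vs) + length vs"
proof -
  have "filter (\<lambda>y. y < k) vs = vs" by (rule filter_True) (use assms in auto)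
  moreover have "cross_inversions us (k # vs) = cross_inversions us vs"
    unfolding cross_inversions_def
  proof (intro arg_cong[where f = sum_list] map_cong refl)
    fix u assume "u \<in> set us"
    then have "u < k" using assms by simp
    then show "length (filter (\<lambda>y. y < u) (k # vs)) = length (filter (\<lambda>y. y < u) vs)" by simp
  qed
  ultimately show ?thesis by (simp add: inversions_append)
qed

text \<open>One-line notation, continued by the identity; \<open>fer_perm\<close> has this
  shape.\<close>

definition list_perm :: "nat list \<Rightarrow> nat \<Rightarrow> nat" where
  "list_perm js = (\<lambda>i. if i < length js then js ! i else i)"

lemma list_perm_permutes:
  assumes "distinct js" "set js = {..<length js}"
  shows "list_perm js permutes {..<length js}"
proof (rule bij_imp_permutes)
  have "inj_on (list_perm js) {..<length js}" 
    using assms(1) by (auto simp: inj_on_def list_perm_def nth_eq_iff_index_eq)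
  moreover have "list_perm js ` {..<length js} = {..<length js}"
  proof -
    have "list_perm js ` {..<length js} = (!) js ` {..<length js}" by (simp add: list_perm_def)
    also have "\<dots> = set js" by (auto simp: set_conv_nth)
    finally show ?thesis using assms(2) by simp
  qed
  ultimately show "bij_betw (list_perm js) {..<length js} {..<length js}"
    by (simp add: bij_betw_def)
qed (simp add: list_perm_def)

text \<open>Exchanging adjacent entries of the one-line notation composes on the right with a
  transposition of two positions.\<close>

lemma sign_list_perm_swap:
  assumes "distinct (us @ x # y # vs)" "set (us @ x # y # vs) = {..<length (us @ x # y # vs)}"
  shows "sign (list_perm (us @ y # x # vs)) = - sign (list_perm (us @ x # y # vs))"
proof -
  define n where "n = length us"
  let ?t = "transpose n (Suc n)"
  have eq: "list_perm (us @ y # x # vs) = list_perm (us @ x # y # vs) \<circ> ?t"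
  proof (rule ext)
    fix i
    consider "i < n" | "i = n" | "i = Suc n" | "i > Suc n" by linarith
    then show "list_perm (us @ y # x # vs) i = (list_perm (us @ x # y # vs) \<circ> ?t) i"
      by cases (simp_all add: list_perm_def n_def transpose_def nth_append nth_Cons')
  qed
  have "permutation (list_perm (us @ x # y # vs))"
    using list_perm_permutes[OF assms] by (meson finite_lessThan permutation_permutes)
  then have "sign (list_perm (us @ x # y # vs) \<circ> ?t) = sign (list_perm (us @ x # y # vs)) * sign ?t"
    by (intro sign_compose permutation_swap_id)
  then show ?thesis by (simp add: eq sign_swap_id)
qed

lemma sign_list_perm_move:
  assumes "distinct (us @ x # vs)" "set (us @ x # vs) = {..<length (us @ x # vs)}"
  shows "sign (list_perm (us @ x # vs)) = (-1) ^ length vs * sign (list_perm (us @ vs @ [x]))"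
  using assms
proof (induction vs arbitrary: us)
  case (Cons v vs)
  have "sign (list_perm (us @ x # v # vs)) = - sign (list_perm (us @ v # x # vs))"
    using sign_list_perm_swap[OF Cons.prems] by simp
  also have "sign (list_perm (us @ v # x # vs)) =
      (-1) ^ length vs * sign (list_perm ((us @ [v]) @ vs @ [x]))"
  proof -
    have "distinct ((us @ [v]) @ x # vs)" using Cons.prems(1) by auto
    moreover have "set ((us @ [v]) @ x # vs) = {..<length ((us @ [v]) @ x # vs)}"
    proof -
      have "set ((us @ [v]) @ x # vs) = set (us @ x # v # vs)" by auto
      also have "\<dots> = {..<length ((us @ [v]) @ x # vs)}" unfolding Cons.prems(2) by simp
      finally show ?thesis .
    qed
    ultimately show ?thesis using Cons.IH[of "us @ [v]"] by simp
  qed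
  finally show ?case by simp
qed simp

text \<open>Induction on the length: the greatest entry is moved to the end, at the cost of one sign
  for each entry passed, and is then dropped.\<close>

lemma sign_list_perm:
  assumes "distinct js" "set js = {..<length js}"
  shows "sign (list_perm js) = (-1) ^ inversions js"
  using assms
proof (induction "length js" arbitrary: js)
  case 0
  then have "list_perm js = id" by (auto simp: list_perm_def)
  with 0 show ?case by (simp add: sign_id)
next
  case (Suc k)
  have "k \<in> set js" unfolding Suc.prems(2) Suc.hyps(2)[symmetric] by simp
  then obtain us vs where js: "js = us @ k # vs" by (meson split_list)
  have len: "length (us @ vs) = k" using Suc.hyps(2) js by simp
  have set: "set (us @ vs) = {..<k}"
  proof -
    have "set (us @ vs) = set js - {k}" using Suc.prems(1) by (auto simp: js)
    also have "\<dots> = {..<k}" unfolding Suc.prems(2) Suc.hyps(2)[symmetric] by auto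
    finally show ?thesis .
  qed
  \<comment> \<open>The entry \<open>k\<close> now stands at position \<open>k\<close>, where the
    shorter list yields \<open>k\<close> by the identity default.\<close>
  have "list_perm (us @ vs @ [k]) = list_perm (us @ vs)"
    using len by (auto simp: list_perm_def nth_append fun_eq_iff)
  then have "sign (list_perm js) = (-1) ^ length vs * sign (list_perm (us @ vs))"
    using sign_list_perm_move[of us k vs] Suc.prems js by simp
  also have "sign (list_perm (us @ vs)) = (-1) ^ inversions (us @ vs)"
  proof (rule Suc.hyps(1))
    show "distinct (us @ vs)" using Suc.prems(1) js by simp
  qed (use len set in auto)
  also have "inversions js = inversions (us @ vs) + length vs"
    unfolding js by (rule inversions_insert_greatest) (use set in auto)
  then have "(-1) ^ length vs * (-1) ^ inversions (us @ vs) = ((-1) ^ inversions js :: int)"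
    by (simp add: power_add)
  finally show ?case .
qed

section \<open>The sign of a normal ordering in terms of fermion counts\<close>

definition fer_no :: "('h bf \<times> int) list \<Rightarrow> nat" where
  "fer_no xs = (\<Sum>x\<leftarrow>xs. par (fst x))"

lemma fer_no_simps [simp]:
  "fer_no [] = 0" "fer_no (x # xs) = par (fst x) + fer_no xs"
  "fer_no (xs @ ys) = fer_no xs + fer_no ys" "fer_no (rev xs) = fer_no xs"
  by (simp_all add: fer_no_def flip: rev_map)

abbreviation negs where "negs \<equiv> filter (\<lambda>x. mode_sgn x = -1)"
abbreviation poss where "poss \<equiv> filter (\<lambda>x. mode_sgn x = 1)"
abbreviation zeros where "zeros \<equiv> filter (\<lambda>x. mode_sgn x = 0)"

text \<open>The inversions of \<open>fer_perm\<close>, read off the modes: a positive fermion before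
  a negative one. Zero modes are bosonic and do not contribute.\<close>

fun nord_inv :: "('h bf \<times> int) list \<Rightarrow> nat" where
  "nord_inv [] = 0"
| "nord_inv (x # xs) = (if mode_sgn x = 1 then par (fst x) * fer_no (negs xs) else 0) + nord_inv xs"

lemma nord_inv_append:
  "nord_inv (xs @ ys) = nord_inv xs + nord_inv ys + fer_no (poss xs) * fer_no (negs ys)"
  by (induction xs) (auto simp: algebra_simps)

lemma mode_sgn_cases: "mode_sgn x = -1 \<or> mode_sgn x = 1 \<or> mode_sgn x = 0"
  by (auto simp: mode_sgn_def sgn_if)

lemma mode_sgn_eq_0_iff: "mode_sgn x = 0 \<longleftrightarrow> is_bos (fst x) \<and> snd x = 0"
proof -
  have "2 * k + 1 \<noteq> (0 :: int)" for k by presburger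
  then show ?thesis by (cases x; cases "fst x") (auto simp: mode_sgn_def sgn_0_0)
qed

lemma par_bool: "par a = (if is_fer a then 1 else 0)"
  by (cases a) auto

lemma fer_no_filter: "fer_no (filter P xs) = length (filter P [m \<leftarrow> xs. is_fer (fst m)])"
  by (induction xs) (auto simp: par_bool)

lemma length_filter_nth: "length (filter P xs) = length (filter (\<lambda>i. P (xs ! i)) [0..<length xs])"
  using arg_cong[OF filter_map[of P "\<lambda>i. xs ! i" "[0..<length xs]"], of length]
  by (simp add: map_nth comp_def)

text \<open>Induction from the right: the position of the appended mode is the greatest, so it
  creates inversions only if it is negative, one with each positive mode that it is moved in front
  of.\<close>

lemma inversions_rearrange:
  assumes "\<And>f. f \<in> set fs \<Longrightarrow> is_fer (fst f)"
  shows "inversions (rearrange (\<lambda>i. mode_sgn (fs ! i)) [0..<length fs]) = nord_inv fs"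
  using assms
proof (induction fs rule: rev_induct)
  case Nil
  then show ?case by (simp add: rearrange_def)
next
  case (snoc x fs)
  let ?k = "length fs"
  let ?F = "\<lambda>c. filter (\<lambda>i. mode_sgn (fs ! i) = c) [0..<?k]"
  have F: "filter (\<lambda>i. mode_sgn ((fs @ [x]) ! i) = c) [0..<?k] = ?F c" for c
    by (rule filter_cong) (simp_all add: nth_append)
  have z: "mode_sgn f \<noteq> 0" if "f \<in> set (fs @ [x])" for f
    using snoc.prems[OF that] by (cases "fst f") (simp_all add: mode_sgn_eq_0_iff)
  have F0: "?F 0 = []" using z by (auto simp: filter_empty_conv)
  have par1: "par (fst x) = 1" using snoc.prems[of x] by (auto simp: par_bool)
  have len: "length (?F 1) = fer_no (poss fs)"
  proof -
    have "filter (\<lambda>m. is_fer (fst m)) fs = fs" using snoc.prems by (auto simp: filter_id_conv)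
    then show ?thesis unfolding fer_no_filter by (simp only: length_filter_nth[where xs = fs])
  qed
  have IH: "inversions (?F (-1) @ ?F 1) = nord_inv fs"
    using snoc.IH snoc.prems by (simp add: rearrange_def F0)
  have re: "rearrange (\<lambda>i. mode_sgn ((fs @ [x]) ! i)) [0..<length (fs @ [x])] =
    (?F (-1) @ (if mode_sgn x = -1 then [?k] else [])) @ (?F 1 @ (if mode_sgn x = 1 then [?k] else []))"
    using z[of x] unfolding rearrange_def by (simp add: F F0)
  from z[of x] mode_sgn_cases[of x] consider "mode_sgn x = -1" | "mode_sgn x = 1" by auto
  then show ?case
  proof cases
    case 1
    have "inversions ((?F (-1) @ [?k]) @ ?F 1) = inversions (?F (-1) @ ?F 1) + length (?F 1)"
      using inversions_insert_greatest[of "?F (-1)" "?F 1" ?k] by auto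
    then show ?thesis unfolding re using 1
      by (simp add: nord_inv_append IH[simplified] par1 len)
  next
    case 2
    have "inversions (?F (-1) @ ?F 1 @ [?k]) = inversions (?F (-1) @ ?F 1)"
      using inversions_insert_greatest[of "?F (-1) @ ?F 1" "[]" ?k] by auto
    then show ?thesis unfolding re using 2
      by (simp add: nord_inv_append IH[simplified])
  qed
qed

lemma nord_inv_fermions: "nord_inv [m \<leftarrow> ms. is_fer (fst m)] = nord_inv ms"
  by (induction ms) (auto simp: par_bool fer_no_filter)

lemma sign_fer_perm: "sign (fer_perm ms) = (-1) ^ nord_inv ms"
proof -
  define fs where "fs = [m \<leftarrow> ms. is_fer (fst m)]"
  define js where "js = rearrange (\<lambda>i. mode_sgn (fs ! i)) [0..<length fs]"
  have set: "set js = {..<length fs}" 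
  proof -
    have "i \<in> set js" if "i < length fs" for i
      using mode_sgn_cases[of "fs ! i"] that by (auto simp: js_def rearrange_def)
    then show ?thesis by (auto simp: js_def rearrange_def)
  qed
  have dist: "distinct js" by (auto simp: js_def rearrange_def)
  then have len: "length js = length fs"
    using distinct_card[of js] set by simp
  have "fer_perm ms = list_perm js"
    unfolding list_perm_def len by (simp only: fer_perm_def Let_def js_def fs_def)
  with sign_list_perm[of js] dist set len
  have "sign (fer_perm ms) = (-1) ^ inversions js" by simp
  also have "inversions js = nord_inv fs"
    unfolding js_def by (rule inversions_rearrange) (auto simp: fs_def)
  finally show ?thesis by (simp add: fs_def nord_inv_fermions)
qed

section \<open>Congruence of operators on $V$\<close>

text \<open>The shape of a sum over contractions with one entry \<open>y\<close> of a list. Prefix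
  and suffix are separate arguments because the sign of a contraction depends on the fermions on one
  side of \<open>y\<close> only.\<close>

definition ssum :: "('x list \<Rightarrow> 'x \<Rightarrow> 'x list \<Rightarrow> 'c::comm_monoid_add) \<Rightarrow> 'x list \<Rightarrow> 'c" where
  "ssum f xs = (\<Sum>i<length xs. f (take i xs) (xs ! i) (drop (Suc i) xs))"

lemma ssum_Nil [simp]: "ssum f [] = 0"
  by (simp add: ssum_def)

lemma ssum_Cons: "ssum f (y # xs) = f [] y xs + ssum (\<lambda>u. f (y # u)) xs"
  unfolding ssum_def length_Cons sum.lessThan_Suc_shift by simp

lemma ssum_snoc: "ssum f (xs @ [y]) = ssum (\<lambda>u z v. f u z (v @ [y])) xs + f xs y []"
  by (induction xs arbitrary: f) (simp_all add: ssum_Cons add_ac)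

lemma ssum_rev: "ssum f (rev xs) = ssum (\<lambda>u y v. f (rev v) y (rev u)) xs"
  by (induction xs arbitrary: f) (simp_all add: ssum_Cons ssum_snoc add_ac)

lemma ssum_filter:
  "ssum f (filter P xs) = ssum (\<lambda>u y v. if P y then f (filter P u) y (filter P v) else 0) xs"
  by (induction xs arbitrary: f) (auto simp: ssum_Cons cong: if_cong)

lemma ssum_cong:
  "(\<And>u y v. xs = u @ y # v \<Longrightarrow> f u y v = g u y v) \<Longrightarrow> ssum f xs = ssum g xs"
  unfolding ssum_def by (intro sum.cong refl) (simp add: id_take_nth_drop)

lemma ssum_0 [simp]: "ssum (\<lambda>_ _ _. 0) xs = 0"
  by (simp add: ssum_def)

lemma ssum_add: "ssum (\<lambda>u y v. f u y v + g u y v) xs = ssum f xs + ssum g xs"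
  by (simp add: ssum_def sum.distrib)

lemma ssum_mult_left: "(h :: 'c::semiring_0) * ssum f xs = ssum (\<lambda>u y v. h * f u y v) xs"
  by (simp add: ssum_def sum_distrib_left)

lemma ssum_mult_right: "ssum f xs * (h :: 'c::semiring_0) = ssum (\<lambda>u y v. f u y v * h) xs"
  by (simp add: ssum_def sum_distrib_right)

lemma ssum_swap:
  "ssum (\<lambda>u y v. ssum (\<lambda>u' y' v'. f u y v u' y' v') xs') xs =
   ssum (\<lambda>u' y' v'. ssum (\<lambda>u y v. f u y v u' y' v') xs) xs'"
  unfolding ssum_def by (rule sum.swap)

text \<open>A separate operator for multiplication by constants lets the simplifier pull scalars out
  of noncommutative products.\<close>

definition smult_alg :: "complex \<Rightarrow> 'u free_alg \<Rightarrow> 'u free_alg" (infixr "\<odot>" 72) where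
  "c \<odot> f = const c * f"

lemma const_mult: "const a * const b = const (a * b)"
  by (simp add: const_def mult_single)

lemma const_add: "const (a + b) = const a + const b"
  by (simp add: const_def single_add)

lemma const_0 [simp]: "const 0 = 0" and const_1 [simp]: "const 1 = 1"
  by (simp_all add: const_def)

lemma smult_alg_simps [simp]:
  "(c \<odot> f) * g = c \<odot> (f * g)" "f * (c \<odot> g) = c \<odot> (f * g)" "c \<odot> d \<odot> f = (c * d) \<odot> f"
  "1 \<odot> f = f" "0 \<odot> f = 0" "c \<odot> 0 = 0"
proof -
  show "f * (c \<odot> g) = c \<odot> (f * g)"
    unfolding smult_alg_def by (metis const_commute mult.assoc)
qed (simp_all add: smult_alg_def mult.assoc flip: const_mult)

lemma smult_alg_add: "c \<odot> (f + g) = c \<odot> f + c \<odot> g" "(c + d) \<odot> f = c \<odot> f + d \<odot> f"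
  by (simp_all add: smult_alg_def distrib_left distrib_right const_add)

lemma smult_alg_sum: "c \<odot> (\<Sum>i\<in>A. f i) = (\<Sum>i\<in>A. c \<odot> f i)"
  by (simp add: smult_alg_def sum_distrib_left)

lemma smult_alg_ssum: "c \<odot> ssum f xs = ssum (\<lambda>u y v. c \<odot> f u y v) xs"
  by (simp add: smult_alg_def ssum_mult_left)

lemma const_smult: "const c = c \<odot> 1"
  by (simp add: smult_alg_def)

lemma const_uminus: "const (- a) = - const a"
  by (simp add: const_def single_uminus)

lemma minus_one_power_const: "(-1) ^ k = const ((-1) ^ k)"
  by (induction k) (simp_all add: const_uminus)

section \<open>Products of modes and an explicit form of normal ordering\<close>

definition mode_gen :: "'h bf \<times> int \<Rightarrow> 'h::ab_group_add hhat free_alg" where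
  "mode_gen x = gen (mode (fst x) (snd x))"

definition gens :: "('h bf \<times> int) list \<Rightarrow> 'h::ab_group_add hhat free_alg" where
  "gens xs = prod_list (map mode_gen xs)"

lemma gens_simps [simp]:
  "gens [] = 1" "gens (x # xs) = mode_gen x * gens xs" "gens (xs @ ys) = gens xs * gens ys"
  by (simp_all add: gens_def)

lemma nord_eq:
  "nord ms = (-1) ^ nord_inv ms \<odot> (gens (negs ms) * (gens (poss ms) * gens (zeros ms)))"
proof -
  have eq: "(\<lambda>(a, n). gen (mode a n)) = (mode_gen :: 'a bf \<times> int \<Rightarrow> _)"
    by (auto simp: mode_gen_def)
  have "prod_list (map mode_gen (rearrange mode_sgn ms)) =
      gens (negs ms) * (gens (poss ms) * gens (zeros ms))"
    by (simp add: rearrange_def gens_def mult.assoc)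
  then show ?thesis
    by (simp add: nord_def sign_fer_perm eq smult_alg_def minus_one_power_const)
qed

lemma nord_Nil [simp]: "nord [] = 1"
  by (simp add: nord_eq)

lemma fer_no_zeros: "fer_no (zeros xs) = 0"
  by (induction xs) (auto simp: mode_sgn_eq_0_iff par_bool bf.distinct_disc)

lemma fer_no_split: "fer_no xs = fer_no (negs xs) + fer_no (poss xs)"
proof (induction xs)
  case (Cons x xs)
  then show ?case using mode_sgn_cases[of x] fer_no_zeros[of "[x]"] by auto
qed simp

lemma mode_sgn_1_iff: "mode_sgn x = 1 \<longleftrightarrow> (case fst x of Bos _ \<Rightarrow> snd x > 0 | Fer _ \<Rightarrow> snd x \<ge> 0)"
  by (cases x; cases "fst x") (auto simp: mode_sgn_def sgn_if)

lemma mode_sgn_m1_iff: "mode_sgn x = -1 \<longleftrightarrow> snd x < 0"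
  by (cases x; cases "fst x") (auto simp: mode_sgn_def sgn_if)

lemma free_alg_induct [case_names add mult const gen]:
  assumes "\<And>f g. P f \<Longrightarrow> P g \<Longrightarrow> P (f + g)" "\<And>f g. P f \<Longrightarrow> P g \<Longrightarrow> P (f * g)"
    "\<And>c. P (const c)" "\<And>u. P (gen u)"
  shows "P (f :: 'u free_alg)"
proof (induction f rule: update_induct)
  case const
  show ?case using assms(3)[of 0] by simp
next
  case (update f k v)
  have "P (Poly_Mapping.single (FWord us) 1)" for us
  proof (induction us)
    case Nil
    show ?case using assms(3)[of 1] by (simp add: const_def zero_fword_def)
  next
    case (Cons u us)
    have "Poly_Mapping.single (FWord (u # us)) 1 = gen u * Poly_Mapping.single (FWord us) (1 :: complex)"
      by (simp add: gen_def mult_single plus_fword_def)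
    with Cons assms(2,4) show ?case by simp
  qed
  then have "P (const v * Poly_Mapping.single k 1)"
    by (cases k) (use assms(2,3) in auto)
  moreover have "const v * Poly_Mapping.single k 1 = Poly_Mapping.single k v"
    by (simp add: const_def mult_single)
  moreover have "Poly_Mapping.update k v f = f + Poly_Mapping.single k v"
    using update.hyps(1)
    by (intro poly_mapping_eqI)
       (auto simp: Poly_Mapping.lookup_update lookup_add lookup_single in_keys_iff when_def)
  ultimately show ?case using update.IH assms(1) by simp
qed

section \<open>Congruence of operators; the central elements act as scalars\<close>

locale fock =
  fixes sc :: "complex \<Rightarrow> 'h::ab_group_add \<Rightarrow> 'h" and form :: "'h \<Rightarrow> 'h \<Rightarrow> complex"
    and lB lF :: complex
begin

text \<open>Equality of the induced operators on V. As \<open>V_ker\<close> is a left ideal only,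
  the quantifier over \<open>w\<close> is what makes this a two-sided congruence.\<close>

definition op_eq :: "'h hhat free_alg \<Rightarrow> 'h hhat free_alg \<Rightarrow> bool" (infix "\<approx>" 50) where
  "f \<approx> g \<longleftrightarrow> (\<forall>w. f * w - g * w \<in> V_ker sc form lB lF)"

lemma op_eq_imp_V_op: "f \<approx> g \<Longrightarrow> V_op sc form lB lF f = V_op sc form lB lF g"
proof
  fix v
  assume *: "f \<approx> g"
  show "V_op sc form lB lF f v = V_op sc form lB lF g v"
  proof (cases "v \<in> V_space sc form lB lF")
    case True
    then obtain w where "v = V_elem sc form lB lF w" by (auto simp: V_space_def)
    with * show ?thesis by (simp add: V_op_V_elem V_elem_eq_iff op_eq_def)
  qed (simp add: V_op_def)
qed

lemma op_eq_refl [simp, intro]: "f \<approx> f"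
  by (simp add: op_eq_def V_ker_zero)

lemma op_eq_sym: "f \<approx> g \<Longrightarrow> g \<approx> f"
  unfolding op_eq_def by (metis V_ker_uminus minus_diff_eq)

lemma op_eq_trans [trans]:
  assumes "f \<approx> g" "g \<approx> h" shows "f \<approx> h"
  unfolding op_eq_def
proof
  fix w
  have "(f * w - g * w) + (g * w - h * w) \<in> V_ker sc form lB lF"
    using assms unfolding op_eq_def by (intro V_ker.add) auto
  then show "f * w - h * w \<in> V_ker sc form lB lF" by simp
qed

text \<open>Rules that are tried before the general substitution rules, for which unification is slow.\<close>

lemma op_eq_trans_eq [trans]: "f \<approx> g \<Longrightarrow> g = h \<Longrightarrow> f \<approx> h" "f = g \<Longrightarrow> g \<approx> h \<Longrightarrow> f \<approx> h"
  by simp_all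

lemma op_eq_add:
  assumes "f \<approx> f'" "g \<approx> g'" shows "f + g \<approx> f' + g'"
  unfolding op_eq_def
proof
  fix w
  have "(f * w - f' * w) + (g * w - g' * w) \<in> V_ker sc form lB lF"
    using assms unfolding op_eq_def by (intro V_ker.add) auto
  then show "(f + g) * w - (f' + g') * w \<in> V_ker sc form lB lF" by (simp add: algebra_simps)
qed

lemma op_eq_mult:
  assumes "f \<approx> f'" "g \<approx> g'" shows "f * g \<approx> f' * g'"
  unfolding op_eq_def
proof
  fix w
  have "f * (g * w - g' * w) + (f * (g' * w) - f' * (g' * w)) \<in> V_ker sc form lB lF"
    using assms unfolding op_eq_def by (intro V_ker.add V_ker_mult_left) auto
  then show "f * g * w - f' * g' * w \<in> V_ker sc form lB lF" by (simp add: algebra_simps)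
qed

lemma op_eq_smult: "f \<approx> g \<Longrightarrow> c \<odot> f \<approx> c \<odot> g"
  unfolding smult_alg_def by (intro op_eq_mult op_eq_refl)

lemma op_eq_diff: 
  assumes "f \<approx> f'" "g \<approx> g'" shows "f - g \<approx> f' - g'"
  using op_eq_add[OF assms(1) op_eq_mult[OF op_eq_refl[of "-1"] assms(2)]] by simp

lemma op_eq_diff_0: "f - g \<approx> 0 \<Longrightarrow> f \<approx> g"
  by (simp add: op_eq_def left_diff_distrib)

lemma op_eq_sum: "(\<And>i. i \<in> A \<Longrightarrow> f i \<approx> g i) \<Longrightarrow> sum f A \<approx> sum g A"
  by (induction A rule: infinite_finite_induct) (simp_all add: op_eq_add)

lemma op_eq_ssum:
  "(\<And>u y v. xs = u @ y # v \<Longrightarrow> f u y v \<approx> g u y v) \<Longrightarrow> ssum f xs \<approx> ssum g xs"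
  unfolding ssum_def by (intro op_eq_sum) (simp add: id_take_nth_drop)

lemma ideal_op_eq: "f \<in> N_ideal sc form \<Longrightarrow> f \<approx> 0"
  by (auto simp: op_eq_def intro!: V_ker.ideal N_ideal.mult_right)

lemma N_ideal_uminus: "f \<in> N_ideal sc form \<Longrightarrow> - f \<in> N_ideal sc form"
  using N_ideal.mult_left[of f sc form "-1"] by simp

lemma N_ideal_diff: "f \<in> N_ideal sc form \<Longrightarrow> g \<in> N_ideal sc form \<Longrightarrow> f - g \<in> N_ideal sc form"
  using N_ideal.add[of f sc form "- g"] N_ideal_uminus[of g] by simp

lemma N_ideal_zero: "0 \<in> N_ideal sc form"
  using N_ideal.mult_left[OF N_ideal.kB_kF, of 0 sc form] by simp

lemma commutator_N_ideal_mult: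
  assumes "f * w - w * f \<in> N_ideal sc form" "g * w - w * g \<in> N_ideal sc form"
  shows "(f * g) * w - w * (f * g) \<in> N_ideal sc form"
proof -
  have "f * (g * w - w * g) + (f * w - w * f) * g \<in> N_ideal sc form"
    using assms by (intro N_ideal.add N_ideal.mult_left N_ideal.mult_right)
  then show ?thesis by (simp add: algebra_simps)
qed

lemma commutator_N_ideal_add:
  assumes "f * w - w * f \<in> N_ideal sc form" "g * w - w * g \<in> N_ideal sc form"
  shows "(f + g) * w - w * (f + g) \<in> N_ideal sc form"
  using N_ideal.add[OF assms] by (simp add: algebra_simps)

lemma commutator_N_ideal_cong:
  assumes "f * w - w * f \<in> N_ideal sc form" "g - f \<in> N_ideal sc form"
  shows "g * w - w * g \<in> N_ideal sc form"
proof -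
  have "(f * w - w * f) + ((g - f) * w - w * (g - f)) \<in> N_ideal sc form"
    using N_ideal.add[OF assms(1) N_ideal_diff[OF N_ideal.mult_right[OF assms(2), of w]
          N_ideal.mult_left[OF assms(2), of w]]] .
  then show ?thesis by (simp add: algebra_simps)
qed

text \<open>An element commuting with all modes and both central letters is central modulo the ideal,
  because a letter of the free algebra is congruent to a linear combination of those.\<close>

lemma central_gen:
  assumes modes: "\<And>a k. gen (mode a k) * z - z * gen (mode a k) \<in> N_ideal sc form"
    and B: "gen kB * z - z * gen kB \<in> N_ideal sc form"
    and F: "gen kF * z - z * gen kF \<in> N_ideal sc form"
  shows "w * z - z * w \<in> N_ideal sc form"
proof -
  define C where "C f \<longleftrightarrow> f * z - z * f \<in> N_ideal sc form" for f
  have C_const: "C (const c)" for c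
    by (simp add: C_def const_commute[of c z] N_ideal_zero)
  have C_plus: "C (f + g)" if "C f" "C g" for f g
    using commutator_N_ideal_add that by (simp add: C_def)
  have C_mult: "C (f * g)" if "C f" "C g" for f g
    using commutator_N_ideal_mult that by (simp add: C_def)
  have C_cong: "C g" if "C f" "g - f \<in> N_ideal sc form" for f g
    using commutator_N_ideal_cong that by (simp add: C_def)
  have C_mode: "C (gen (mode a k))" for a k
    unfolding C_def by (rule modes)
  have C_k: "C (gen kB)" "C (gen kF)"
    unfolding C_def by (rule B, rule F)
  have C_add: "C (gen (u + v))" if "C (gen u)" "C (gen v)" for u v
    using C_cong[OF C_plus[OF that]] N_ideal.lin_add[of u v sc form] by (simp add: diff_diff_eq)
  have C_scale: "C (gen (hhat_scale sc c u))" if "C (gen u)" for c u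
    using C_cong[OF C_mult[OF C_const that] N_ideal.lin_scale] .
  \<comment> \<open>\<open>gen 0\<close> is a letter, not the zero of the free algebra; additivity
    puts it into the ideal.\<close>
  have "gen (0 + 0) - gen 0 - gen 0 \<in> N_ideal sc form" by (rule N_ideal.lin_add)
  from N_ideal_uminus[OF this] have "gen 0 - const 0 \<in> N_ideal sc form" by simp
  then have C_0: "C (gen 0)" by (rule C_cong[OF C_const])
  have upd: "Poly_Mapping.update k v f = Poly_Mapping.single k v + f"
    if "k \<notin> Poly_Mapping.keys f" for k :: int and v :: 'h and f
    using that by (intro poly_mapping_eqI)
      (auto simp: Poly_Mapping.lookup_update lookup_add lookup_single in_keys_iff when_def)
  have C_bos: "C (gen (f, 0, 0, 0))" for f
  proof (induction f rule: update_induct)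
    case const
    show ?case using C_0 by (simp add: zero_prod_def)
  next
    case (update f k v)
    have "C (gen (mode (Bos v) k + (f, 0, 0, 0)))"
      by (rule C_add[OF C_mode update.IH])
    with update.hyps show ?case by (simp add: upd)
  qed
  have C_fer: "C (gen (0, f, 0, 0))" for f
  proof (induction f rule: update_induct)
    case const
    show ?case using C_0 by (simp add: zero_prod_def)
  next
    case (update f k v)
    have "C (gen (mode (Fer v) k + (0, f, 0, 0)))"
      by (rule C_add[OF C_mode update.IH])
    with update.hyps show ?case by (simp add: upd)
  qed
  \<comment> \<open>Reduces \<open>hhat_scale sc c kB\<close> and \<open>hhat_scale sc d kF\<close>
    to letters with a single nonzero slot.\<close>
  have map0: "Poly_Mapping.map (sc c) 0 = (0 :: int \<Rightarrow>\<^sub>0 'h)" for c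
    by (intro poly_mapping_eqI) (simp add: Poly_Mapping.map.rep_eq)
  have "C w"
  proof (induction w rule: free_alg_induct)
    case (gen u)
    obtain f g c d where u: "u = (f, g, c, d)" by (cases u)
    have "C (gen ((f, 0, 0, 0) + ((0, g, 0, 0) + (hhat_scale sc c kB + hhat_scale sc d kF))))"
      by (intro C_add C_scale C_bos C_fer C_k)
    then show ?case by (simp add: u kB_def kF_def map0)
  qed (simp_all add: C_const C_mult C_plus)
  then show ?thesis by (simp add: C_def)
qed

text \<open>The relation \<open>balanced\<close> replaces a central letter by its scalar only at the
  right end of \<open>w\<close>; centrality modulo the ideal carries the letter from the left of
  \<open>w\<close> to that end.\<close>

lemma kB_op_eq: "gen kB \<approx> const lB" and kF_op_eq: "gen kF \<approx> const lF"
proof -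
  have 1: "gen kB * gen kF - gen kF * gen kB \<in> N_ideal sc form"
    using N_ideal.kB_kF by (auto simp: scomm_def)
  from N_ideal_uminus[OF this] have 2: "gen kF * gen kB - gen kB * gen kF \<in> N_ideal sc form" by simp
  have mB: "gen (mode a k) * gen kB - gen kB * gen (mode a k) \<in> N_ideal sc form"
    and mF: "gen (mode a k) * gen kF - gen kF * gen (mode a k) \<in> N_ideal sc form" for a k
    using N_ideal.mode_kB[of a k sc form] N_ideal.mode_kF[of a k sc form] by (simp_all add: scomm_def)
  have "w * gen kB - gen kB * w \<in> N_ideal sc form" for w
    by (rule central_gen[OF mB _ 2]) (simp_all add: N_ideal_zero)
  moreover have "w * gen kB - const lB * w \<in> V_ker sc form lB lF" for w
    by (intro V_ker.balanced vac_char.kB)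
  ultimately have "(w * gen kB - const lB * w) + - (w * gen kB - gen kB * w) \<in> V_ker sc form lB lF" for w
    using V_ker.add[OF _ V_ker_uminus[OF V_ker.ideal]] by blast
  then show "gen kB \<approx> const lB" by (simp add: op_eq_def)
  have "w * gen kF - gen kF * w \<in> N_ideal sc form" for w
    by (rule central_gen[OF mF 1]) (simp_all add: N_ideal_zero)
  moreover have "w * gen kF - const lF * w \<in> V_ker sc form lB lF" for w
    by (intro V_ker.balanced vac_char.kF)
  ultimately have "(w * gen kF - const lF * w) + - (w * gen kF - gen kF * w) \<in> V_ker sc form lB lF" for w
    using V_ker.add[OF _ V_ker_uminus[OF V_ker.ideal]] by blast
  then show "gen kF \<approx> const lF" by (simp add: op_eq_def)
qed

end

section \<open>Products with a single mode\<close>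

context fock
begin

text \<open>The scalar left over when a positive \<open>x\<close> is moved past \<open>y\<close>.
  The condition on the mode numbers forces \<open>y\<close> to be negative, see
  \<open>ctr_right\<close>.\<close>

definition ctr :: "'h bf \<times> int \<Rightarrow> 'h bf \<times> int \<Rightarrow> complex" where
  "ctr x y =
    (if mode_sgn x = 1 then
       (case (fst x, fst y) of
          (Bos u, Bos v) \<Rightarrow> if snd x + snd y = 0 then lB * of_int (snd x) * form u v else 0
        | (Fer u, Fer v) \<Rightarrow> if snd x + snd y + 1 = 0 then lF * form u v else 0
        | _ \<Rightarrow> 0)
     else 0)"

lemma ctr_left: "mode_sgn x \<noteq> 1 \<Longrightarrow> ctr x y = 0"
  by (simp add: ctr_def)

lemma ctr_right: "mode_sgn y \<noteq> -1 \<Longrightarrow> ctr x y = 0"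
  by (auto simp: ctr_def mode_sgn_1_iff mode_sgn_m1_iff split: bf.split)

lemma ctr_par: "par (fst x) \<noteq> par (fst y) \<Longrightarrow> ctr x y = 0"
  by (auto simp: ctr_def split: bf.split)

lemma scomm_op_eq:
  assumes "scomm p q f g - const c * h \<in> N_ideal sc form"
  shows "gen f * gen g \<approx> (-1) ^ (p * q) \<odot> (gen g * gen f) + c \<odot> h"
proof -
  have "gen f * gen g - ((-1) ^ (p * q) \<odot> (gen g * gen f) + c \<odot> h) \<approx> 0"
    using ideal_op_eq[OF assms]
    by (simp add: scomm_def smult_alg_def minus_one_power_const diff_diff_eq)
  then show ?thesis by (rule op_eq_diff_0)
qed

lemma scomm_op_eq_0:
  assumes "scomm p q f g \<in> N_ideal sc form"
  shows "gen f * gen g \<approx> (-1) ^ (p * q) \<odot> (gen g * gen f)"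
  using scomm_op_eq[of p q f g 0 0] assms by simp

lemma pos_neg_op_eq:
  assumes x: "mode_sgn x = 1" and y: "mode_sgn y = -1"
  shows "mode_gen x * mode_gen y \<approx>
    (-1) ^ (par (fst x) * par (fst y)) \<odot> (mode_gen y * mode_gen x) + const (ctr x y)"
proof -
  obtain a k b l where xy: "x = (a, k)" "y = (b, l)" by (cases x, cases y)
  have l: "l < 0" using y by (simp add: xy mode_sgn_m1_iff)
  show ?thesis
  proof (cases a; cases b)
    fix u v assume ab: "a = Bos u" "b = Bos v"
    have k: "k > 0" using x by (simp add: xy ab mode_sgn_1_iff)
    define c where "c = of_int k * form u v * (if k + l = 0 then 1 else 0)"
    have "mode_gen x * mode_gen y \<approx> (-1) ^ (0 * 0) \<odot> (mode_gen y * mode_gen x) + c \<odot> gen kB"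
      unfolding mode_gen_def xy ab fst_conv snd_conv
      by (rule scomm_op_eq, unfold c_def, rule N_ideal.bos_bos[OF k l])
    also have "\<dots> \<approx> (-1) ^ (0 * 0) \<odot> (mode_gen y * mode_gen x) + c \<odot> const lB"
      by (intro op_eq_add op_eq_refl op_eq_smult kB_op_eq)
    finally show ?thesis using x
      by (simp add: xy ab ctr_def c_def smult_alg_def const_mult mult_ac split: if_splits)
  next
    fix u v assume ab: "a = Fer u" "b = Fer v"
    have k: "k \<ge> 0" using x by (simp add: xy ab mode_sgn_1_iff)
    define c where "c = form u v * (if k + l + 1 = 0 then 1 else 0)"
    have "mode_gen x * mode_gen y \<approx> (-1) ^ (1 * 1) \<odot> (mode_gen y * mode_gen x) + c \<odot> gen kF"
      unfolding mode_gen_def xy ab fst_conv snd_conv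
      by (rule scomm_op_eq, unfold c_def, rule N_ideal.fer_fer[OF k l])
    also have "\<dots> \<approx> (-1) ^ (1 * 1) \<odot> (mode_gen y * mode_gen x) + c \<odot> const lF"
      by (intro op_eq_add op_eq_refl op_eq_smult kF_op_eq)
    finally show ?thesis using x
      by (simp add: xy ab ctr_def c_def smult_alg_def const_mult mult_ac split: if_splits)
  next
    fix u v assume ab: "a = Bos u" "b = Fer v"
    have k: "k > 0" using x by (simp add: xy ab mode_sgn_1_iff)
    have "mode_gen x * mode_gen y \<approx> (-1) ^ (0 * 1) \<odot> (mode_gen y * mode_gen x)"
      unfolding mode_gen_def xy ab fst_conv snd_conv
      by (intro scomm_op_eq_0 N_ideal.bos_fer) (use k l in simp)
    then show ?thesis by (simp add: xy ab ctr_par)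
  next
    fix u v assume ab: "a = Fer u" "b = Bos v"
    have k: "k \<ge> 0" using x by (simp add: xy ab mode_sgn_1_iff)
    \<comment> \<open>The mixed relation has the boson on the left, which here is \<open>y\<close>,
      so it is applied to the exchanged product and read backwards.\<close>
    have "mode_gen y * mode_gen x \<approx> (-1) ^ (0 * 1) \<odot> (mode_gen x * mode_gen y)"
      unfolding mode_gen_def xy ab fst_conv snd_conv
      by (intro scomm_op_eq_0 N_ideal.bos_fer) (use k l in simp)
    then show ?thesis by (simp add: xy ab ctr_par op_eq_sym)
  qed
qed

lemma zero_op_eq:
  assumes x: "mode_sgn x = 0" and y: "mode_sgn y \<noteq> 0"
  shows "mode_gen y * mode_gen x \<approx> mode_gen x * mode_gen y"
proof -
  obtain v where x': "x = (Bos v, 0)"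
    using x by (cases x) (auto simp: mode_sgn_eq_0_iff is_bos_def)
  obtain b k where y': "y = (b, k)" by (cases y)
  have "scomm (par b) 0 (mode b k) (mode (Bos v) 0) \<in> N_ideal sc form"
  proof (cases b)
    case (Bos u)
    then have "k \<noteq> 0" using y by (simp add: y' mode_sgn_eq_0_iff)
    then show ?thesis unfolding Bos par.simps by (rule N_ideal.bos_zero)
  next
    case (Fer u)
    then show ?thesis by (simp only: par.simps N_ideal.fer_zero)
  qed
  from scomm_op_eq_0[OF this] show ?thesis by (simp add: x' y' mode_gen_def)
qed

lemma zero_gens_op_eq:
  assumes "mode_sgn x = 0" "\<And>y. y \<in> set ys \<Longrightarrow> mode_sgn y \<noteq> 0"
  shows "mode_gen x * gens ys \<approx> gens ys * mode_gen x"
  using assms(2)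
proof (induction ys)
  case (Cons y ys)
  have "mode_gen x * gens (y # ys) \<approx> mode_gen y * mode_gen x * gens ys"
    unfolding gens_simps mult.assoc[symmetric]
    by (intro op_eq_mult op_eq_refl op_eq_sym[OF zero_op_eq] assms(1)) (use Cons.prems in simp)
  also have "\<dots> \<approx> mode_gen y * (gens ys * mode_gen x)"
    unfolding mult.assoc by (intro op_eq_mult op_eq_refl Cons.IH) (use Cons.prems in simp)
  finally show ?case by (simp add: mult.assoc)
qed simp

lemma gens_zeros_op_eq:
  assumes "mode_sgn x \<noteq> 0"
  shows "gens (zeros ys) * mode_gen x \<approx> mode_gen x * gens (zeros ys)"
proof (induction ys)
  case (Cons y ys)
  show ?case
  proof (cases "mode_sgn y = 0")
    case True
    have "gens (zeros (y # ys)) * mode_gen x \<approx> mode_gen y * (mode_gen x * gens (zeros ys))"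
      using True by (auto simp: mult.assoc intro: op_eq_mult Cons.IH)
    also have "\<dots> \<approx> mode_gen x * mode_gen y * gens (zeros ys)"
      unfolding mult.assoc[symmetric]
      by (intro op_eq_mult op_eq_refl op_eq_sym[OF zero_op_eq] True assms)
    finally show ?thesis using True by (simp add: mult.assoc)
  qed (use Cons.IH in simp)
qed simp

text \<open>When \<open>x\<close> is contracted with \<open>y\<close> it has passed exactly the
  modes before \<open>y\<close>, whence the sign with \<open>fer_no u\<close>.\<close>

lemma pos_gens_op_eq:
  assumes x: "mode_sgn x = 1" and "\<And>y. y \<in> set ys \<Longrightarrow> mode_sgn y = -1"
  shows "mode_gen x * gens ys \<approx>
    (-1) ^ (par (fst x) * fer_no ys) \<odot> (gens ys * mode_gen x)
    + ssum (\<lambda>u y v. ((-1) ^ (par (fst x) * fer_no u) * ctr x y) \<odot> gens (u @ v)) ys"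
    (is "_ \<approx> ?s ys \<odot> _ + ?T ys")
  using assms(2)
proof (induction ys)
  case (Cons y ys)
  let ?e = "(-1) ^ (par (fst x) * par (fst y)) :: complex"
  have "mode_gen x * gens (y # ys) \<approx> (?e \<odot> (mode_gen y * mode_gen x) + const (ctr x y)) * gens ys"
    unfolding gens_simps mult.assoc[symmetric]
    by (intro op_eq_mult op_eq_refl pos_neg_op_eq x) (use Cons.prems in simp)
  also have "\<dots> = ?e \<odot> (mode_gen y * (mode_gen x * gens ys)) + ctr x y \<odot> gens ys"
    by (simp add: distrib_right mult.assoc const_smult)
  also have "\<dots> \<approx> ?e \<odot> (mode_gen y * (?s ys \<odot> (gens ys * mode_gen x) + ?T ys)) + ctr x y \<odot> gens ys"
    by (intro op_eq_add op_eq_smult op_eq_mult op_eq_refl Cons.IH) (use Cons.prems in simp)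
  also have "\<dots> = ?s (y # ys) \<odot> (gens (y # ys) * mode_gen x) + ?T (y # ys)"
    by (simp add: distrib_left smult_alg_add mult.assoc ssum_Cons power_add ssum_mult_left smult_alg_ssum
        mult_ac(1)[where 'a = complex] mult.left_commute[where 'a = complex])
  finally show ?case .
qed simp

text \<open>The mirror image: the negative mode travels to the left and has passed the modes after
  \<open>y\<close>.\<close>

lemma gens_neg_op_eq:
  assumes x: "mode_sgn x = -1" and "\<And>y. y \<in> set ys \<Longrightarrow> mode_sgn y = 1"
  shows "gens ys * mode_gen x \<approx>
    (-1) ^ (par (fst x) * fer_no ys) \<odot> (mode_gen x * gens ys)
    + ssum (\<lambda>u y v. ((-1) ^ (par (fst x) * fer_no v) * ctr y x) \<odot> gens (u @ v)) ys"
    (is "_ \<approx> ?s ys \<odot> _ + ?T ys")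
  using assms(2)
proof (induction ys)
  case (Cons y ys)
  let ?e = "(-1) ^ (par (fst y) * par (fst x)) :: complex"
  have "gens (y # ys) * mode_gen x \<approx> mode_gen y * (?s ys \<odot> (mode_gen x * gens ys) + ?T ys)"
    unfolding gens_simps(2) mult.assoc
    by (intro op_eq_mult op_eq_refl Cons.IH) (use Cons.prems in simp)
  also have "\<dots> = ?s ys \<odot> (mode_gen y * mode_gen x * gens ys) + mode_gen y * ?T ys"
    by (simp add: distrib_left mult.assoc)
  also have "\<dots> \<approx> ?s ys \<odot> ((?e \<odot> (mode_gen x * mode_gen y) + const (ctr y x)) * gens ys) + mode_gen y * ?T ys"
    by (intro op_eq_add op_eq_smult op_eq_mult op_eq_refl pos_neg_op_eq x) (use Cons.prems in simp)
  also have "\<dots> = ?s (y # ys) \<odot> (mode_gen x * gens (y # ys)) + ?T (y # ys)"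
    by (simp add: distrib_right smult_alg_add mult.assoc ssum_Cons power_add ssum_mult_left const_smult
        distrib_left mult.commute[where 'a = nat] mult.commute[where 'a = complex])
  finally show ?case .
qed simp

text \<open>A negative \<open>x\<close> already stands in its place; a zero mode commutes with all
  the nonzero modes it has to cross; a positive \<open>x\<close> has to cross the negative modes,
  which produces the contractions.\<close>

lemma mode_gen_nord:
  "mode_gen x * nord B \<approx> nord (x # B)
    + ssum (\<lambda>u y v. ((-1) ^ (par (fst x) * fer_no u) * ctr x y) \<odot> nord (u @ v)) B"
proof -
  define N P Z where "N = gens (negs B)" "P = gens (poss B)" "Z = gens (zeros B)"
  define e :: complex where "e = (-1) ^ nord_inv B"
  have nB: "nord B = e \<odot> (N * (P * Z))" by (simp add: nord_eq N_P_Z_def e_def)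
  consider "mode_sgn x = -1" | "mode_sgn x = 0" | "mode_sgn x = 1" using mode_sgn_cases[of x] by blast
  then show ?thesis
  proof cases
    case 1
    then show ?thesis by (simp add: ctr_left nord_eq mult.assoc)
  next
    case 2
    have "mode_gen x * nord B = e \<odot> (mode_gen x * gens (negs B @ poss B) * Z)"
      by (simp add: nB mult.assoc N_P_Z_def)
    also have "\<dots> \<approx> e \<odot> (gens (negs B @ poss B) * mode_gen x * Z)"
      by (intro op_eq_smult op_eq_mult op_eq_refl zero_gens_op_eq 2) auto
    also have "\<dots> = nord (x # B)"
      using 2 by (simp add: nord_eq N_P_Z_def e_def mult.assoc)
    finally show ?thesis using 2 by (simp add: ctr_left)
  next
    case 3
    let ?p = "par (fst x)"
    let ?f = "\<lambda>u y v. ((-1) ^ (?p * fer_no u) * ctr x y) \<odot> gens (u @ v)"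
    have "mode_gen x * nord B = e \<odot> (mode_gen x * N * (P * Z))"
      by (simp add: nB mult.assoc)
    also have "\<dots> \<approx> e \<odot> (((-1) ^ (?p * fer_no (negs B)) \<odot> (N * mode_gen x) + ssum ?f (negs B)) * (P * Z))"
      unfolding N_P_Z_def by (intro op_eq_smult op_eq_mult op_eq_refl pos_gens_op_eq 3) auto
    also have "\<dots> = nord (x # B) + e \<odot> (ssum ?f (negs B) * (P * Z))"
      using 3 by (simp add: distrib_right smult_alg_add nord_eq N_P_Z_def e_def power_add mult.assoc
          mult.commute[where 'a = complex])
    also have "e \<odot> (ssum ?f (negs B) * (P * Z)) =
        ssum (\<lambda>u y v. ((-1) ^ (?p * fer_no u) * ctr x y) \<odot> nord (u @ v)) B"
      unfolding ssum_filter ssum_mult_right smult_alg_ssum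
    proof (rule ssum_cong)
      fix u y v assume B: "B = u @ y # v"
      show "e \<odot> ((if mode_sgn y = -1 then ?f (negs u) y (negs v) else 0) * (P * Z)) =
          ((-1) ^ (?p * fer_no u) * ctr x y) \<odot> nord (u @ v)"
      proof (cases "mode_sgn y = -1 \<and> par (fst y) = ?p")
        case True
        \<comment> \<open>If the negative mode \<open>y\<close> is a fermion, its removal destroys
          one inversion for each positive fermion of \<open>u\<close>. With the negative fermions of
          \<open>u\<close>, which \<open>x\<close> has passed, these are all fermions of
          \<open>u\<close>.\<close>
        have "e * (-1) ^ (?p * fer_no (negs u)) = (-1) ^ (?p * fer_no u) * (-1) ^ nord_inv (u @ v)"
          unfolding e_def B fer_no_split[of u] using True
          by (simp add: nord_inv_append flip: power_add) (auto simp: minus_one_power_iff)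
        moreover have "nord (u @ v) = (-1) ^ nord_inv (u @ v) \<odot> (gens (negs u @ negs v) * (P * Z))"
          using True by (simp add: nord_eq N_P_Z_def B)
        ultimately show ?thesis using True by (simp flip: mult.assoc) (simp add: mult_ac)
      qed (auto simp: ctr_right ctr_par)
    qed
    finally show ?thesis .
  qed
qed

text \<open>Zero modes come last, so a nonzero \<open>x\<close> first crosses them
  (\<open>commute\<close>); after that a negative \<open>x\<close> meets the positive modes and is
  contracted with them.\<close>

lemma nord_mode_gen:
  "nord A * mode_gen x \<approx> nord (A @ [x])
    + ssum (\<lambda>u y v. ((-1) ^ (par (fst x) * fer_no v) * ctr y x) \<odot> nord (u @ v)) A"
proof -
  define N P Z where "N = gens (negs A)" "P = gens (poss A)" "Z = gens (zeros A)"
  define e :: complex where "e = (-1) ^ nord_inv A"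
  have nA: "nord A = e \<odot> (N * (P * Z))" by (simp add: nord_eq N_P_Z_def e_def)
  have commute: "e \<odot> (N * (P * (Z * mode_gen x))) \<approx> e \<odot> (N * (P * (mode_gen x * Z)))"
    if "mode_sgn x \<noteq> 0"
    unfolding N_P_Z_def by (intro op_eq_smult op_eq_mult op_eq_refl gens_zeros_op_eq that)
  consider "mode_sgn x = -1" | "mode_sgn x = 0" | "mode_sgn x = 1" using mode_sgn_cases[of x] by blast
  then show ?thesis
  proof cases
    case 2
    then show ?thesis by (simp add: ctr_right nord_eq mult.assoc nord_inv_append)
  next
    case 3
    have "nord A * mode_gen x \<approx> e \<odot> (N * (P * (mode_gen x * Z)))"
      using commute 3 by (simp add: nA mult.assoc)
    also have "\<dots> = nord (A @ [x])"
      using 3 by (simp add: nord_eq N_P_Z_def e_def mult.assoc nord_inv_append)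
    finally show ?thesis using 3 by (simp add: ctr_right)
  next
    case 1
    let ?p = "par (fst x)"
    let ?f = "\<lambda>u y v. ((-1) ^ (?p * fer_no v) * ctr y x) \<odot> gens (u @ v)"
    have "nord A * mode_gen x \<approx> e \<odot> (N * (P * mode_gen x * Z))"
      using commute 1 by (simp add: nA mult.assoc)
    also have "\<dots> \<approx> e \<odot> (N * (((-1) ^ (?p * fer_no (poss A)) \<odot> (mode_gen x * P) + ssum ?f (poss A)) * Z))"
      unfolding N_P_Z_def by (intro op_eq_smult op_eq_mult op_eq_refl gens_neg_op_eq 1) auto
    also have "\<dots> = nord (A @ [x]) + e \<odot> (N * (ssum ?f (poss A) * Z))"
      using 1 by (simp add: distrib_right distrib_left smult_alg_add nord_eq N_P_Z_def e_def power_add mult.assoc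
          nord_inv_append mult.commute[where 'a = nat])
    also have "e \<odot> (N * (ssum ?f (poss A) * Z)) =
        ssum (\<lambda>u y v. ((-1) ^ (?p * fer_no v) * ctr y x) \<odot> nord (u @ v)) A"
      unfolding ssum_filter ssum_mult_right ssum_mult_left smult_alg_ssum
    proof (rule ssum_cong)
      fix u y v assume A: "A = u @ y # v"
      show "e \<odot> (N * ((if mode_sgn y = 1 then ?f (poss u) y (poss v) else 0) * Z)) =
          ((-1) ^ (?p * fer_no v) * ctr y x) \<odot> nord (u @ v)"
      proof (cases "mode_sgn y = 1 \<and> par (fst y) = ?p")
        case True
        \<comment> \<open>If the positive mode \<open>y\<close> is a fermion, its removal destroys
          one inversion for each negative fermion of \<open>v\<close>; with the positive fermions
          passed by \<open>x\<close> these are all fermions of \<open>v\<close>.\<close>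
        have "e * (-1) ^ (?p * fer_no (poss v)) = (-1) ^ (?p * fer_no v) * (-1) ^ nord_inv (u @ v)"
          unfolding e_def A fer_no_split[of v] using True
          by (simp add: nord_inv_append flip: power_add) (auto simp: minus_one_power_iff)
        moreover have "nord (u @ v) = (-1) ^ nord_inv (u @ v) \<odot> (N * (gens (poss u @ poss v) * Z))"
          using True by (simp add: nord_eq N_P_Z_def A)
        ultimately show ?thesis using True by (simp flip: mult.assoc) (simp add: mult_ac)
      qed (auto simp: ctr_left ctr_par)
    qed
    finally show ?thesis .
  qed
qed

end

section \<open>Products of two normally ordered lists of modes\<close>

context fock
begin

text \<open>\<open>wick_sum A M B\<close> sums over the partial pairings of \<open>rev A\<close> with \<open>B\<close>, the modes \<open>M\<close>
  between the two being left alone. The first list is reversed because the recursion moves the last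
  mode of the left factor into \<open>M\<close>.\<close>

primrec wick_sum :: "('h bf \<times> int) list \<Rightarrow> ('h bf \<times> int) list \<Rightarrow> ('h bf \<times> int) list \<Rightarrow> 'h hhat free_alg"
where
  "wick_sum [] M B = nord (M @ B)"
| "wick_sum (x # A) M B = wick_sum A (x # M) B
    + ssum (\<lambda>u y v. ((-1) ^ (par (fst x) * (fer_no M + fer_no u)) * ctr x y) \<odot> wick_sum A M (u @ v)) B"

text \<open>The defining recursion decides about the mode of \<open>A\<close> next to
  \<open>M\<close>; this one decides about the mode of \<open>B\<close> next to \<open>M\<close>.
  Both enumerate the same pairings, so the point is that the signs do not depend on the order of the
  decisions.\<close>

lemma wick_sum_Cons_right:
  "wick_sum A M (y # B) = wick_sum A (M @ [y]) B
    + ssum (\<lambda>u x v. ((-1) ^ (par (fst y) * (fer_no M + fer_no u)) * ctr x y) \<odot> wick_sum (u @ v) M B) A"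
proof (induction A arbitrary: M B)
  case (Cons x A)
  let ?px = "par (fst x)" and ?py = "par (fst y)"
  define L where "L (u :: ('h bf \<times> int) list) z = (-1) ^ (?px * (fer_no M + ?py + fer_no u)) * ctr x z" for u z
  define R where "R (u :: ('h bf \<times> int) list) a = (-1) ^ (?py * (fer_no M + fer_no u)) * ctr a y" for u a
  define L' where "L' (u :: ('h bf \<times> int) list) z = (-1) ^ (?px * (fer_no M + fer_no u)) * ctr x z" for u z
  define R' where "R' (u :: ('h bf \<times> int) list) a = (-1) ^ (?py * (fer_no M + ?px + fer_no u)) * ctr a y" for u a
  \<comment> \<open>The contractions of \<open>x\<close> with \<open>z\<close> and of
    \<open>a\<close> with \<open>y\<close> cross. Whichever is done first passes one more mode:
    \<open>y\<close> between \<open>x\<close> and \<open>z\<close>, or \<open>x\<close> between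
    \<open>a\<close> and \<open>y\<close>. Either way the extra exponent is
    \<open>?px * ?py\<close>.\<close>
  have LR: "L u z * R w a = R' w a * L' u z" for u w :: "('h bf \<times> int) list" and z a
    by (simp add: L_def R_def L'_def R'_def power_add algebra_simps)
  \<comment> \<open>A nonzero contraction forces equal parities, so the two sides may count with
    different ones.\<close>
  have xy: "(-1) ^ (?px * fer_no M) * ctr x y = (-1) ^ (?py * fer_no M) * ctr x y"
    using ctr_par[of x y] by (cases "?px = ?py") auto
  have "wick_sum (x # A) M (y # B) =
      wick_sum A (x # M) (y # B) + ((-1) ^ (?px * fer_no M) * ctr x y) \<odot> wick_sum A M B
      + ssum (\<lambda>u z v. L u z \<odot> wick_sum A M (y # u @ v)) B"
    by (simp add: ssum_Cons L_def add_ac)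
  also have "wick_sum A (x # M) (y # B) = wick_sum A (x # M @ [y]) B
      + ssum (\<lambda>u a v. R' u a \<odot> wick_sum (u @ v) (x # M) B) A"
    unfolding Cons.IH by (simp add: R'_def add_ac)
  also have "ssum (\<lambda>u z v. L u z \<odot> wick_sum A M (y # u @ v)) B =
      ssum (\<lambda>u z v. L u z \<odot> wick_sum A (M @ [y]) (u @ v)) B
      + ssum (\<lambda>u z v. ssum (\<lambda>u' a v'. (L u z * R u' a) \<odot> wick_sum (u' @ v') M (u @ v)) A) B"
    unfolding Cons.IH by (simp add: smult_alg_add smult_alg_ssum ssum_add R_def)
  also have "ssum (\<lambda>u z v. ssum (\<lambda>u' a v'. (L u z * R u' a) \<odot> wick_sum (u' @ v') M (u @ v)) A) B =
      ssum (\<lambda>u' a v'. R' u' a \<odot> ssum (\<lambda>u z v. L' u z \<odot> wick_sum (u' @ v') M (u @ v)) B) A"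
    unfolding LR by (subst ssum_swap) (simp add: smult_alg_ssum)
  finally have "wick_sum (x # A) M (y # B) =
      (wick_sum A (x # M @ [y]) B + ssum (\<lambda>u z v. L u z \<odot> wick_sum A (M @ [y]) (u @ v)) B)
      + (((-1) ^ (?py * fer_no M) * ctr x y) \<odot> wick_sum A M B
        + ssum (\<lambda>u a v. R' u a \<odot> (wick_sum (u @ v) (x # M) B
            + ssum (\<lambda>u' z v'. L' u' z \<odot> wick_sum (u @ v) M (u' @ v')) B)) A)"
    unfolding xy by (simp add: smult_alg_add ssum_add add_ac)
  then show ?case
    by (simp add: ssum_Cons L_def L'_def R'_def add_ac)
qed simp

text \<open>Induction on the left factor, moving its last mode \<open>x\<close> to the right factor:
  \<open>nord A * mode_gen x * nord B\<close> is expanded once as \<open>(nord A * mode_gen x) * nord B\<close> and once as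
  \<open>nord A * (mode_gen x * nord B)\<close>.\<close>

lemma nord_mult_nord: "nord (rev A) * nord B \<approx> wick_sum A [] B"
proof (induction A arbitrary: B rule: length_induct)
  case (1 A)
  show ?case
  proof (cases A)
    case (Cons x A')
    let ?p = "par (fst x)"
    define S where "S = ssum (\<lambda>u y v. ((-1) ^ (?p * fer_no u) * ctr y x) \<odot> nord (rev (u @ v))) A'"
    define S' where "S' = ssum (\<lambda>u y v. ((-1) ^ (?p * fer_no u) * ctr y x) \<odot> wick_sum (u @ v) [] B) A'"
    define T where "T = ssum (\<lambda>u y v. ((-1) ^ (?p * fer_no u) * ctr x y) \<odot> nord (u @ v)) B"
    define T' where "T' = ssum (\<lambda>u y v. ((-1) ^ (?p * fer_no u) * ctr x y) \<odot> wick_sum A' [] (u @ v)) B"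
    \<comment> \<open>Contractions delete modes from the interior of \<open>A'\<close>, which is why
      the induction is on the length.\<close>
    have IH: "nord (rev A'') * nord B'' \<approx> wick_sum A'' [] B''" if "length A'' \<le> length A'" for A'' B''
      using 1 that Cons by auto
    have S: "S * nord B \<approx> S'"
      unfolding S_def S'_def ssum_mult_right smult_alg_simps
      by (intro op_eq_ssum op_eq_smult IH) auto
    have T: "nord (rev A') * T \<approx> T'"
      unfolding T_def T'_def ssum_mult_left smult_alg_simps
      by (intro op_eq_ssum op_eq_smult IH) auto
    have "nord (rev A') * mode_gen x \<approx> nord (rev A) + S"
      using nord_mode_gen[of "rev A'" x] by (simp add: Cons S_def ssum_rev)
    from op_eq_diff[OF op_eq_sym[OF this] op_eq_refl[of S]]
    have "nord (rev A) \<approx> nord (rev A') * mode_gen x - S" by simp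
    from op_eq_mult[OF this op_eq_refl[of "nord B"]]
    have "nord (rev A) * nord B \<approx> nord (rev A') * (mode_gen x * nord B) - S * nord B"
      by (simp add: left_diff_distrib mult.assoc)
    also have "\<dots> \<approx> nord (rev A') * (nord (x # B) + T) - S * nord B"
      unfolding T_def by (intro op_eq_diff op_eq_mult op_eq_refl mode_gen_nord)
    also have "\<dots> = nord (rev A') * nord (x # B) + nord (rev A') * T - S * nord B"
      by (simp add: distrib_left)
    also have "\<dots> \<approx> wick_sum A' [] (x # B) + T' - S'"
      by (intro op_eq_diff op_eq_add S T IH) simp
    \<comment> \<open>By \<open>wick_sum_Cons_right\<close> the first summand contains
      \<open>S'\<close>, which cancels; the rest is the defining recursion for
      \<open>x # A'\<close>.\<close>
    also have "\<dots> = wick_sum A [] B"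
      by (simp add: wick_sum_Cons_right S'_def T'_def Cons)
    finally show ?thesis .
  qed simp
qed

end

section \<open>Sums over pairings\<close>

lemma ssum_map: "ssum f (map g xs) = ssum (\<lambda>u y v. f (map g u) (g y) (map g v)) xs"
  by (simp add: ssum_def take_map drop_map)

text \<open>In an increasing list of positions the entries before \<open>j\<close> are the smaller
  ones, so a sum over splittings becomes a sum over a set of positions.\<close>

lemma ssum_sorted:
  assumes "sorted_wrt (<) (xs :: nat list)"
  shows "ssum (\<lambda>u y v. f u y (u @ v)) xs =
    (\<Sum>j\<in>set xs. f (filter (\<lambda>k. k < j) xs) j (filter (\<lambda>k. k \<noteq> j) xs))"
  using assms
proof (induction xs arbitrary: f)
  case (Cons y xs)
  have gt: "y < k" if "k \<in> set xs" for k using Cons.prems that by simp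
  then have 1: "filter (\<lambda>k. k < y) xs = []" "filter (\<lambda>k. k \<noteq> y) xs = xs" "y \<notin> set xs"
    by (force simp: filter_empty_conv filter_id_conv)+
  have "ssum (\<lambda>u z v. f (y # u) z (y # u @ v)) xs =
      (\<Sum>j\<in>set xs. f (y # filter (\<lambda>k. k < j) xs) j (y # filter (\<lambda>k. k \<noteq> j) xs))"
    using Cons.IH[of "\<lambda>u z w. f (y # u) z (y # w)"] Cons.prems by simp
  also have "\<dots> = (\<Sum>j\<in>set xs. f (filter (\<lambda>k. k < j) (y # xs)) j (filter (\<lambda>k. k \<noteq> j) (y # xs)))"
    by (intro sum.cong refl) (use gt 1 in force)
  finally show ?case using 1 by (simp add: ssum_Cons)
qed simp

definition pairings :: "nat set \<Rightarrow> nat set \<Rightarrow> (nat list \<times> nat list) set" where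
  "pairings S T = {(I, J). set I \<subseteq> S \<and> sorted_wrt (<) I \<and> length J = length I \<and> distinct J \<and> set J \<subseteq> T}"

lemma sorted_wrt_less_distinct: "sorted_wrt (<) (xs :: nat list) \<Longrightarrow> distinct xs"
  by (simp add: strict_sorted_iff)

lemma finite_pairings: "finite S \<Longrightarrow> finite T \<Longrightarrow> finite (pairings S T)"
proof -
  assume "finite S" "finite T"
  then have "finite ({I. set I \<subseteq> S \<and> distinct I} \<times> {J. set J \<subseteq> T \<and> distinct J})"
    by (intro finite_cartesian_product finite_subset_distinct)
  then show ?thesis
    by (rule finite_subset[rotated]) (auto simp: pairings_def sorted_wrt_less_distinct)
qed

lemma pairings_empty: "pairings {} T = {([], [])}"
  by (auto simp: pairings_def)

text \<open>As \<open>k\<close> exceeds all of \<open>S\<close>, it can only be the last entry of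
  \<open>I\<close>, and then its partner is the last entry of \<open>J\<close>.\<close>

lemma pairings_insert:
  assumes "\<And>i. i \<in> S \<Longrightarrow> i < k"
  shows "pairings (insert k S) T =
    pairings S T \<union> (\<Union>j\<in>T. (\<lambda>(I, J). (I @ [k], J @ [j])) ` pairings S (T - {j}))"
    (is "_ = _ \<union> ?U")
proof (intro equalityI subsetI)
  fix p assume p: "p \<in> pairings (insert k S) T"
  obtain I J where IJ: "p = (I, J)" by (cases p)
  have *: "set I \<subseteq> insert k S" "sorted_wrt (<) I" "length J = length I" "distinct J" "set J \<subseteq> T"
    using p by (auto simp: pairings_def IJ)
  show "p \<in> pairings S T \<union> ?U"
  proof (cases "k \<in> set I")
    case False
    then show ?thesis using * by (auto simp: pairings_def IJ)
  next
    case True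
    then obtain I1 I2 where I: "I = I1 @ k # I2" by (meson split_list)
    have "I2 = []"
    proof (rule ccontr)
      assume "I2 \<noteq> []"
      then obtain i where i: "i \<in> set I2" by (cases I2) auto
      with *(2) have "k < i" by (auto simp: I sorted_wrt_append)
      with i *(1) assms show False by (force simp: I)
    qed
    with *(3) have "J \<noteq> []" by (auto simp: I)
    then obtain J1 j where J: "J = J1 @ [j]" by (meson rev_exhaust)
    have "k \<notin> set I1" using *(2) by (auto simp: I sorted_wrt_append)
    then have "(I1, J1) \<in> pairings S (T - {j})"
      using * \<open>I2 = []\<close> by (auto simp: pairings_def I J sorted_wrt_append)
    moreover have "j \<in> T" using * by (simp add: J)
    ultimately show ?thesis using \<open>I2 = []\<close> by (auto simp: IJ I J intro!: bexI[of _ j] rev_image_eqI)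
  qed
next
  fix p assume "p \<in> pairings S T \<union> ?U"
  then show "p \<in> pairings (insert k S) T"
    using assms by (auto simp: pairings_def sorted_wrt_append subset_iff)
qed

lemma sum_pairings_insert:
  assumes lt: "\<And>i. i \<in> S \<Longrightarrow> i < k" and fin: "finite S" "finite T"
  shows "(\<Sum>(I, J)\<in>pairings (insert k S) T. f I J) =
    (\<Sum>(I, J)\<in>pairings S T. f I J)
    + (\<Sum>j\<in>T. \<Sum>(I, J)\<in>pairings S (T - {j}). f (I @ [k]) (J @ [j]) :: 'c::comm_monoid_add)"
proof -
  let ?h = "\<lambda>j (I, J). (I @ [k], J @ [j]) :: nat list \<times> nat list"
  let ?U = "\<Union>j\<in>T. ?h j ` pairings S (T - {j})"
  have "k \<notin> S" using lt by blast
  then have disj: "pairings S T \<inter> ?U = {}" by (auto simp: pairings_def)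
  have finU: "finite ?U" using fin by (auto intro: finite_pairings)
  have eq: "pairings (insert k S) T = pairings S T \<union> ?U"
    by (rule pairings_insert) (rule lt)
  have "(\<Sum>(I, J)\<in>pairings (insert k S) T. f I J) =
      (\<Sum>(I, J)\<in>pairings S T. f I J) + (\<Sum>(I, J)\<in>?U. f I J)"
    unfolding eq using fin by (intro sum.union_disjoint finite_pairings finU disj)
  also have "(\<Sum>(I, J)\<in>?U. f I J) = (\<Sum>j\<in>T. \<Sum>(I, J)\<in>?h j ` pairings S (T - {j}). f I J)"
    using fin by (intro sum.UNION_disjoint) (auto intro: finite_pairings)
  also have "\<dots> = (\<Sum>j\<in>T. \<Sum>(I, J)\<in>pairings S (T - {j}). f (I @ [k]) (J @ [j]))"
    by (rule sum.cong[OF refl], subst sum.reindex) (auto simp: inj_on_def case_prod_unfold)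
  finally show ?thesis .
qed

section \<open>Fermion counts and the signs of pairings\<close>

text \<open>For \<open>xs = [1..<Suc s]\<close> this is s^F(j). A general \<open>xs\<close> occurs
  because contracted positions are deleted one by one.\<close>

definition fer_upto :: "(nat \<Rightarrow> 'h bf \<times> int) \<Rightarrow> nat list \<Rightarrow> nat \<Rightarrow> nat" where
  "fer_upto B xs j = length (filter (\<lambda>k. is_fer (fst (B k)) \<and> k \<le> j) xs)"

text \<open>This is r^F - r^F(i), see \<open>fer_count_below\<close>: a contraction of position
  \<open>i\<close> passes the fermions to its right.\<close>

definition fer_below :: "nat \<Rightarrow> (nat \<Rightarrow> 'h bf \<times> int) \<Rightarrow> nat \<Rightarrow> nat" where
  "fer_below r A i = length (filter (\<lambda>k. is_fer (fst (A k)) \<and> i < k) [1..<Suc r])"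

lemma fer_upto_filter:
  assumes "is_fer (fst (B j))" "j \<in> set xs" "distinct xs"
  shows "fer_upto B xs j' = fer_upto B (filter (\<lambda>k. k \<noteq> j) xs) j' + (if j \<le> j' then 1 else 0)"
  using assms(2,3)
proof (induction xs)
  case (Cons x xs)
  show ?case
  proof (cases "x = j")
    case True
    then have "filter (\<lambda>k. k \<noteq> j) xs = xs" using Cons.prems by (auto simp: filter_id_conv)
    with True assms(1) show ?thesis by (auto simp: fer_upto_def)
  qed (use Cons in \<open>auto simp: fer_upto_def\<close>)
qed simp

lemma fer_upto_filter_bos:
  "\<not> is_fer (fst (B j)) \<Longrightarrow> fer_upto B (filter (\<lambda>k. k \<noteq> j) xs) = fer_upto B xs"
  by (rule ext, induction xs) (auto simp: fer_upto_def)

lemma fer_no_less: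
  assumes "is_fer (fst (B j))" "j \<in> set xs" "distinct xs"
  shows "fer_upto B xs j = fer_no (map B (filter (\<lambda>k. k < j) xs)) + 1"
proof -
  have "fer_upto B (filter (\<lambda>k. k \<noteq> j) xs) j = fer_no (map B (filter (\<lambda>k. k < j) xs))"
    by (induction xs) (auto simp: fer_upto_def par_bool)
  then show ?thesis using fer_upto_filter[of B j xs j] assms by simp
qed

lemma is_fer_iff: "is_fer x \<longleftrightarrow> \<not> is_bos x"
  by (cases x) auto

context fock
begin

text \<open>Removing the last pair \<open>(Suc r, j)\<close> of a pairing changes \<open>pair_sign\<close>, up to an even number,
  by the number of fermions between the two contracted modes.\<close>

definition pair_sign :: "nat \<Rightarrow> (nat \<Rightarrow> 'h bf \<times> int) \<Rightarrow> ('h bf \<times> int) list \<Rightarrow> (nat \<Rightarrow> 'h bf \<times> int) \<Rightarrow>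
    nat list \<Rightarrow> nat list \<Rightarrow> nat list \<Rightarrow> nat" where
  "pair_sign r A M B xs I J = (\<Sum>i\<leftarrow>I. fer_below r A i) + fer_no M * length I
     + length I * (length I + 1) div 2 + (\<Sum>j\<leftarrow>J. fer_upto B xs j) + inversions J"

definition ctr_prod :: "(nat \<Rightarrow> 'h bf \<times> int) \<Rightarrow> (nat \<Rightarrow> 'h bf \<times> int) \<Rightarrow> nat list \<Rightarrow> nat list \<Rightarrow> complex"
where
  "ctr_prod A B I J = prod_list (map2 (\<lambda>i j. ctr (A i) (B j)) I J)"

text \<open>\<open>I\<close>, \<open>J\<close> hold the bosonic pairs and \<open>I'\<close>,
  \<open>J'\<close> the fermionic ones; only the latter enter the sign.\<close>

definition pair_term :: "nat \<Rightarrow> (nat \<Rightarrow> 'h bf \<times> int) \<Rightarrow> ('h bf \<times> int) list \<Rightarrow> (nat \<Rightarrow> 'h bf \<times> int) \<Rightarrow>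
    nat list \<Rightarrow> nat list \<Rightarrow> nat list \<Rightarrow> nat list \<Rightarrow> nat list \<Rightarrow> 'h hhat free_alg" where
  "pair_term r A M B xs I J I' J' =
    (ctr_prod A B I J * ctr_prod A B I' J' * (-1) ^ pair_sign r A M B xs I' J') \<odot>
    nord (map A (filter (\<lambda>i. i \<notin> set I \<union> set I') [1..<Suc r]) @ M
      @ map B (filter (\<lambda>j. j \<notin> set J \<union> set J') xs))"

definition bos_set where "bos_set r A = {i \<in> {1..r}. is_bos (fst (A i))}"
definition fer_set where "fer_set r A = {i \<in> {1..r}. is_fer (fst (A i))}"

lemma fer_below_Suc:
  "i \<le> r \<Longrightarrow> fer_below (Suc r) A i = fer_below r A i + par (fst (A (Suc r)))"
  "fer_below (Suc r) A (Suc r) = 0"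
  by (auto simp: fer_below_def par_bool filter_empty_conv)

lemma ctr_prod_snoc:
  "length I = length J \<Longrightarrow> ctr_prod A B (I @ [i]) (J @ [j]) = ctr_prod A B I J * ctr (A i) (B j)"
  by (simp add: ctr_prod_def)

lemma sum_fer_below_Suc:
  assumes "set I \<subseteq> {1..r}"
  shows "(\<Sum>i\<leftarrow>I. fer_below (Suc r) A i) = (\<Sum>i\<leftarrow>I. fer_below r A i) + length I * par (fst (A (Suc r)))"
  using assms by (induction I) (auto simp: fer_below_Suc)

text \<open>The uncontracted mode at \<open>Suc r\<close> joins \<open>M\<close>: its parity leaves
  \<open>fer_below\<close> for each entry of \<open>I'\<close> and reappears in
  \<open>fer_no M * length I'\<close>.\<close>

lemma pair_term_Suc:
  assumes "set I \<subseteq> {1..r}" "set I' \<subseteq> {1..r}"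
  shows "pair_term (Suc r) A M B xs I J I' J' = pair_term r A (A (Suc r) # M) B xs I J I' J'"
proof -
  have "Suc r \<notin> set I \<union> set I'" using assms by auto
  moreover have "pair_sign (Suc r) A M B xs I' J' = pair_sign r A (A (Suc r) # M) B xs I' J'"
    unfolding pair_sign_def sum_fer_below_Suc[OF assms(2)] by (simp add: algebra_simps)
  ultimately show ?thesis by (simp add: pair_term_def)
qed

lemma pair_term_bos:
  assumes "set I \<subseteq> {1..r}" "set I' \<subseteq> {1..r}" "length I = length J"
    and "is_bos (fst (A (Suc r)))" "is_bos (fst (B j))"
  shows "pair_term (Suc r) A M B xs (I @ [Suc r]) (J @ [j]) I' J' =
    ctr (A (Suc r)) (B j) \<odot> pair_term r A M B (filter (\<lambda>k. k \<noteq> j) xs) I J I' J'"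
proof -
  have par: "par (fst (A (Suc r))) = 0" using assms(4) by (simp add: par_bool is_fer_iff)
  have fil: "filter (\<lambda>i. i \<notin> set (I @ [Suc r]) \<union> set I') [1..<Suc (Suc r)] =
      filter (\<lambda>i. i \<notin> set I \<union> set I') [1..<Suc r]"
    using assms(1,2) by (auto intro!: filter_cong)
  have fil2: "filter (\<lambda>k. k \<notin> set (J @ [j]) \<union> set J') xs =
      filter (\<lambda>k. k \<notin> set J \<union> set J') (filter (\<lambda>k. k \<noteq> j) xs)"
    by (auto intro!: filter_cong)
  have "\<not> is_fer (fst (B j))" using assms(5) by (simp add: is_fer_iff)
  then have sgn: "pair_sign (Suc r) A M B xs I' J' = pair_sign r A M B (filter (\<lambda>k. k \<noteq> j) xs) I' J'"
    unfolding pair_sign_def sum_fer_below_Suc[OF assms(2)] by (simp add: par fer_upto_filter_bos)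
  show ?thesis
    unfolding pair_term_def fil fil2 sgn ctr_prod_snoc[OF assms(3)] by (simp add: mult_ac)
qed

lemma pair_term_fer:
  assumes "set I \<subseteq> {1..r}" "set I' \<subseteq> {1..r}" "length I' = length J'"
    and "is_fer (fst (A (Suc r)))" "is_fer (fst (B j))"
    and "j \<in> set xs" "distinct xs" "j \<notin> set J'"
  shows "pair_term (Suc r) A M B xs I J (I' @ [Suc r]) (J' @ [j]) =
    ((-1) ^ (fer_no M + fer_no (map B (filter (\<lambda>k. k < j) xs))) * ctr (A (Suc r)) (B j)) \<odot>
    pair_term r A M B (filter (\<lambda>k. k \<noteq> j) xs) I J I' J'"
proof -
  let ?xs = "filter (\<lambda>k. k \<noteq> j) xs" and ?n = "length I'"
  let ?f = "fer_no (map B (filter (\<lambda>k. k < j) xs))"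
  let ?g = "length (filter (\<lambda>k. j < k) J')"
  have par: "par (fst (A (Suc r))) = 1" using assms(4) by (simp add: par_bool)
  have fil: "filter (\<lambda>i. i \<notin> set I \<union> set (I' @ [Suc r])) [1..<Suc (Suc r)] =
      filter (\<lambda>i. i \<notin> set I \<union> set I') [1..<Suc r]"
    using assms(1,2) by (auto intro!: filter_cong)
  have fil2: "filter (\<lambda>k. k \<notin> set J \<union> set (J' @ [j])) xs =
      filter (\<lambda>k. k \<notin> set J \<union> set J') (filter (\<lambda>k. k \<noteq> j) xs)"
    by (auto intro!: filter_cong)
  have upto: "(\<Sum>k\<leftarrow>J'. fer_upto B xs k) = (\<Sum>k\<leftarrow>J'. fer_upto B ?xs k) + ?g"
    using assms(8) by (induction J') (auto simp: fer_upto_filter[of B j xs] assms(5-7))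
  have "inversions (J' @ [j]) = inversions J' + ?g"
    by (induction J') auto
  moreover have "(\<Sum>i\<leftarrow>I' @ [Suc r]. fer_below (Suc r) A i) = (\<Sum>i\<leftarrow>I'. fer_below r A i) + ?n"
    by (simp add: sum_fer_below_Suc[OF assms(2)] par fer_below_Suc)
  moreover have "(?n + 1) * (?n + 1 + 1) div 2 = ?n * (?n + 1) div 2 + ?n + 1"
  proof -
    have "(?n + 1) * (?n + 1 + 1) = ?n * (?n + 1) + 2 * (?n + 1)" by (simp add: algebra_simps)
    then show ?thesis by simp
  qed
  \<comment> \<open>The new fermion lies after \<open>?n\<close> earlier ones, the triangular number
    grows by \<open>?n + 1\<close>, and \<open>fer_upto\<close> counts \<open>j\<close> itself:
    together 2(\<open>?n\<close> + 1). The number \<open>?g\<close> arises twice, from deleting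
    \<open>j\<close> in \<open>xs\<close> and from the inversions of the longer list.\<close>
  ultimately have "pair_sign (Suc r) A M B xs (I' @ [Suc r]) (J' @ [j]) =
      pair_sign r A M B ?xs I' J' + (fer_no M + ?f) + 2 * (?n + 1 + ?g)"
    unfolding pair_sign_def using fer_no_less[of B j xs] assms(5-7) upto
    by (simp add: algebra_simps)
  then have sgn: "(-1 :: complex) ^ pair_sign (Suc r) A M B xs (I' @ [Suc r]) (J' @ [j]) =
      (-1) ^ (fer_no M + ?f) * (-1) ^ pair_sign r A M B ?xs I' J'"
    by (simp add: power_add power_mult)
  show ?thesis
    unfolding pair_term_def fil fil2 sgn ctr_prod_snoc[OF assms(3)] by (simp add: mult_ac)
qed

text \<open>Induction on \<open>r\<close> with \<open>M\<close> and \<open>xs\<close> arbitrary: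
  position \<open>Suc r\<close> either stays free and joins \<open>M\<close>, or takes a partner
  \<open>j\<close>, which leaves \<open>xs\<close>. The sums over \<open>pairings\<close> split in
  the same way by \<open>sum_pairings_insert\<close>.\<close>

lemma wick_sum_eq:
  assumes "sorted_wrt (<) xs"
  shows "wick_sum (rev (map A [1..<Suc r])) M (map B xs) =
    (\<Sum>(I, J)\<in>pairings (bos_set r A) {j \<in> set xs. is_bos (fst (B j))}.
      \<Sum>(I', J')\<in>pairings (fer_set r A) {j \<in> set xs. is_fer (fst (B j))}. pair_term r A M B xs I J I' J')"
  using assms
proof (induction r arbitrary: M xs)
  case 0
  then show ?case
    by (simp add: bos_set_def fer_set_def pairings_empty pair_term_def ctr_prod_def pair_sign_def)
next
  case (Suc r)
  let ?x = "A (Suc r)" and ?A = "rev (map A [1..<Suc r])"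
  let ?Tb = "{j \<in> set xs. is_bos (fst (B j))}" and ?Tf = "{j \<in> set xs. is_fer (fst (B j))}"
  let ?xs = "\<lambda>j. filter (\<lambda>k. k \<noteq> j) xs"
  let ?e = "\<lambda>j. (-1) ^ (par (fst ?x) * (fer_no M + fer_no (map B (filter (\<lambda>k. k < j) xs)))) * ctr ?x (B j)"
  let ?E = "\<lambda>j. ?e j \<odot> wick_sum ?A M (map B (?xs j))"
  have dist: "distinct xs" by (rule sorted_wrt_less_distinct[OF Suc.prems])
  have fin: "finite (bos_set r A)" "finite (fer_set r A)" "finite ?Tb" "finite ?Tf"
    by (auto simp: bos_set_def fer_set_def)
  have lt: "i < Suc r" if "i \<in> bos_set r A" for i using that by (simp add: bos_set_def)
  have lt': "i < Suc r" if "i \<in> fer_set r A" for i using that by (simp add: fer_set_def)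
  have sub: "set I \<subseteq> {1..r}" "length I = length J" "set J \<subseteq> T"
    if "(I, J) \<in> pairings (bos_set r A) T" for I J T
    using that by (auto simp: pairings_def bos_set_def)
  have sub': "set I \<subseteq> {1..r}" "length I = length J" "set J \<subseteq> T"
    if "(I, J) \<in> pairings (fer_set r A) T" for I J T
    using that by (auto simp: pairings_def fer_set_def)
  have IH: "wick_sum ?A M (map B (?xs j)) =
      (\<Sum>(I, J)\<in>pairings (bos_set r A) (?Tb - {j}).
        \<Sum>(I', J')\<in>pairings (fer_set r A) (?Tf - {j}). pair_term r A M B (?xs j) I J I' J')" for j
  proof -
    have "{k \<in> set (?xs j). is_bos (fst (B k))} = ?Tb - {j}" "{k \<in> set (?xs j). is_fer (fst (B k))} = ?Tf - {j}"
      by auto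
    then show ?thesis
      using Suc.IH[of "?xs j" M] sorted_wrt_filter[OF Suc.prems] by simp
  qed
  have eqS: "pair_term r A (?x # M) B xs I J I' J' = pair_term (Suc r) A M B xs I J I' J'"
    if p: "(I, J) \<in> pairings (bos_set r A) ?Tb" and q: "(I', J') \<in> pairings (fer_set r A) ?Tf"
    for I J I' J'
    by (rule pair_term_Suc[symmetric, OF sub(1)[OF p] sub'(1)[OF q]])
  have "wick_sum (rev (map A [1..<Suc (Suc r)])) M (map B xs) =
      wick_sum ?A (?x # M) (map B xs) + (\<Sum>j\<in>set xs. ?E j)"
    using ssum_sorted[OF Suc.prems, of "\<lambda>u y w.
        ((-1) ^ (par (fst ?x) * (fer_no M + fer_no (map B u))) * ctr ?x (B y)) \<odot> wick_sum ?A M (map B w)"]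
    by (simp add: ssum_map)
  also have "wick_sum ?A (?x # M) (map B xs) =
      (\<Sum>(I, J)\<in>pairings (bos_set r A) ?Tb.
        \<Sum>(I', J')\<in>pairings (fer_set r A) ?Tf. pair_term (Suc r) A M B xs I J I' J')"
    unfolding Suc.IH[OF Suc.prems] case_prod_unfold by (intro sum.cong refl) (simp_all add: eqS)
  finally have *: "wick_sum (rev (map A [1..<Suc (Suc r)])) M (map B xs) =
      (\<Sum>(I, J)\<in>pairings (bos_set r A) ?Tb.
        \<Sum>(I', J')\<in>pairings (fer_set r A) ?Tf. pair_term (Suc r) A M B xs I J I' J')
      + (\<Sum>j\<in>set xs. ?E j)" .
  show ?case
  proof (cases "is_bos (fst ?x)")
    case True
    have sets: "bos_set (Suc r) A = insert (Suc r) (bos_set r A)" "fer_set (Suc r) A = fer_set r A"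
      using True by (auto simp: bos_set_def fer_set_def le_Suc_eq is_fer_iff)
    have "(\<Sum>j\<in>set xs. ?E j) = (\<Sum>j\<in>?Tb. ?E j)"
    proof (rule sum.mono_neutral_right)
      have "?E j = 0" if "\<not> is_bos (fst (B j))" for j
      proof -
        have "ctr ?x (B j) = 0" using True that by (intro ctr_par) (simp add: par_bool is_fer_iff)
        then show ?thesis by (simp only: mult_zero_right smult_alg_simps)
      qed
      then show "\<forall>j\<in>set xs - ?Tb. ?E j = 0" by blast
    qed auto
    also have "\<dots> = (\<Sum>j\<in>?Tb. \<Sum>(I, J)\<in>pairings (bos_set r A) (?Tb - {j}).
        \<Sum>(I', J')\<in>pairings (fer_set r A) ?Tf.
          pair_term (Suc r) A M B xs (I @ [Suc r]) (J @ [j]) I' J')"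
    proof (intro sum.cong refl)
      fix j assume j: "j \<in> ?Tb"
      then have "?Tf - {j} = ?Tf" by (auto simp: is_fer_iff)
      moreover have eq: "ctr ?x (B j) \<odot> pair_term r A M B (?xs j) I J I' J' =
          pair_term (Suc r) A M B xs (I @ [Suc r]) (J @ [j]) I' J'"
        if p: "(I, J) \<in> pairings (bos_set r A) (?Tb - {j})" and q: "(I', J') \<in> pairings (fer_set r A) ?Tf"
        for I J I' J'
        using pair_term_bos[of I r I' J A B j M xs J', OF sub(1)[OF p] sub'(1)[OF q] sub(2)[OF p] True] j
        by simp
      moreover have "par (fst ?x) = 0" using True by (simp add: par_bool is_fer_iff)
      ultimately show "?E j = (\<Sum>(I, J)\<in>pairings (bos_set r A) (?Tb - {j}).
          \<Sum>(I', J')\<in>pairings (fer_set r A) ?Tf.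
            pair_term (Suc r) A M B xs (I @ [Suc r]) (J @ [j]) I' J')"
        unfolding IH smult_alg_sum case_prod_unfold by (intro sum.cong refl) (simp_all add: eq)
    qed
    finally have E: "(\<Sum>j\<in>set xs. ?E j) = \<dots>" .
    show ?thesis
      unfolding * E sets by (rule sum_pairings_insert[OF lt fin(1,3), symmetric])
  next
    case False
    then have x: "is_fer (fst ?x)" by (simp add: is_fer_iff)
    have sets: "fer_set (Suc r) A = insert (Suc r) (fer_set r A)" "bos_set (Suc r) A = bos_set r A"
      using x by (auto simp: bos_set_def fer_set_def le_Suc_eq is_fer_iff)
    let ?t = "\<lambda>j (I, J) (I', J'). pair_term (Suc r) A M B xs I J (I' @ [Suc r]) (J' @ [j])"
    have "(\<Sum>j\<in>set xs. ?E j) = (\<Sum>j\<in>?Tf. ?E j)"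
    proof (rule sum.mono_neutral_right)
      have "?E j = 0" if "\<not> is_fer (fst (B j))" for j
      proof -
        have "ctr ?x (B j) = 0" using x that by (intro ctr_par) (simp add: par_bool is_fer_iff)
        then show ?thesis by (simp only: mult_zero_right smult_alg_simps)
      qed
      then show "\<forall>j\<in>set xs - ?Tf. ?E j = 0" by blast
    qed auto
    also have "\<dots> = (\<Sum>j\<in>?Tf. \<Sum>p\<in>pairings (bos_set r A) ?Tb.
        \<Sum>q\<in>pairings (fer_set r A) (?Tf - {j}). ?t j p q)"
    proof (intro sum.cong refl)
      fix j assume j: "j \<in> ?Tf"
      then have "?Tb - {j} = ?Tb" by (auto simp: is_fer_iff)
      moreover have eq: "((-1) ^ (fer_no M + fer_no (map B (filter (\<lambda>k. k < j) xs))) * ctr ?x (B j)) \<odot>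
          pair_term r A M B (?xs j) I J I' J' = pair_term (Suc r) A M B xs I J (I' @ [Suc r]) (J' @ [j])"
        if p: "(I, J) \<in> pairings (bos_set r A) ?Tb" and q: "(I', J') \<in> pairings (fer_set r A) (?Tf - {j})"
        for I J I' J'
      proof -
        have "j \<notin> set J'" using sub'(3)[OF q] by blast
        then show ?thesis
          using pair_term_fer[of I r I' J' A B j xs M J, OF sub(1)[OF p] sub'(1)[OF q] sub'(2)[OF q] x _ _ dist] j
          by simp
      qed
      moreover have "par (fst ?x) = 1" using x by (simp add: par_bool)
      ultimately show "?E j = (\<Sum>p\<in>pairings (bos_set r A) ?Tb.
          \<Sum>q\<in>pairings (fer_set r A) (?Tf - {j}). ?t j p q)"
        unfolding IH smult_alg_sum case_prod_unfold by (intro sum.cong refl) (simp_all add: eq)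
    qed
    \<comment> \<open>The bosonic sum goes outside, so that the new pair can be inserted into the
      inner, fermionic sum.\<close>
    also have "\<dots> = (\<Sum>p\<in>pairings (bos_set r A) ?Tb. \<Sum>j\<in>?Tf.
        \<Sum>q\<in>pairings (fer_set r A) (?Tf - {j}). ?t j p q)"
      by (rule sum.swap)
    finally have E: "(\<Sum>j\<in>set xs. ?E j) = \<dots>" .
    have ins: "(\<Sum>(I', J')\<in>pairings (insert (Suc r) (fer_set r A)) ?Tf. pair_term (Suc r) A M B xs I J I' J') =
        (\<Sum>(I', J')\<in>pairings (fer_set r A) ?Tf. pair_term (Suc r) A M B xs I J I' J')
        + (\<Sum>j\<in>?Tf. \<Sum>q\<in>pairings (fer_set r A) (?Tf - {j}). ?t j (I, J) q)" for I J
      unfolding case_prod_conv by (rule sum_pairings_insert[OF lt' fin(2,4)])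
    show ?thesis
      unfolding * E sets ins unfolding case_prod_unfold sum.distrib fst_conv snd_conv by (rule refl)
  qed
qed

end

section \<open>Permanents, determinants and coefficients of series\<close>

text \<open>A list of distinct entries is a unique rearrangement of a unique increasing list. This
  absorbs the permutations of permanents and determinants into the second list of a pairing.\<close>

lemma sum_permuted_tuples:
  "(\<Sum>J\<in>incr_tuples T k. \<Sum>\<sigma> | \<sigma> permutes {..<k}. f (permute_list \<sigma> J)) =
   (\<Sum>J | length J = k \<and> distinct J \<and> set J \<subseteq> T. f J)"
proof -
  have bij: "bij_betw (\<lambda>(J, \<sigma>). permute_list \<sigma> J) (incr_tuples T k \<times> {\<sigma>. \<sigma> permutes {..<k}})
      {J. length J = k \<and> distinct J \<and> set J \<subseteq> T}"
  proof (rule bij_betwI')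
    fix p q
    assume "p \<in> incr_tuples T k \<times> {\<sigma>. \<sigma> permutes {..<k}}" "q \<in> incr_tuples T k \<times> {\<sigma>. \<sigma> permutes {..<k}}"
    moreover obtain J \<sigma> J' \<sigma>' where pq: "p = (J, \<sigma>)" "q = (J', \<sigma>')" by (cases p, cases q)
    ultimately have J: "length J = k" "sorted_wrt (<) J" "\<sigma> permutes {..<k}"
      and J': "length J' = k" "sorted_wrt (<) J'" "\<sigma>' permutes {..<k}"
      by (auto simp: incr_tuples_def)
    have "p = q" if eq: "permute_list \<sigma> J = permute_list \<sigma>' J'"
    proof -
      have "set J = set J'"
        using arg_cong[OF eq, of set] J J' by simp
      then have JJ': "J = J'"
        using J(2) J'(2) by (metis strict_sorted_equal)
      have "\<sigma> i = \<sigma>' i" for i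
      proof (cases "i < k")
        case True
        then have "J ! \<sigma> i = J ! \<sigma>' i"
          using arg_cong[OF eq, of "\<lambda>l. l ! i"] J J' by (simp add: permute_list_nth JJ')
        moreover have "\<sigma> i < k" "\<sigma>' i < k"
          using True permutes_in_image[OF J(3)] permutes_in_image[OF J'(3)] by auto
        ultimately show ?thesis
          using sorted_wrt_less_distinct[OF J(2)] J(1) by (simp add: nth_eq_iff_index_eq)
      next
        case False
        then show ?thesis using J(3) J'(3) by (simp add: permutes_not_in)
      qed
      then show ?thesis by (auto simp: pq JJ')
    qed
    then show "((\<lambda>(J, \<sigma>). permute_list \<sigma> J) p = (\<lambda>(J, \<sigma>). permute_list \<sigma> J) q) = (p = q)"
      by (auto simp: pq)
  next
    fix p assume "p \<in> incr_tuples T k \<times> {\<sigma>. \<sigma> permutes {..<k}}"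
    then show "(\<lambda>(J, \<sigma>). permute_list \<sigma> J) p \<in> {J. length J = k \<and> distinct J \<and> set J \<subseteq> T}"
      by (auto simp: incr_tuples_def sorted_wrt_less_distinct)
  next
    fix L assume "L \<in> {J. length J = k \<and> distinct J \<and> set J \<subseteq> T}"
    then have L: "length L = k" "distinct L" "set L \<subseteq> T" by auto
    define J where "J = sorted_list_of_set (set L)"
    have J: "set J = set L" "length J = k" "sorted_wrt (<) J"
      using L by (simp_all add: J_def distinct_card)
    have "mset L = mset J"
      using J L sorted_wrt_less_distinct by (metis set_eq_iff_mset_eq_distinct)
    then obtain \<sigma> where "\<sigma> permutes {..<length J}" "permute_list \<sigma> J = L"
      by (rule mset_eq_permutation)
    then show "\<exists>p\<in>incr_tuples T k \<times> {\<sigma>. \<sigma> permutes {..<k}}. L = (\<lambda>(J, \<sigma>). permute_list \<sigma> J) p"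
      using J L by (intro bexI[of _ "(J, \<sigma>)"]) (auto simp: incr_tuples_def)
  qed
  show ?thesis
    using sum.reindex_bij_betw[OF bij, of f]
    by (simp add: sum.cartesian_product case_prod_unfold)
qed

text \<open>Indexing into an increasing \<open>J\<close> preserves order, so the inversions are
  those of the one-line notation of \<sigma>.\<close>

lemma sign_eq_inversions:
  assumes "\<sigma> permutes {..<length J}" "sorted_wrt (<) J"
  shows "sign \<sigma> = (-1) ^ inversions (permute_list \<sigma> J)"
proof -
  let ?l = "map \<sigma> [0..<length J]"
  have set: "set ?l = {..<length J}"
    using permutes_image[OF assms(1)] by (simp add: atLeast0LessThan)
  have "distinct ?l"
    using permutes_inj_on[OF assms(1)] by (simp add: distinct_map)
  moreover have "list_perm ?l = \<sigma>"
    using permutes_not_in[OF assms(1)] by (auto simp: list_perm_def fun_eq_iff)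
  ultimately have "sign \<sigma> = (-1) ^ inversions ?l"
    using sign_list_perm[of ?l] set by simp
  also have "inversions ?l = inversions (map ((!) J) ?l)"
  proof (rule inversions_map_strict[symmetric])
    fix x y assume "x \<in> set ?l" "y \<in> set ?l"
    then have "x < length J" "y < length J" unfolding set by auto
    then show "J ! x < J ! y \<longleftrightarrow> x < y"
      using sorted_wrt_nth_less[OF assms(2)] by (metis linorder_less_linear order_less_asym)
  qed
  finally show ?thesis by (simp add: permute_list_def comp_def)
qed

section \<open>Exponents split along disjoint sets of variables\<close>

definition restrict_monom :: "var set \<Rightarrow> monom \<Rightarrow> monom" where
  "restrict_monom S e = Poly_Mapping.mapp (\<lambda>v x. if v \<in> S then x else 0) e"

lemma lookup_restrict_monom [simp]:
  "Poly_Mapping.lookup (restrict_monom S e) v = (if v \<in> S then Poly_Mapping.lookup e v else 0)"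
  by (simp add: restrict_monom_def lookup_mapp in_keys_iff when_def)

lemma keys_restrict_monom [simp]: "Poly_Mapping.keys (restrict_monom S e) = Poly_Mapping.keys e \<inter> S"
  by (auto simp: in_keys_iff split: if_splits)

lemma restrict_restrict_monom [simp]:
  "restrict_monom S (restrict_monom T e) = restrict_monom (S \<inter> T) e"
  by (intro poly_mapping_eqI) simp

text \<open>An exponent splits in only one way into a part on \<open>S\<close> and a part off
  \<open>S\<close>, so the convolution has at most one term.\<close>

lemma ser_mult_disjoint:
  assumes f: "\<And>d. f d \<noteq> 0 \<Longrightarrow> Poly_Mapping.keys d \<subseteq> S"
    and g: "\<And>d. g d \<noteq> 0 \<Longrightarrow> Poly_Mapping.keys d \<inter> S = {}"
  shows "ser_mult f g e = f (restrict_monom S e) * g (restrict_monom (- S) e)"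
proof -
  let ?D = "{d. f d \<noteq> 0 \<and> g (e - d) \<noteq> 0}" and ?d = "restrict_monom S e"
  have e: "e - ?d = restrict_monom (- S) e"
    by (intro poly_mapping_eqI) (simp add: lookup_minus)
  have "?D \<subseteq> {?d}"
  proof
    fix d assume "d \<in> ?D"
    then have d: "Poly_Mapping.keys d \<subseteq> S" "Poly_Mapping.keys (e - d) \<inter> S = {}"
      using f g by auto
    have "Poly_Mapping.lookup d v = Poly_Mapping.lookup ?d v" for v
    proof (cases "v \<in> S")
      case True
      then have "Poly_Mapping.lookup (e - d) v = 0" using d(2) by (auto simp: in_keys_iff)
      with True show ?thesis by (simp add: lookup_minus)
    next
      case False
      then show ?thesis using d(1) by (auto simp: in_keys_iff)
    qed
    then show "d \<in> {?d}" by (auto intro: poly_mapping_eqI)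
  qed
  then have "ser_mult f g e = (\<Sum>d\<in>{?d}. f d * g (e - d))"
    unfolding ser_mult_def by (intro sum.mono_neutral_left) auto
  then show ?thesis by (simp add: e)
qed

lemma ser_prod_disjoint:
  fixes f :: "'i \<Rightarrow> complex series"
  assumes "distinct xs"
    and "\<And>i d. i \<in> set xs \<Longrightarrow> f i d \<noteq> 0 \<Longrightarrow> Poly_Mapping.keys d \<subseteq> S i"
    and "\<And>i j. i \<in> set xs \<Longrightarrow> j \<in> set xs \<Longrightarrow> i \<noteq> j \<Longrightarrow> S i \<inter> S j = {}"
  shows "ser_prod (map f xs) e =
    (if Poly_Mapping.keys e \<subseteq> (\<Union>i\<in>set xs. S i) then \<Prod>i\<leftarrow>xs. f i (restrict_monom (S i) e) else 0)"
  using assms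
proof (induction xs arbitrary: e)
  case Nil
  then show ?case by (auto simp: ser_prod_def ser_one_def)
next
  case (Cons x xs)
  have IH: "ser_prod (map f xs) e =
    (if Poly_Mapping.keys e \<subseteq> (\<Union>i\<in>set xs. S i) then \<Prod>i\<leftarrow>xs. f i (restrict_monom (S i) e) else 0)" for e
    using Cons.prems by (intro Cons.IH) auto
  have disj: "S x \<inter> S i = {}" if "i \<in> set xs" for i
    using Cons.prems(1) that by (intro Cons.prems(3)) auto
  then have eq: "S i \<inter> - S x = S i" if "i \<in> set xs" for i using that by blast
  have "ser_prod (map f (x # xs)) e = ser_mult (f x) (ser_prod (map f xs)) e"
    by (simp add: ser_prod_def)
  also have "\<dots> = f x (restrict_monom (S x) e) * ser_prod (map f xs) (restrict_monom (- S x) e)"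
  proof (rule ser_mult_disjoint)
    show "Poly_Mapping.keys d \<subseteq> S x" if "f x d \<noteq> 0" for d
      using Cons.prems(2)[OF _ that] by simp
    show "Poly_Mapping.keys d \<inter> S x = {}" if "ser_prod (map f xs) d \<noteq> 0" for d
      using that disj unfolding IH by (auto split: if_splits)
  qed
  also have "(\<Prod>i\<leftarrow>xs. f i (restrict_monom (S i) (restrict_monom (- S x) e))) =
      (\<Prod>i\<leftarrow>xs. f i (restrict_monom (S i) e))"
    by (intro arg_cong[where f = prod_list] map_cong refl) (simp add: eq)
  then have "ser_prod (map f xs) (restrict_monom (- S x) e) =
      (if Poly_Mapping.keys e - S x \<subseteq> (\<Union>i\<in>set xs. S i) then \<Prod>i\<leftarrow>xs. f i (restrict_monom (S i) e) else 0)"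
    unfolding IH by (simp add: Diff_eq)
  finally show ?case by (auto simp: Diff_subset_conv)
qed

section \<open>Coefficients of the fields and of the functions F\<close>

fun rising :: "nat \<Rightarrow> int \<Rightarrow> int" where
  "rising 0 p = 1"
| "rising (Suc m) p = (p + 1) * rising m (p + 1)"

lemma fls_deriv_power_nth:
  "fls_nth ((fls_deriv ^^ m) f) p = of_int (rising m p) * fls_nth f (p + int m)"
  by (induction m arbitrary: p) (simp_all add: mult.assoc algebra_simps)

text \<open>As \<open>rising m p\<close> is (p+1)...(p+m), this is the generalised binomial
  coefficient of p+m over m.\<close>

definition deriv_coeff :: "nat \<Rightarrow> int \<Rightarrow> complex" where
  "deriv_coeff m p = of_int (rising m p) / fact m"

lemma field_monom_eq:
  "field_monom m v n e = (if Poly_Mapping.keys e \<subseteq> {v} \<and> n = -1 - Poly_Mapping.lookup e v - int m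
    then deriv_coeff m (Poly_Mapping.lookup e v) else 0)"
  by (auto simp: field_monom_def ser1_def fls_deriv_power_nth deriv_coeff_def)

text \<open>At the exponent \<open>e\<close> a field contributes a single mode,
  \<open>field_mode\<close>, with the scalar \<open>field_coeff\<close>; the shift by
  \<open>m\<close> in the mode number comes from the derivative.\<close>

definition field_coeff :: "monom \<Rightarrow> 'h bf \<times> nat \<times> var \<Rightarrow> complex" where
  "field_coeff e = (\<lambda>(b, m, v). deriv_coeff m (Poly_Mapping.lookup e v))"

definition field_mode :: "monom \<Rightarrow> 'h bf \<times> nat \<times> var \<Rightarrow> 'h bf \<times> int" where
  "field_mode e = (\<lambda>(b, m, v). (b, -1 - Poly_Mapping.lookup e v - int m))"

text \<open>With distinct variables the exponent determines the mode number of each field, so at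
  most one \<open>ns\<close> contributes; its coefficient may still vanish.\<close>

lemma nord_series_eq:
  fixes fs :: "('h::ab_group_add bf \<times> nat \<times> var) list"
  assumes "distinct (map (\<lambda>f. snd (snd f)) fs)"
  shows "nord_series fs e =
    (if Poly_Mapping.keys e \<subseteq> (\<lambda>f. snd (snd f)) ` set fs
     then (\<Prod>f\<leftarrow>fs. field_coeff e f) \<odot> nord (map (field_mode e) fs) else 0)"
proof -
  define c where "c ns = ser_prod (map2 (\<lambda>(a, m, v) n. field_monom m v n) fs ns) e" for ns
  let ?ns = "map (snd \<circ> field_mode e) fs"
  let ?vs = "(\<lambda>f. snd (snd f)) ` set fs"
  have c: "c ns = (if Poly_Mapping.keys e \<subseteq> ?vs then
      \<Prod>i\<leftarrow>[0..<length fs]. if ns ! i = ?ns ! i then field_coeff e (fs ! i) else 0 else 0)"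
    if len: "length ns = length fs" for ns
  proof -
    let ?m = "\<lambda>i. fst (snd (fs ! i))" and ?v = "\<lambda>i. snd (snd (fs ! i))"
    have vs: "(\<Union>i\<in>set [0..<length fs]. {?v i}) = ?vs"
    proof -
      have "set fs = (!) fs ` {0..<length fs}" by (auto simp: set_conv_nth)
      then show ?thesis by (simp add: image_image UNION_singleton_eq_range)
    qed
    have "map2 (\<lambda>(a, m, v) n. field_monom m v n) fs ns =
        map (\<lambda>i. field_monom (?m i) (?v i) (ns ! i)) [0..<length fs]"
      using len by (intro nth_equalityI) (auto simp: case_prod_unfold)
    then have "c ns = ser_prod (map (\<lambda>i. field_monom (?m i) (?v i) (ns ! i)) [0..<length fs]) e"
      by (simp add: c_def)
    also have "\<dots> = (if Poly_Mapping.keys e \<subseteq> (\<Union>i\<in>set [0..<length fs]. {?v i}) then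
        \<Prod>i\<leftarrow>[0..<length fs]. field_monom (?m i) (?v i) (ns ! i) (restrict_monom {?v i} e) else 0)"
    proof (rule ser_prod_disjoint)
      show "{?v i} \<inter> {?v j} = {}" if "i \<in> set [0..<length fs]" "j \<in> set [0..<length fs]" "i \<noteq> j" for i j
        using assms that nth_eq_iff_index_eq[of "map (\<lambda>f. snd (snd f)) fs" i j] by auto
    qed (auto simp: field_monom_eq split: if_splits)
    also have "(\<Prod>i\<leftarrow>[0..<length fs]. field_monom (?m i) (?v i) (ns ! i) (restrict_monom {?v i} e)) =
        (\<Prod>i\<leftarrow>[0..<length fs]. if ns ! i = ?ns ! i then field_coeff e (fs ! i) else 0)"
      by (intro arg_cong[where f = prod_list] map_cong refl)
        (auto simp: field_monom_eq field_coeff_def field_mode_def case_prod_unfold)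
    finally show ?thesis unfolding vs .
  qed
  have sub: "{ns. length ns = length fs \<and> c ns \<noteq> 0} \<subseteq> {?ns}"
  proof
    fix ns assume ns: "ns \<in> {ns. length ns = length fs \<and> c ns \<noteq> 0}"
    have "ns ! i = ?ns ! i" if "i < length fs" for i
      using ns c[of ns] that by (auto simp: prod_list_zero_iff split: if_splits)
    then show "ns \<in> {?ns}" using ns by (auto intro: nth_equalityI)
  qed
  have "nord_series fs e = (\<Sum>ns | length ns = length fs \<and> c ns \<noteq> 0. const (c ns) * nord (zip (map fst fs) ns))"
    by (simp add: nord_series_def c_def)
  also have "\<dots> = (\<Sum>ns\<in>{?ns}. const (c ns) * nord (zip (map fst fs) ns))"
    using sub by (intro sum.mono_neutral_left) auto
  also have "zip (map fst fs) ?ns = map (field_mode e) fs"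
    by (intro nth_equalityI) (auto simp: field_mode_def case_prod_unfold)
  then have "(\<Sum>ns\<in>{?ns}. const (c ns) * nord (zip (map fst fs) ns)) =
      c ?ns \<odot> nord (map (field_mode e) fs)"
    by (simp add: smult_alg_def)
  also have "c ?ns = (if Poly_Mapping.keys e \<subseteq> ?vs then \<Prod>f\<leftarrow>fs. field_coeff e f else 0)"
  proof -
    have "map (\<lambda>i. field_coeff e (fs ! i)) [0..<length fs] = map (field_coeff e) fs"
      by (intro nth_equalityI) auto
    then show ?thesis by (subst c) simp_all
  qed
  finally show ?thesis by simp
qed

text \<open>The coefficients of 1/(x-y), the sum of x^(-q-1) y^q, and of its square, the sum of
  (q+1) x^(-q-2) y^q, both over q \<ge> 0.\<close>

definition geometric_coeff :: "nat \<Rightarrow> int \<Rightarrow> int \<Rightarrow> complex" where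
  "geometric_coeff k p q = (if p + q + int k = 0 \<and> q \<ge> 0 then (if k = 1 then 1 else of_int q + 1) else 0)"

lemma fls_inverse_diff_nth:
  assumes "k = 1 \<or> k = 2"
  shows "fls_nth (fls_nth (1 / (fls_const fls_X - fls_X) ^ k) q) p = geometric_coeff k p q"
proof -
  define z :: "complex fls fls" where "z = fls_const fls_X - fls_X"
  \<comment> \<open>The two expansions are written down and verified by multiplication with x - y:
    \<open>z * g1 = 1\<close> and \<open>z * g2 = g1\<close>.\<close>
  define g1 where "g1 = fps_to_fls (Abs_fps (\<lambda>q. fls_X_intpow (- int q - 1) :: complex fls))"
  define g2 where "g2 = fps_to_fls (Abs_fps (\<lambda>q. of_nat (q + 1) * fls_X_intpow (- int q - 2) :: complex fls))"
  have X: "fls_X * fls_shift i 1 = (fls_shift (i - 1) 1 :: complex fls)" for i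
    by (simp add: fls_X_times_conv_shift)
  have z: "fls_nth (z * g) n = fls_X * fls_nth g n - fls_nth g (n - 1)" for g n
    by (simp add: z_def left_diff_distrib fls_X_times_conv_shift)
  have 1: "z * g1 = 1"
  proof (rule fls_eqI)
    fix n :: int
    consider "n < 0" | "n = 0" | "n > 0" by linarith
    then show "fls_nth (z * g1) n = fls_nth 1 n"
      by cases (simp_all add: z g1_def X nat_diff_distrib')
  qed
  have 2: "z * g2 = g1"
  proof (rule fls_eqI)
    fix n :: int
    consider "n < 0" | "n = 0" | "n > 0" by linarith
    then show "fls_nth (z * g2) n = fls_nth g1 n"
      by cases (simp_all add: z g1_def g2_def X mult.left_commute[of fls_X] algebra_simps)
  qed
  from 1 have z0: "z \<noteq> 0" by auto
  have "1 / z = g1" using 1 z0 by (simp add: divide_eq_eq mult.commute)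
  moreover have "1 / z ^ 2 = g2"
  proof -
    have "z ^ 2 * g2 = 1" using 1 2 by (simp add: power2_eq_square mult.assoc)
    then show ?thesis using z0 by (simp add: divide_eq_eq mult.commute)
  qed
  moreover have "fls_nth (fls_nth g1 q) p = geometric_coeff 1 p q"
    by (auto simp: g1_def geometric_coeff_def)
  moreover have "fls_nth (fls_nth g2 q) p = geometric_coeff 2 p q"
    by (auto simp: g2_def geometric_coeff_def fls_of_nat)
  ultimately show ?thesis using assms by (auto simp: z_def)
qed

lemma F_coeff_eq:
  assumes "k = 1 \<or> k = 2"
  shows "F_coeff k m n p q = deriv_coeff (m - 1) p * deriv_coeff (n - 1) q
    * geometric_coeff k (p + int (m - 1)) (q + int (n - 1))"
  unfolding F_coeff_def fls_deriv_power_nth fls_of_int fls_mult_const_nth fls_inverse_diff_nth[OF assms]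
  by (simp add: deriv_coeff_def)

context fock
begin

text \<open>For p + q = -2 the first mode number is q + 1, the factor in the bosonic relation. Its
  positivity means q \<ge> 0: this is where the expansion in nonnegative powers of y
  originates.\<close>

lemma ctr_bos: "ctr (Bos u, -1 - p) (Bos v, -1 - q) = lB * geometric_coeff 2 p q * form u v"
proof (cases "p = -2 - q")
  case True
  then show ?thesis unfolding True by (simp add: ctr_def geometric_coeff_def mode_sgn_1_iff)
qed (auto simp: ctr_def geometric_coeff_def)

text \<open>For p + q = -1 the first mode number is q, and a fermion counts as positive from 0
  on.\<close>

lemma ctr_fer: "ctr (Fer u, -1 - p) (Fer v, -1 - q) = lF * geometric_coeff 1 p q * form u v"
proof (cases "p = -1 - q")
  case True
  then show ?thesis unfolding True by (simp add: ctr_def geometric_coeff_def mode_sgn_1_iff)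
qed (auto simp: ctr_def geometric_coeff_def)

text \<open>The derivatives in F produce the same scalars and index shifts as those of the two
  fields, which leaves the contraction of two modes.\<close>

lemma bos_contraction:
  assumes "is_bos a" "is_bos b"
  shows "lB * bf_form form a b * F_coeff 2 m n (Poly_Mapping.lookup e x) (Poly_Mapping.lookup e y) =
    field_coeff e (a, m - 1, x) * field_coeff e (b, n - 1, y)
    * ctr (field_mode e (a, m - 1, x)) (field_mode e (b, n - 1, y))"
  using assms
  by (cases a; cases b)
    (simp_all add: F_coeff_eq field_coeff_def field_mode_def diff_diff_eq ctr_bos)

lemma fer_contraction:
  assumes "is_fer a" "is_fer b"
  shows "lF * bf_form form a b * F_coeff 1 m n (Poly_Mapping.lookup e x) (Poly_Mapping.lookup e y) =
    field_coeff e (a, m - 1, x) * field_coeff e (b, n - 1, y)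
    * ctr (field_mode e (a, m - 1, x)) (field_mode e (b, n - 1, y))"
  using assms
  by (cases a; cases b)
    (simp_all add: F_coeff_eq field_coeff_def field_mode_def diff_diff_eq ctr_fer)

end

section \<open>Coefficients of both sides\<close>

definition pair_weight :: "(nat \<Rightarrow> nat \<Rightarrow> int \<Rightarrow> int \<Rightarrow> complex) \<Rightarrow> monom \<Rightarrow> nat list \<Rightarrow> nat list \<Rightarrow> complex"
where
  "pair_weight w e I J =
    prod_list (map2 (\<lambda>i j. w i j (Poly_Mapping.lookup e (X i)) (Poly_Mapping.lookup e (Y j))) I J)"

lemma pair_weight_restrict:
  assumes "X ` set I \<union> Y ` set J \<subseteq> S"
  shows "pair_weight w (restrict_monom S e) I J = pair_weight w e I J"
proof -
  have "X i \<in> S \<and> Y j \<in> S" if "(i, j) \<in> set (zip I J)" for i j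
    using set_zip_leftD[OF that] set_zip_rightD[OF that] assms by auto
  then show ?thesis
    unfolding pair_weight_def by (intro arg_cong[where f = prod_list] map_cong refl) auto
qed

lemma ser_prod_pairs:
  assumes "distinct I" "distinct J" "length I = k" "length J = k"
  shows "ser_prod (map (\<lambda>\<alpha>. ser2 (X (I ! \<alpha>)) (Y (J ! \<alpha>)) (w (I ! \<alpha>) (J ! \<alpha>))) [0..<k]) e =
    (if Poly_Mapping.keys e \<subseteq> X ` set I \<union> Y ` set J then pair_weight w e I J else 0)"
proof -
  let ?S = "\<lambda>\<alpha>. {X (I ! \<alpha>), Y (J ! \<alpha>)}"
  have "ser_prod (map (\<lambda>\<alpha>. ser2 (X (I ! \<alpha>)) (Y (J ! \<alpha>)) (w (I ! \<alpha>) (J ! \<alpha>))) [0..<k]) e =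
      (if Poly_Mapping.keys e \<subseteq> (\<Union>\<alpha>\<in>set [0..<k]. ?S \<alpha>) then
        \<Prod>\<alpha>\<leftarrow>[0..<k]. ser2 (X (I ! \<alpha>)) (Y (J ! \<alpha>)) (w (I ! \<alpha>) (J ! \<alpha>)) (restrict_monom (?S \<alpha>) e) else 0)"
  proof (rule ser_prod_disjoint)
    show "?S \<alpha> \<inter> ?S \<beta> = {}" if "\<alpha> \<in> set [0..<k]" "\<beta> \<in> set [0..<k]" "\<alpha> \<noteq> \<beta>" for \<alpha> \<beta>
      using assms that by (auto simp: nth_eq_iff_index_eq)
  qed (auto simp: ser2_def split: if_splits)
  also have "(\<Union>\<alpha>\<in>set [0..<k]. ?S \<alpha>) = X ` set I \<union> Y ` set J"
    using assms(3,4) by (auto simp: set_conv_nth)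
  also have "map (\<lambda>\<alpha>. ser2 (X (I ! \<alpha>)) (Y (J ! \<alpha>)) (w (I ! \<alpha>) (J ! \<alpha>)) (restrict_monom (?S \<alpha>) e)) [0..<k] =
      map2 (\<lambda>i j. w i j (Poly_Mapping.lookup e (X i)) (Poly_Mapping.lookup e (Y j))) I J"
    using assms(3,4) by (intro nth_equalityI) (auto simp: ser2_def)
  finally show ?thesis by (simp add: pair_weight_def)
qed

lemma ser_prod_pairs_permuted:
  assumes "distinct I" "distinct J" "length I = k" "length J = k" "\<sigma> permutes {..<k}"
  shows "ser_prod (map (\<lambda>\<alpha>. ser2 (X (I ! \<alpha>)) (Y (J ! \<sigma> \<alpha>)) (w (I ! \<alpha>) (J ! \<sigma> \<alpha>))) [0..<k]) e =
    (if Poly_Mapping.keys e \<subseteq> X ` set I \<union> Y ` set J then pair_weight w e I (permute_list \<sigma> J) else 0)"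
proof -
  have "map (\<lambda>\<alpha>. ser2 (X (I ! \<alpha>)) (Y (J ! \<sigma> \<alpha>)) (w (I ! \<alpha>) (J ! \<sigma> \<alpha>))) [0..<k] =
      map (\<lambda>\<alpha>. ser2 (X (I ! \<alpha>)) (Y (permute_list \<sigma> J ! \<alpha>)) (w (I ! \<alpha>) (permute_list \<sigma> J ! \<alpha>))) [0..<k]"
    using assms by (simp add: permute_list_nth)
  then show ?thesis using ser_prod_pairs[of I "permute_list \<sigma> J" k w e] assms by (simp only:) simp
qed

lemma ser_perm_pairs:
  assumes "distinct I" "distinct J" "length I = k" "length J = k"
  shows "ser_perm k (\<lambda>\<alpha> \<beta>. ser2 (X (I ! \<alpha>)) (Y (J ! \<beta>)) (w (I ! \<alpha>) (J ! \<beta>))) e =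
    (if Poly_Mapping.keys e \<subseteq> X ` set I \<union> Y ` set J
     then \<Sum>\<sigma> | \<sigma> permutes {..<k}. pair_weight w e I (permute_list \<sigma> J) else 0)"
  using ser_prod_pairs_permuted[OF assms] by (simp add: ser_perm_def)

lemma ser_det_pairs:
  assumes "distinct I" "sorted_wrt (<) J" "length I = k" "length J = k"
  shows "ser_det k (\<lambda>\<alpha> \<beta>. ser2 (X (I ! \<alpha>)) (Y (J ! \<beta>)) (w (I ! \<alpha>) (J ! \<beta>))) e =
    (if Poly_Mapping.keys e \<subseteq> X ` set I \<union> Y ` set J
     then \<Sum>\<sigma> | \<sigma> permutes {..<k}.
       (-1) ^ inversions (permute_list \<sigma> J) * pair_weight w e I (permute_list \<sigma> J) else 0)"
proof -
  have J: "distinct J" by (rule sorted_wrt_less_distinct[OF assms(2)])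
  have "of_int (sign \<sigma>) * ser_prod (map (\<lambda>\<alpha>. ser2 (X (I ! \<alpha>)) (Y (J ! \<sigma> \<alpha>)) (w (I ! \<alpha>) (J ! \<sigma> \<alpha>))) [0..<k]) e =
      (if Poly_Mapping.keys e \<subseteq> X ` set I \<union> Y ` set J
       then (-1) ^ inversions (permute_list \<sigma> J) * pair_weight w e I (permute_list \<sigma> J) else 0)"
    if \<sigma>: "\<sigma> permutes {..<k}" for \<sigma>
  proof -
    have "sign \<sigma> = (-1) ^ inversions (permute_list \<sigma> J)"
      using sign_eq_inversions[of \<sigma> J] \<sigma> assms by simp
    then show ?thesis unfolding ser_prod_pairs_permuted[OF assms(1) J assms(3,4) \<sigma>] by simp
  qed
  then show ?thesis by (simp add: ser_det_def)
qed

text \<open>A pairing is no longer than either set has elements, so a bound on one of them is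
  enough; \<open>min r s\<close> is \<open>r\<close> or \<open>s\<close>.\<close>

lemma sum_pairings_by_length:
  assumes S: "finite S" and T: "finite T" and N: "card S \<le> N \<or> card T \<le> N"
  shows "(\<Sum>k = 0..N. \<Sum>I\<in>incr_tuples S k. \<Sum>J | length J = k \<and> distinct J \<and> set J \<subseteq> T. f I J) =
    (\<Sum>(I, J)\<in>pairings S T. f I J)"
proof -
  have fin: "finite (pairings S T)" using S T by (simp add: finite_pairings)
  have le: "length I \<le> N" if "(I, J) \<in> pairings S T" for I J
  proof -
    have IJ: "set I \<subseteq> S" "set J \<subseteq> T" "distinct I" "distinct J" "length J = length I"
      using that by (auto simp: pairings_def sorted_wrt_less_distinct)
    have "length I \<le> card S" "length J \<le> card T"
      using card_mono[OF S IJ(1)] card_mono[OF T IJ(2)] IJ(3,4) by (simp_all add: distinct_card)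
    then show ?thesis using IJ(5) N by linarith
  qed
  have "(\<Sum>I\<in>incr_tuples S k. \<Sum>J | length J = k \<and> distinct J \<and> set J \<subseteq> T. f I J) =
      (\<Sum>(I, J)\<in>{p \<in> pairings S T. length (fst p) = k}. f I J)" for k
  proof -
    have "incr_tuples S k \<times> {J. length J = k \<and> distinct J \<and> set J \<subseteq> T} =
        {p \<in> pairings S T. length (fst p) = k}"
      by (auto simp: incr_tuples_def pairings_def)
    then show ?thesis by (simp add: sum.cartesian_product)
  qed
  then have "(\<Sum>k = 0..N. \<Sum>I\<in>incr_tuples S k. \<Sum>J | length J = k \<and> distinct J \<and> set J \<subseteq> T. f I J) =
      (\<Sum>k = 0..N. \<Sum>(I, J)\<in>{p \<in> pairings S T. length (fst p) = k}. f I J)" by simp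
  also have "\<dots> = (\<Sum>(I, J)\<in>pairings S T. f I J)"
    using le by (intro sum.group fin) auto
  finally show ?thesis .
qed

lemma fields_eq: "fields r a m v S = map (\<lambda>i. (a i, m i - 1, v i)) (filter (\<lambda>i. i \<notin> S) [1..<Suc r])"
proof -
  have "concat (map (\<lambda>i. if P i then [g i] else []) xs) = map g (filter P xs)"
    for P and g :: "nat \<Rightarrow> 'a bf \<times> nat \<times> var" and xs
    by (induction xs) auto
  then show ?thesis by (simp add: fields_def)
qed

text \<open>Contracted and remaining fields together supply every scalar once, so the total scalar
  is the same for all pairings.\<close>

lemma prod_list_filter_upt:
  fixes c :: "nat \<Rightarrow> complex"
  assumes "distinct I" "distinct I'" "set I \<inter> set I' = {}" "set I \<union> set I' \<subseteq> {1..r}"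
  shows "(\<Prod>i\<leftarrow>I. c i) * (\<Prod>i\<leftarrow>I'. c i) * (\<Prod>i\<leftarrow>filter (\<lambda>i. i \<notin> set I \<union> set I') [1..<Suc r]. c i) =
    (\<Prod>i\<leftarrow>[1..<Suc r]. c i)"
proof -
  let ?R = "filter (\<lambda>i. i \<notin> set I \<union> set I') [1..<Suc r]"
  have "(\<Prod>i\<leftarrow>I @ I' @ ?R. c i) = (\<Prod>i\<in>set (I @ I' @ ?R). c i)"
    using assms by (intro prod.distinct_set_conv_list[symmetric]) auto
  also have "set (I @ I' @ ?R) = set [1..<Suc r]" using assms(4) by auto
  also have "(\<Prod>i\<in>set [1..<Suc r]. c i) = (\<Prod>i\<leftarrow>[1..<Suc r]. c i)"
    by (intro prod.distinct_set_conv_list) simp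
  finally show ?thesis by (simp add: mult.assoc)
qed

lemma fer_count_below: "fer_count r a i + fer_below r A i = card (fer_idx r a)"
  if "\<And>k. fst (A k) = a k"
proof -
  have "fer_below r A i = card {k \<in> fer_idx r a. i < k}"
    unfolding fer_below_def that by (subst distinct_length_filter) (auto intro!: arg_cong[where f = card] simp: fer_idx_def)
  moreover have "fer_idx r a = {k \<in> fer_idx r a. k \<le> i} \<union> {k \<in> fer_idx r a. i < k}" by auto
  moreover have "card ({k \<in> fer_idx r a. k \<le> i} \<union> {k \<in> fer_idx r a. i < k}) =
      card {k \<in> fer_idx r a. k \<le> i} + card {k \<in> fer_idx r a. i < k}"
    by (intro card_Un_disjoint) (auto simp: fer_idx_def)
  ultimately show ?thesis by (simp add: fer_count_def)
qed

lemma fer_upto_eq_count: "fer_upto B [1..<Suc s] j = fer_count s b j" if "\<And>k. fst (B k) = b k"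
  unfolding fer_upto_def fer_count_def that
  by (subst distinct_length_filter) (auto intro!: arg_cong[where f = card] simp: fer_idx_def)

section \<open>Both sides at one fixed exponent\<close>

text \<open>The exponent \<open>e\<close> is a parameter because at a given exponent each field is a
  scalar times one mode, depending only on its index.\<close>

locale fock_fields = fock sc form lB lF
  for sc :: "complex \<Rightarrow> 'h::ab_group_add \<Rightarrow> 'h" and form lB lF +
  fixes r s :: nat and a b :: "nat \<Rightarrow> 'h bf" and m n :: "nat \<Rightarrow> nat" and e :: monom
begin

definition modeA where "modeA i = field_mode e (a i, m i - 1, X i)"
definition modeB where "modeB j = field_mode e (b j, n j - 1, Y j)"
definition coeffA where "coeffA i = field_coeff e (a i, m i - 1, X i)"
definition coeffB where "coeffB j = field_coeff e (b j, n j - 1, Y j)"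
definition coeff_all where
  "coeff_all = (\<Prod>i\<leftarrow>[1..<Suc r]. coeffA i) * (\<Prod>j\<leftarrow>[1..<Suc s]. coeffB j)"
definition in_range where "in_range \<longleftrightarrow> Poly_Mapping.keys e \<subseteq> X ` {1..r} \<union> Y ` {1..s}"

definition weightB where "weightB i j p q = lB * bf_form form (a i) (b j) * F_coeff 2 (m i) (n j) p q"
definition weightF where "weightF i j p q = lF * bf_form form (a i) (b j) * F_coeff 1 (m i) (n j) p q"

lemma fst_mode [simp]: "fst (modeA i) = a i" "fst (modeB j) = b j"
  by (simp_all add: modeA_def modeB_def field_mode_def)

lemma field_coeff_restrict: "v \<in> S \<Longrightarrow> field_coeff (restrict_monom S e) (c, k, v) = field_coeff e (c, k, v)"
  and field_mode_restrict: "v \<in> S \<Longrightarrow> field_mode (restrict_monom S e) (c, k, v) = field_mode e (c, k, v)"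
  by (simp_all add: field_coeff_def field_mode_def)

lemma nord_series_fields:
  assumes "X ` ({1..r} - P) \<union> Y ` ({1..s} - Q) \<subseteq> S"
  shows "nord_series (fields r a m X P @ fields s b n Y Q) (restrict_monom S e) =
    (if Poly_Mapping.keys e \<inter> S \<subseteq> X ` ({1..r} - P) \<union> Y ` ({1..s} - Q) then
      ((\<Prod>i\<leftarrow>filter (\<lambda>i. i \<notin> P) [1..<Suc r]. coeffA i) * (\<Prod>j\<leftarrow>filter (\<lambda>j. j \<notin> Q) [1..<Suc s]. coeffB j)) \<odot>
      nord (map modeA (filter (\<lambda>i. i \<notin> P) [1..<Suc r]) @ map modeB (filter (\<lambda>j. j \<notin> Q) [1..<Suc s])) else 0)"
proof -
  let ?I = "filter (\<lambda>i. i \<notin> P) [1..<Suc r]" and ?J = "filter (\<lambda>j. j \<notin> Q) [1..<Suc s]"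
  let ?fs = "fields r a m X P @ fields s b n Y Q" and ?e = "restrict_monom S e"
  have fs: "?fs = map (\<lambda>i. (a i, m i - 1, X i)) ?I @ map (\<lambda>j. (b j, n j - 1, Y j)) ?J"
    by (simp only: fields_eq)
  have dist: "distinct (map (\<lambda>f. snd (snd f)) ?fs)"
    unfolding fs by (auto simp: distinct_map inj_on_def comp_def)
  have subX: "X i \<in> S" if "i \<in> set ?I" for i using assms that by auto
  have subY: "Y j \<in> S" if "j \<in> set ?J" for j using assms that by auto
  have vars: "(\<lambda>f. snd (snd f)) ` set ?fs = X ` ({1..r} - P) \<union> Y ` ({1..s} - Q)"
    unfolding fs by (auto simp: image_image image_Un)
  have "map (field_coeff ?e) ?fs = map coeffA ?I @ map coeffB ?J"
    unfolding fs using subX subY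
    by (auto simp: comp_def coeffA_def coeffB_def field_coeff_restrict)
  moreover have "map (field_mode ?e) ?fs = map modeA ?I @ map modeB ?J"
    unfolding fs using subX subY
    by (auto simp: comp_def modeA_def modeB_def field_mode_restrict)
  ultimately show ?thesis
    unfolding nord_series_eq[OF dist] vars by simp
qed

lemma nord_series_fields_support:
  assumes "nord_series (fields r a m X P @ fields s b n Y Q) d \<noteq> 0"
  shows "Poly_Mapping.keys d \<subseteq> X ` ({1..r} - P) \<union> Y ` ({1..s} - Q)"
proof -
  let ?fs = "fields r a m X P @ fields s b n Y Q"
  have "distinct (map (\<lambda>f. snd (snd f)) ?fs)"
    by (auto simp: fields_eq distinct_map inj_on_def comp_def)
  from nord_series_eq[OF this, of d] assms
  have "Poly_Mapping.keys d \<subseteq> (\<lambda>f. snd (snd f)) ` set ?fs" by (auto split: if_splits)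
  also have "\<dots> = X ` ({1..r} - P) \<union> Y ` ({1..s} - Q)"
    by (auto simp: fields_eq image_image image_Un)
  finally show ?thesis .
qed

lemma product_coeff:
  "ser_mult (nord_series (fields r a m X {})) (nord_series (fields s b n Y {})) e =
    (if in_range then coeff_all \<odot> (nord (map modeA [1..<Suc r]) * nord (map modeB [1..<Suc s])) else 0)"
proof -
  \<comment> \<open>Omitting all fields of one family makes the lemmas on joint lists applicable to
    each factor alone.\<close>
  have fX: "fields r a m X {} @ fields s b n Y {1..s} = fields r a m X {}"
    and fY: "fields r a m X {1..r} @ fields s b n Y {} = fields s b n Y {}"
    by (auto simp: fields_eq filter_empty_conv)
  have nil: "filter (\<lambda>j. j \<notin> {1..k}) [1..<Suc k] = []" for k
    by (auto simp: filter_empty_conv)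
  have sX: "X ` ({1..r} - {}) \<union> Y ` ({1..s} - {1..s}) \<subseteq> range X"
    and sY: "X ` ({1..r} - {1..r}) \<union> Y ` ({1..s} - {}) \<subseteq> - range X" by auto
  have "ser_mult (nord_series (fields r a m X {})) (nord_series (fields s b n Y {})) e =
      nord_series (fields r a m X {}) (restrict_monom (range X) e)
      * nord_series (fields s b n Y {}) (restrict_monom (- range X) e)"
  proof (rule ser_mult_disjoint)
    show "Poly_Mapping.keys d \<subseteq> range X" if "nord_series (fields r a m X {}) d \<noteq> 0" for d
      using nord_series_fields_support[of "{}" "{1..s}" d, unfolded fX, OF that] by auto
    show "Poly_Mapping.keys d \<inter> range X = {}" if "nord_series (fields s b n Y {}) d \<noteq> 0" for d
      using nord_series_fields_support[of "{1..r}" "{}" d, unfolded fY, OF that] by auto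
  qed
  also have "nord_series (fields r a m X {}) (restrict_monom (range X) e) =
      (if Poly_Mapping.keys e \<inter> range X \<subseteq> X ` {1..r}
       then (\<Prod>i\<leftarrow>[1..<Suc r]. coeffA i) \<odot> nord (map modeA [1..<Suc r]) else 0)"
    using nord_series_fields[of "{}" "{1..s}" "range X", OF sX, unfolded fX nil]
    by (simp del: upt_Suc)
  also have "nord_series (fields s b n Y {}) (restrict_monom (- range X) e) =
      (if Poly_Mapping.keys e \<inter> - range X \<subseteq> Y ` {1..s}
       then (\<Prod>j\<leftarrow>[1..<Suc s]. coeffB j) \<odot> nord (map modeB [1..<Suc s]) else 0)"
    using nord_series_fields[of "{1..r}" "{}" "- range X", OF sY, unfolded fY nil]
    by (simp del: upt_Suc)
  also have "in_range \<longleftrightarrow> Poly_Mapping.keys e \<inter> range X \<subseteq> X ` {1..r} \<and>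
      Poly_Mapping.keys e \<inter> - range X \<subseteq> Y ` {1..s}"
  proof -
    have "X ` {1..r} \<subseteq> range X" "Y ` {1..s} \<subseteq> - range X" by auto
    then show ?thesis unfolding in_range_def by blast
  qed
  then have "(if Poly_Mapping.keys e \<inter> range X \<subseteq> X ` {1..r}
       then (\<Prod>i\<leftarrow>[1..<Suc r]. coeffA i) \<odot> nord (map modeA [1..<Suc r]) else 0)
      * (if Poly_Mapping.keys e \<inter> - range X \<subseteq> Y ` {1..s}
       then (\<Prod>j\<leftarrow>[1..<Suc s]. coeffB j) \<odot> nord (map modeB [1..<Suc s]) else 0) =
      (if in_range then coeff_all \<odot> (nord (map modeA [1..<Suc r]) * nord (map modeB [1..<Suc s])) else 0)"
    by (simp add: coeff_all_def mult.commute del: upt_Suc)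
  finally show ?thesis .
qed

text \<open>The support condition is \<open>in_range\<close> for all \<open>P\<close> and
  \<open>Q\<close>: the variables of the omitted fields are cut off from the exponent, being used by
  the permanent and the determinant.\<close>

definition rest_nord :: "nat set \<Rightarrow> nat set \<Rightarrow> 'h hhat free_alg" where
  "rest_nord P Q =
    (if in_range then
      ((\<Prod>i\<leftarrow>filter (\<lambda>i. i \<notin> P) [1..<Suc r]. coeffA i) * (\<Prod>j\<leftarrow>filter (\<lambda>j. j \<notin> Q) [1..<Suc s]. coeffB j)) \<odot>
      nord (map modeA (filter (\<lambda>i. i \<notin> P) [1..<Suc r]) @ map modeB (filter (\<lambda>j. j \<notin> Q) [1..<Suc s])) else 0)"

lemma nord_series_rest:
  assumes "P \<subseteq> {1..r}" "Q \<subseteq> {1..s}"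
  shows "nord_series (fields r a m X P @ fields s b n Y Q) (restrict_monom (- (X ` P \<union> Y ` Q)) e) = rest_nord P Q"
proof -
  have "Poly_Mapping.keys e \<inter> - (X ` P \<union> Y ` Q) \<subseteq> X ` ({1..r} - P) \<union> Y ` ({1..s} - Q) \<longleftrightarrow> in_range"
  proof -
    have eq: "X ` ({1..r} - P) \<union> Y ` ({1..s} - Q) = X ` {1..r} \<union> Y ` {1..s} - (X ` P \<union> Y ` Q)" by auto
    have "X ` P \<union> Y ` Q \<subseteq> X ` {1..r} \<union> Y ` {1..s}"
      using assms by (intro Un_mono image_mono)
    then show ?thesis unfolding eq in_range_def by blast
  qed
  moreover have "X ` ({1..r} - P) \<union> Y ` ({1..s} - Q) \<subseteq> - (X ` P \<union> Y ` Q)" by auto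
  ultimately show ?thesis by (simp only: nord_series_fields rest_nord_def)
qed

definition full_sign :: "nat list \<Rightarrow> nat list \<Rightarrow> nat" where
  "full_sign I J = (\<Sum>i\<leftarrow>I. fer_count r a i) + (\<Sum>j\<leftarrow>J. fer_count s b j)
    + (card (fer_idx r a) * length I + length I * (length I + 1) div 2)"

definition full_term :: "nat list \<Rightarrow> nat list \<Rightarrow> nat list \<Rightarrow> nat list \<Rightarrow> 'h hhat free_alg" where
  "full_term I J I' J' =
    (pair_weight weightB e I J * ((-1) ^ (full_sign I' J' + inversions J') * pair_weight weightF e I' J')) \<odot>
    rest_nord (set I \<union> set I') (set J \<union> set J')"

abbreviation "perm_series \<eta> I J \<equiv> ser_perm \<eta> (\<lambda>\<alpha> \<beta> d. lB * bf_form form (a (I ! \<alpha>)) (b (J ! \<beta>))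
  * FB (m (I ! \<alpha>)) (n (J ! \<beta>)) (X (I ! \<alpha>)) (Y (J ! \<beta>)) d)"

abbreviation "det_series \<rho> I J \<equiv> ser_det \<rho> (\<lambda>\<gamma> \<delta> d. lF * bf_form form (a (I ! \<gamma>)) (b (J ! \<delta>))
  * FF (m (I ! \<gamma>)) (n (J ! \<delta>)) (X (I ! \<gamma>)) (Y (J ! \<delta>)) d)"

lemma perm_series_eq:
  assumes "I \<in> incr_tuples S k" "J \<in> incr_tuples T k"
  shows "perm_series k I J d = (if Poly_Mapping.keys d \<subseteq> X ` set I \<union> Y ` set J
     then \<Sum>\<sigma> | \<sigma> permutes {..<k}. pair_weight weightB d I (permute_list \<sigma> J) else 0)"
proof -
  have "(\<lambda>\<alpha> \<beta> d. lB * bf_form form (a (I ! \<alpha>)) (b (J ! \<beta>))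
      * FB (m (I ! \<alpha>)) (n (J ! \<beta>)) (X (I ! \<alpha>)) (Y (J ! \<beta>)) d) =
      (\<lambda>\<alpha> \<beta>. ser2 (X (I ! \<alpha>)) (Y (J ! \<beta>)) (weightB (I ! \<alpha>) (J ! \<beta>)))"
    by (intro ext) (simp add: FB_def ser2_def weightB_def)
  then show ?thesis
    using assms ser_perm_pairs[of I J k weightB d] by (simp add: incr_tuples_def sorted_wrt_less_distinct)
qed

lemma det_series_eq:
  assumes "I \<in> incr_tuples S k" "J \<in> incr_tuples T k"
  shows "det_series k I J d = (if Poly_Mapping.keys d \<subseteq> X ` set I \<union> Y ` set J
     then \<Sum>\<sigma> | \<sigma> permutes {..<k}.
       (-1) ^ inversions (permute_list \<sigma> J) * pair_weight weightF d I (permute_list \<sigma> J) else 0)"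
proof -
  have "(\<lambda>\<gamma> \<delta> d. lF * bf_form form (a (I ! \<gamma>)) (b (J ! \<delta>))
      * FF (m (I ! \<gamma>)) (n (J ! \<delta>)) (X (I ! \<gamma>)) (Y (J ! \<delta>)) d) =
      (\<lambda>\<alpha> \<beta>. ser2 (X (I ! \<alpha>)) (Y (J ! \<beta>)) (weightF (I ! \<alpha>) (J ! \<beta>)))"
    by (intro ext) (simp add: FF_def ser2_def weightF_def)
  then show ?thesis
    using assms ser_det_pairs[of I J k weightF d] by (simp add: incr_tuples_def sorted_wrt_less_distinct)
qed

end

section \<open>The right side as a sum over pairings\<close>

lemma smult_alg_sum_left: "(\<Sum>i\<in>A. c i) \<odot> f = (\<Sum>i\<in>A. c i \<odot> f)"
  by (induction A rule: infinite_finite_induct) (simp_all add: smult_alg_add)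

lemma sum_list_permute_list:
  fixes f :: "nat \<Rightarrow> nat"
  assumes "\<sigma> permutes {..<length J}"
  shows "(\<Sum>j\<leftarrow>permute_list \<sigma> J. f j) = (\<Sum>j\<leftarrow>J. f j)"
proof -
  have "(\<Sum>j\<leftarrow>permute_list \<sigma> J. f j) = \<Sum>\<^sub># (image_mset f (mset (permute_list \<sigma> J)))"
    by (simp only: sum_mset_sum_list flip: mset_map)
  also have "\<dots> = (\<Sum>j\<leftarrow>J. f j)"
    unfolding mset_permute_list[OF assms] by (simp only: sum_mset_sum_list flip: mset_map)
  finally show ?thesis .
qed

lemma bos_fer_idx_disjoint: "bos_idx r a \<inter> fer_idx r a = {}"
  by (auto simp: bos_idx_def fer_idx_def is_fer_iff)

context fock_fields
begin

lemma ser_mult_det: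
  assumes I: "I \<in> incr_tuples (fer_idx r a) \<rho>" and J: "J \<in> incr_tuples (fer_idx s b) \<rho>"
    and P: "set I \<subseteq> P" and Q: "set J \<subseteq> Q"
  shows "ser_mult (ser_const (det_series \<rho> I J)) (nord_series (fields r a m X P @ fields s b n Y Q)) d =
    det_series \<rho> I J (restrict_monom (X ` set I \<union> Y ` set J) d) \<odot>
    nord_series (fields r a m X P @ fields s b n Y Q) (restrict_monom (- (X ` set I \<union> Y ` set J)) d)"
proof -
  have "ser_mult (ser_const (det_series \<rho> I J)) (nord_series (fields r a m X P @ fields s b n Y Q)) d =
    ser_const (det_series \<rho> I J) (restrict_monom (X ` set I \<union> Y ` set J) d) *
    nord_series (fields r a m X P @ fields s b n Y Q) (restrict_monom (- (X ` set I \<union> Y ` set J)) d)"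
  proof (rule ser_mult_disjoint)
    show "Poly_Mapping.keys d \<subseteq> X ` set I \<union> Y ` set J" if "ser_const (det_series \<rho> I J) d \<noteq> 0" for d
      using that by (simp add: ser_const_def det_series_eq[OF I J] split: if_splits)
    show "Poly_Mapping.keys d \<inter> (X ` set I \<union> Y ` set J) = {}"
      if "nord_series (fields r a m X P @ fields s b n Y Q) d \<noteq> 0" for d
      using nord_series_fields_support[OF that] P Q by fastforce
  qed
  then show ?thesis by (simp add: ser_const_def smult_alg_def)
qed

lemma det_term:
  assumes I: "I \<in> incr_tuples (bos_idx r a) \<eta>" and J: "J \<in> incr_tuples (bos_idx s b) \<eta>"
    and I': "I' \<in> incr_tuples (fer_idx r a) \<rho>" and J': "J' \<in> incr_tuples (fer_idx s b) \<rho>"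
  shows "ser_mult (ser_const (det_series \<rho> I' J'))
      (nord_series (fields r a m X (set I \<union> set I') @ fields s b n Y (set J \<union> set J')))
      (restrict_monom (- (X ` set I \<union> Y ` set J)) e) =
    (\<Sum>\<sigma> | \<sigma> permutes {..<\<rho>}.
      ((-1) ^ inversions (permute_list \<sigma> J') * pair_weight weightF e I' (permute_list \<sigma> J')) \<odot>
      rest_nord (set I \<union> set I') (set J \<union> set J'))"
proof -
  let ?Sb = "X ` set I \<union> Y ` set J" and ?Sf = "X ` set I' \<union> Y ` set J'"
  have sets: "set I \<subseteq> bos_idx r a" "set J \<subseteq> bos_idx s b" "set I' \<subseteq> fer_idx r a" "set J' \<subseteq> fer_idx s b"
    "length J' = \<rho>"
    using assms by (auto simp: incr_tuples_def)
  have "set I \<inter> set I' = {}" "set J \<inter> set J' = {}"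
    using sets bos_fer_idx_disjoint[of r a] bos_fer_idx_disjoint[of s b] by blast+
  \<comment> \<open>No variable is used both by a bosonic and by a fermionic pair, so cutting off
    the bosonic ones leaves the exponent of the determinant intact.\<close>
  then have S1: "?Sf \<inter> - ?Sb = ?Sf" by auto
  have S2: "- ?Sf \<inter> - ?Sb = - (X ` (set I \<union> set I') \<union> Y ` (set J \<union> set J'))" by auto
  have "set I \<union> set I' \<subseteq> {1..r}" "set J \<union> set J' \<subseteq> {1..s}"
    using sets by (auto simp: bos_idx_def fer_idx_def)
  note rest = nord_series_rest[OF this]
  have w: "pair_weight weightF (restrict_monom ?Sf e) I' (permute_list \<sigma> J') =
      pair_weight weightF e I' (permute_list \<sigma> J')" if "\<sigma> permutes {..<\<rho>}" for \<sigma>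
    using that sets(5) by (intro pair_weight_restrict) simp
  have "det_series \<rho> I' J' (restrict_monom ?Sf e) =
      (\<Sum>\<sigma> | \<sigma> permutes {..<\<rho>}.
        (-1) ^ inversions (permute_list \<sigma> J') * pair_weight weightF e I' (permute_list \<sigma> J'))"
    by (simp add: det_series_eq[OF I' J'] w)
  then show ?thesis
    by (simp only: ser_mult_det[OF I' J' Un_upper2 Un_upper2] restrict_restrict_monom S1 S2 rest
        smult_alg_sum_left)
qed

text \<open>The fermion counts are sums over \<open>J'\<close> and ignore its order; only the
  inversions and the weight see the permutation.\<close>

lemma full_term_permute:
  assumes I: "I \<in> incr_tuples S \<eta>" "J \<in> incr_tuples T \<eta>" "\<sigma> permutes {..<\<eta>}"
    and I': "I' \<in> incr_tuples S' \<rho>" "J' \<in> incr_tuples T' \<rho>" "\<sigma>' permutes {..<\<rho>}"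
  shows "full_term I (permute_list \<sigma> J) I' (permute_list \<sigma>' J') =
    (pair_weight weightB e I (permute_list \<sigma> J) *
      ((-1) ^ ((\<Sum>i\<leftarrow>I'. fer_count r a i) + (\<Sum>j\<leftarrow>J'. fer_count s b j))
      * (-1) ^ (card (fer_idx r a) * \<rho> + \<rho> * (\<rho> + 1) div 2)
      * ((-1) ^ inversions (permute_list \<sigma>' J') * pair_weight weightF e I' (permute_list \<sigma>' J')))) \<odot>
    rest_nord (set I \<union> set I') (set J \<union> set J')"
proof -
  have len: "length J = \<eta>" "length I' = \<rho>" "length J' = \<rho>" using I I' by (auto simp: incr_tuples_def)
  have "full_sign I' (permute_list \<sigma>' J') =
      ((\<Sum>i\<leftarrow>I'. fer_count r a i) + (\<Sum>j\<leftarrow>J'. fer_count s b j))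
      + (card (fer_idx r a) * \<rho> + \<rho> * (\<rho> + 1) div 2)"
    using I'(3) len by (simp only: full_sign_def sum_list_permute_list)
  then show ?thesis
    using I(3) I'(3) len by (simp add: full_term_def power_add mult.assoc)
qed

lemma perm_term:
  assumes I: "I \<in> incr_tuples (bos_idx r a) \<eta>" and J: "J \<in> incr_tuples (bos_idx s b) \<eta>"
  shows "ser_mult (ser_const (perm_series \<eta> I J))
      (\<lambda>e'. \<Sum>I' \<in> incr_tuples (fer_idx r a) \<rho>. \<Sum>J' \<in> incr_tuples (fer_idx s b) \<rho>.
        (-1) ^ ((\<Sum>i\<leftarrow>I'. fer_count r a i) + (\<Sum>j\<leftarrow>J'. fer_count s b j))
        * (-1) ^ (card (fer_idx r a) * \<rho> + \<rho> * (\<rho> + 1) div 2)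
        * ser_mult (ser_const (det_series \<rho> I' J'))
            (nord_series (fields r a m X (set I \<union> set I') @ fields s b n Y (set J \<union> set J'))) e') e =
    (\<Sum>\<sigma> | \<sigma> permutes {..<\<eta>}.
      \<Sum>I' \<in> incr_tuples (fer_idx r a) \<rho>. \<Sum>J' \<in> incr_tuples (fer_idx s b) \<rho>.
      \<Sum>\<sigma>' | \<sigma>' permutes {..<\<rho>}. full_term I (permute_list \<sigma> J) I' (permute_list \<sigma>' J'))"
    (is "ser_mult _ ?G e = _")
proof -
  let ?Sb = "X ` set I \<union> Y ` set J"
  let ?s = "\<lambda>I' J'. (-1) ^ ((\<Sum>i\<leftarrow>I'. fer_count r a i) + (\<Sum>j\<leftarrow>J'. fer_count s b j))
      * (-1) ^ (card (fer_idx r a) * \<rho> + \<rho> * (\<rho> + 1) div 2) :: complex"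
  have sets: "set I \<subseteq> bos_idx r a" "set J \<subseteq> bos_idx s b" "length J = \<eta>"
    using assms by (auto simp: incr_tuples_def)
  have "ser_mult (ser_const (perm_series \<eta> I J)) ?G e =
      ser_const (perm_series \<eta> I J) (restrict_monom ?Sb e) * ?G (restrict_monom (- ?Sb) e)"
  proof (rule ser_mult_disjoint)
    show "Poly_Mapping.keys d \<subseteq> ?Sb" if "ser_const (perm_series \<eta> I J) d \<noteq> 0" for d
      using that by (simp add: ser_const_def perm_series_eq[OF I J] split: if_splits)
    \<comment> \<open>A nonzero sum has a nonzero summand. Its determinant involves only fermionic
      positions and its normally ordered part omits the bosonic pairs, so no variable of the
      permanent occurs.\<close>
    show "Poly_Mapping.keys d \<inter> ?Sb = {}" if "?G d \<noteq> 0" for d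
    proof -
      from that obtain I' J' where I': "I' \<in> incr_tuples (fer_idx r a) \<rho>" and J': "J' \<in> incr_tuples (fer_idx s b) \<rho>"
        and nz: "ser_mult (ser_const (det_series \<rho> I' J'))
            (nord_series (fields r a m X (set I \<union> set I') @ fields s b n Y (set J \<union> set J'))) d \<noteq> 0"
        by (metis (no_types, lifting) mult_zero_right sum.neutral)
      let ?Sf = "X ` set I' \<union> Y ` set J'"
      have "nord_series (fields r a m X (set I \<union> set I') @ fields s b n Y (set J \<union> set J'))
          (restrict_monom (- ?Sf) d) \<noteq> 0"
        using nz ser_mult_det[OF I' J' Un_upper2 Un_upper2, of "set I" "set J" d] by auto
      from nord_series_fields_support[OF this]
      have "Poly_Mapping.keys d \<inter> - ?Sf \<inter> ?Sb = {}" by auto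
      moreover have "?Sf \<inter> ?Sb = {}"
        using sets I' J' bos_fer_idx_disjoint[of r a] bos_fer_idx_disjoint[of s b]
        by (auto simp: incr_tuples_def)
      ultimately show ?thesis by blast
    qed
  qed
  also have "ser_const (perm_series \<eta> I J) (restrict_monom ?Sb e) =
      const (\<Sum>\<sigma> | \<sigma> permutes {..<\<eta>}. pair_weight weightB e I (permute_list \<sigma> J))"
  proof -
    have w: "pair_weight weightB (restrict_monom ?Sb e) I (permute_list \<sigma> J) =
        pair_weight weightB e I (permute_list \<sigma> J)" if "\<sigma> permutes {..<\<eta>}" for \<sigma>
      using that sets(3) by (intro pair_weight_restrict) simp
    then show ?thesis by (simp add: ser_const_def perm_series_eq[OF I J])
  qed
  also have "?G (restrict_monom (- ?Sb) e) =
      (\<Sum>I' \<in> incr_tuples (fer_idx r a) \<rho>. \<Sum>J' \<in> incr_tuples (fer_idx s b) \<rho>.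
        \<Sum>\<sigma>' | \<sigma>' permutes {..<\<rho>}. (?s I' J' * ((-1) ^ inversions (permute_list \<sigma>' J')
          * pair_weight weightF e I' (permute_list \<sigma>' J'))) \<odot>
          rest_nord (set I \<union> set I') (set J \<union> set J'))"
    by (intro sum.cong refl)
      (simp only: det_term[OF I J] minus_one_power_const const_mult smult_alg_def[symmetric] smult_alg_sum
        smult_alg_simps, simp only: mult.assoc)
  also have "const (\<Sum>\<sigma> | \<sigma> permutes {..<\<eta>}. pair_weight weightB e I (permute_list \<sigma> J)) * \<dots> =
      (\<Sum>\<sigma> | \<sigma> permutes {..<\<eta>}.
        \<Sum>I' \<in> incr_tuples (fer_idx r a) \<rho>. \<Sum>J' \<in> incr_tuples (fer_idx s b) \<rho>.
        \<Sum>\<sigma>' | \<sigma>' permutes {..<\<rho>}. full_term I (permute_list \<sigma> J) I' (permute_list \<sigma>' J'))"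
    unfolding smult_alg_def[symmetric] smult_alg_sum_left
    unfolding smult_alg_sum smult_alg_simps
    by (intro sum.cong refl)
      (simp add: full_term_permute[OF I J, where S' = "fer_idx r a" and T' = "fer_idx s b"])
  finally show ?thesis .
qed

lemma sum_full_term:
  "(\<Sum>\<rho> = 0..min r s. \<Sum>\<eta> = 0..min r s.
     \<Sum>I \<in> incr_tuples (bos_idx r a) \<eta>. \<Sum>J \<in> incr_tuples (bos_idx s b) \<eta>. \<Sum>\<sigma> | \<sigma> permutes {..<\<eta>}.
     \<Sum>I' \<in> incr_tuples (fer_idx r a) \<rho>. \<Sum>J' \<in> incr_tuples (fer_idx s b) \<rho>. \<Sum>\<sigma>' | \<sigma>' permutes {..<\<rho>}.
       full_term I (permute_list \<sigma> J) I' (permute_list \<sigma>' J')) =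
   (\<Sum>(I, J)\<in>pairings (bos_idx r a) (bos_idx s b). \<Sum>(I', J')\<in>pairings (fer_idx r a) (fer_idx s b).
     full_term I J I' J')"
proof -
  have fin: "finite (bos_idx r a)" "finite (bos_idx s b)" "finite (fer_idx r a)" "finite (fer_idx s b)"
    by (auto simp: bos_idx_def fer_idx_def)
  have "card (bos_idx k c) \<le> k" "card (fer_idx k c) \<le> k" for k and c :: "nat \<Rightarrow> 'h bf"
  proof -
    have *: "card {i \<in> {1..k}. Q i} \<le> k" for Q
      using card_mono[of "{1..k}" "{i \<in> {1..k}. Q i}"] by (simp add: subset_eq)
    show "card (bos_idx k c) \<le> k" "card (fer_idx k c) \<le> k"
      unfolding bos_idx_def fer_idx_def by (rule *)+
  qed
  then have N: "card (bos_idx r a) \<le> min r s \<or> card (bos_idx s b) \<le> min r s"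
    "card (fer_idx r a) \<le> min r s \<or> card (fer_idx s b) \<le> min r s"
    by (auto simp: min_def)
  have fer: "(\<Sum>\<rho> = 0..min r s. \<Sum>I' \<in> incr_tuples (fer_idx r a) \<rho>. \<Sum>J' \<in> incr_tuples (fer_idx s b) \<rho>.
      \<Sum>\<sigma>' | \<sigma>' permutes {..<\<rho>}. full_term I J I' (permute_list \<sigma>' J')) =
      (\<Sum>(I', J')\<in>pairings (fer_idx r a) (fer_idx s b). full_term I J I' J')" for I J
    unfolding sum_permuted_tuples by (rule sum_pairings_by_length[OF fin(3,4) N(2)])
  have "(\<Sum>\<eta> = 0..min r s.
      \<Sum>I \<in> incr_tuples (bos_idx r a) \<eta>. \<Sum>J \<in> incr_tuples (bos_idx s b) \<eta>. \<Sum>\<sigma> | \<sigma> permutes {..<\<eta>}.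
        h I (permute_list \<sigma> J)) =
      (\<Sum>(I, J)\<in>pairings (bos_idx r a) (bos_idx s b). h I J)" for h :: "nat list \<Rightarrow> nat list \<Rightarrow> 'h hhat free_alg"
    unfolding sum_permuted_tuples by (rule sum_pairings_by_length[OF fin(1,2) N(1)])
  note bos = this[of "\<lambda>I J. \<Sum>I' \<in> incr_tuples (fer_idx r a) \<rho>. \<Sum>J' \<in> incr_tuples (fer_idx s b) \<rho>.
      \<Sum>\<sigma>' | \<sigma>' permutes {..<\<rho>}. full_term I J I' (permute_list \<sigma>' J')" for \<rho>]
  show ?thesis
    unfolding bos case_prod_unfold by (subst sum.swap) (simp only: fer case_prod_unfold)
qed

lemma pair_weight_factor:
  assumes "length I = length J" "\<And>i j. i \<in> set I \<Longrightarrow> j \<in> set J \<Longrightarrow>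
    w i j (Poly_Mapping.lookup e (X i)) (Poly_Mapping.lookup e (Y j)) = coeffA i * coeffB j * ctr (modeA i) (modeB j)"
  shows "pair_weight w e I J = (\<Prod>i\<leftarrow>I. coeffA i) * (\<Prod>j\<leftarrow>J. coeffB j) * ctr_prod modeA modeB I J"
  using assms
  by (induction I J rule: list_induct2) (simp_all add: pair_weight_def ctr_prod_def mult_ac)

text \<open>Fermions up to \<open>i\<close> and fermions after \<open>i\<close> add up to r^F, so
  the exponents differ by twice the sum of the r^F(i).\<close>

lemma sign_full_sign:
  "(-1 :: complex) ^ (full_sign I J + inversions J) = (-1) ^ pair_sign r modeA [] modeB [1..<Suc s] I J"
proof -
  have "(\<Sum>i\<leftarrow>I. fer_count r a i) + (\<Sum>i\<leftarrow>I. fer_below r modeA i) = card (fer_idx r a) * length I"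
    using fer_count_below[of modeA a r] by (induction I) (simp_all add: algebra_simps)
  moreover have "(\<Sum>j\<leftarrow>J. fer_upto modeB [1..<Suc s] j) = (\<Sum>j\<leftarrow>J. fer_count s b j)"
    using fer_upto_eq_count[of modeB b s] by simp
  ultimately have "full_sign I J + inversions J =
      pair_sign r modeA [] modeB [1..<Suc s] I J + 2 * (\<Sum>i\<leftarrow>I. fer_count r a i)"
    unfolding full_sign_def pair_sign_def fer_no_simps by linarith
  then show ?thesis by (simp add: power_add power_mult)
qed

text \<open>The scalars of the contracted fields, contained in the pair weights, complete those of
  the remaining fields to \<open>coeff_all\<close>.\<close>

lemma full_term_eq_pair_term:
  assumes IJ: "(I, J) \<in> pairings (bos_idx r a) (bos_idx s b)"
    and IJ': "(I', J') \<in> pairings (fer_idx r a) (fer_idx s b)"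
  shows "full_term I J I' J' =
    (if in_range then coeff_all \<odot> pair_term r modeA [] modeB [1..<Suc s] I J I' J' else 0)"
proof -
  have sets: "set I \<subseteq> bos_idx r a" "set J \<subseteq> bos_idx s b" "distinct I" "distinct J" "length I = length J"
    "set I' \<subseteq> fer_idx r a" "set J' \<subseteq> fer_idx s b" "distinct I'" "distinct J'" "length I' = length J'"
    using IJ IJ' by (auto simp: pairings_def sorted_wrt_less_distinct)
  have disj: "set I \<inter> set I' = {}" "set J \<inter> set J' = {}"
    using sets bos_fer_idx_disjoint[of r a] bos_fer_idx_disjoint[of s b] by blast+
  have sub: "set I \<union> set I' \<subseteq> {1..r}" "set J \<union> set J' \<subseteq> {1..s}"
    using sets by (auto simp: bos_idx_def fer_idx_def)
  have wB: "pair_weight weightB e I J = (\<Prod>i\<leftarrow>I. coeffA i) * (\<Prod>j\<leftarrow>J. coeffB j) * ctr_prod modeA modeB I J"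
  proof (rule pair_weight_factor[OF sets(5)])
    fix i j assume "i \<in> set I" "j \<in> set J"
    then have "is_bos (a i)" "is_bos (b j)" using sets by (auto simp: bos_idx_def)
    then show "weightB i j (Poly_Mapping.lookup e (X i)) (Poly_Mapping.lookup e (Y j)) =
        coeffA i * coeffB j * ctr (modeA i) (modeB j)"
      unfolding weightB_def coeffA_def coeffB_def modeA_def modeB_def by (rule bos_contraction)
  qed
  have wF: "pair_weight weightF e I' J' = (\<Prod>i\<leftarrow>I'. coeffA i) * (\<Prod>j\<leftarrow>J'. coeffB j) * ctr_prod modeA modeB I' J'"
  proof (rule pair_weight_factor[OF sets(10)])
    fix i j assume "i \<in> set I'" "j \<in> set J'"
    then have "is_fer (a i)" "is_fer (b j)" using sets by (auto simp: fer_idx_def)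
    then show "weightF i j (Poly_Mapping.lookup e (X i)) (Poly_Mapping.lookup e (Y j)) =
        coeffA i * coeffB j * ctr (modeA i) (modeB j)"
      unfolding weightF_def coeffA_def coeffB_def modeA_def modeB_def by (rule fer_contraction)
  qed
  show ?thesis
    unfolding full_term_def rest_nord_def pair_term_def wB wF sign_full_sign coeff_all_def
      prod_list_filter_upt[OF sets(3,8) disj(1) sub(1), of coeffA, symmetric]
      prod_list_filter_upt[OF sets(4,9) disj(2) sub(2), of coeffB, symmetric]
    by (simp add: mult_ac del: upt_Suc)
qed

lemma wick_coefficient:
  "ser_mult (nord_series (fields r a m X {})) (nord_series (fields s b n Y {})) e \<approx>
   (\<Sum>\<rho> = 0..min r s. \<Sum>\<eta> = 0..min r s.
     \<Sum>I \<in> incr_tuples (bos_idx r a) \<eta>. \<Sum>J \<in> incr_tuples (bos_idx s b) \<eta>.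
      ser_mult (ser_const (perm_series \<eta> I J))
      (\<lambda>e'. \<Sum>I' \<in> incr_tuples (fer_idx r a) \<rho>. \<Sum>J' \<in> incr_tuples (fer_idx s b) \<rho>.
        (-1) ^ ((\<Sum>i\<leftarrow>I'. fer_count r a i) + (\<Sum>j\<leftarrow>J'. fer_count s b j))
        * (-1) ^ (card (fer_idx r a) * \<rho> + \<rho> * (\<rho> + 1) div 2)
        * ser_mult (ser_const (det_series \<rho> I' J'))
            (nord_series (fields r a m X (set I \<union> set I') @ fields s b n Y (set J \<union> set J'))) e') e)"
    (is "?L \<approx> ?R")
proof -
  let ?P = "\<lambda>I J I' J'. pair_term r modeA [] modeB [1..<Suc s] I J I' J'"
  have "?R = (\<Sum>(I, J)\<in>pairings (bos_idx r a) (bos_idx s b). \<Sum>(I', J')\<in>pairings (fer_idx r a) (fer_idx s b).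
     full_term I J I' J')"
    unfolding sum_full_term[symmetric] by (intro sum.cong refl perm_term)
  also have "\<dots> = (\<Sum>(I, J)\<in>pairings (bos_idx r a) (bos_idx s b). \<Sum>(I', J')\<in>pairings (fer_idx r a) (fer_idx s b).
     if in_range then coeff_all \<odot> ?P I J I' J' else 0)"
    unfolding case_prod_unfold by (intro sum.cong refl full_term_eq_pair_term) simp_all
  finally have R: "?R = \<dots>" .
  show ?thesis
  proof (cases in_range)
    \<comment> \<open>If \<open>e\<close> involves a foreign variable, both coefficients are
      zero.\<close>
    case False
    then show ?thesis unfolding R product_coeff by (simp add: case_prod_unfold)
  next
    case True
    have sets: "bos_set r modeA = bos_idx r a" "fer_set r modeA = fer_idx r a"
      "{j \<in> set [1..<Suc s]. is_bos (fst (modeB j))} = bos_idx s b"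
      "{j \<in> set [1..<Suc s]. is_fer (fst (modeB j))} = fer_idx s b"
      by (auto simp: bos_set_def fer_set_def bos_idx_def fer_idx_def)
    have sorted: "sorted_wrt (<) [1..<Suc s]" by (rule sorted_wrt_upt)
    have "?L = coeff_all \<odot> (nord (rev (rev (map modeA [1..<Suc r]))) * nord (map modeB [1..<Suc s]))"
      unfolding product_coeff using True by (simp del: upt_Suc)
    also have "\<dots> \<approx> coeff_all \<odot> wick_sum (rev (map modeA [1..<Suc r])) [] (map modeB [1..<Suc s])"
      by (intro op_eq_smult nord_mult_nord)
    also have "\<dots> = ?R"
      unfolding R wick_sum_eq[OF sorted] sets using True
      by (simp add: case_prod_unfold smult_alg_sum del: upt_Suc)
    finally show ?thesis .
  qed
qed

end

theorem theorem6p7: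
  fixes sc :: "complex \<Rightarrow> 'h::ab_group_add \<Rightarrow> 'h" and Basis :: "'h set"
    and form :: "'h \<Rightarrow> 'h \<Rightarrow> complex"
    and lB lF :: complex
    and r s :: nat
    and a b :: "nat \<Rightarrow> 'h bf"
    and m n :: "nat \<Rightarrow> nat"
  assumes "finite_dimensional_vector_space sc Basis"
    and "\<And>u. Vector_Spaces.linear sc (*) (\<lambda>v. form u v)"
    and "\<And>v. Vector_Spaces.linear sc (*) (\<lambda>u. form u v)"
    and "\<And>u v. form u v = form v u"
    and "\<And>u. (\<And>v. form u v = 0) \<Longrightarrow> u = 0"
    and "lB \<noteq> 0" and "lF \<noteq> 0"
    and "r \<ge> 1" and "s \<ge> 1"
    and "\<And>i. i \<in> {1..r} \<Longrightarrow> m i \<ge> 1"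
    and "\<And>j. j \<in> {1..s} \<Longrightarrow> n j \<ge> 1"
  shows
    "(\<lambda>e. V_op sc form lB lF
       (ser_mult (nord_series (fields r a m X {})) (nord_series (fields s b n Y {})) e)) =
     (\<lambda>e. V_op sc form lB lF
       (\<Sum>\<rho> = 0..min r s. \<Sum>\<eta> = 0..min r s.
         \<Sum>IB \<in> incr_tuples (bos_idx r a) \<eta>. \<Sum>JB \<in> incr_tuples (bos_idx s b) \<eta>.
          ser_mult
            (ser_const (ser_perm \<eta> (\<lambda>\<alpha> \<beta> d.
              lB * bf_form form (a (IB ! \<alpha>)) (b (JB ! \<beta>))
                 * FB (m (IB ! \<alpha>)) (n (JB ! \<beta>)) (X (IB ! \<alpha>)) (Y (JB ! \<beta>)) d)))
            (\<lambda>e'. \<Sum>IF \<in> incr_tuples (fer_idx r a) \<rho>. \<Sum>JF \<in> incr_tuples (fer_idx s b) \<rho>.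
              (-1) ^ ((\<Sum>i\<leftarrow>IF. fer_count r a i) + (\<Sum>j\<leftarrow>JF. fer_count s b j))
              * (-1) ^ (card (fer_idx r a) * \<rho> + \<rho> * (\<rho> + 1) div 2)
              * ser_mult
                  (ser_const (ser_det \<rho> (\<lambda>\<gamma> \<delta> d.
                    lF * bf_form form (a (IF ! \<gamma>)) (b (JF ! \<delta>))
                       * FF (m (IF ! \<gamma>)) (n (JF ! \<delta>)) (X (IF ! \<gamma>)) (Y (JF ! \<delta>)) d)))
                  (nord_series (fields r a m X (set IB \<union> set IF)
                                @ fields s b n Y (set JB \<union> set JF)))
                  e')
            e))"
  by (intro ext fock.op_eq_imp_V_op fock_fields.wick_coefficient)

end
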